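(* ${\rm LZFC}+V=L\vdash \neg(TMA)\Leftrightarrow GC$.
   Context: All theories are in the language $\{\in\}$. BST is the theory with axioms: Empty set, Extensionality, Pair, Union, Cartesian Product, "$\omega$ exists", $\Delta_0$-Separation. $Loc({\rm ZFC})$ is the statement $\forall x\exists y(x\in y\wedge Tr(y)\wedge (y,\in)\models{\rm ZFC})$, where $Tr(y)$ means $y$ is transitive; ${\rm LZFC}={\rm BST}+Loc({\rm ZFC})$. "Model" means a (set) transitive model of ZFC. The expressions $|x|=|y|$, $|x|\leq|y|$, $|x|<|y|$ have their usual meaning in terms of existence of bijections/injections. $GC$ ("there is a greatest cardinality") is the statement $(\exists \kappa)(\forall y)(|y|\leq |\kappa|)$, with $\kappa$ ranging over ordinals. $TMA$ (Tall Model Axiom) is the statement $$(\forall \kappa)(\exists \alpha>\kappa)(\forall \delta\geq \alpha)(\exists M)(\delta\in M \wedge M\models |\kappa|<|\alpha|),$$ where $\kappa,\alpha,\delta$ range over ordinals and $M$ over models. $V=L$ says that every set belongs to some $L_\alpha$, $\alpha$ an ordinal (in LZFC each $L_\alpha$ exists, since it can be computed absolutely in any model containing $\alpha$). *)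

theory Defs
  imports Main
begin

section \<open>First-order logic in the language of set theory\<close>

text \<open>Formulas in the language with \<open>\<in>\<close> and equality, with de Bruijn indices for variables.
  The only terms are variables.\<close>

datatype fm = Falsum | Mem nat nat | Equ nat nat | Impl fm fm | Forall fm

definition Neg :: "fm \<Rightarrow> fm" where "Neg p = Impl p Falsum"
definition Conj :: "fm \<Rightarrow> fm \<Rightarrow> fm" where "Conj p q = Neg (Impl p (Neg q))"
definition Disj :: "fm \<Rightarrow> fm \<Rightarrow> fm" where "Disj p q = Impl (Neg p) q"
definition Iff :: "fm \<Rightarrow> fm \<Rightarrow> fm" where "Iff p q = Conj (Impl p q) (Impl q p)"
definition Exists :: "fm \<Rightarrow> fm" where "Exists p = Neg (Forall (Neg p))"

primrec rename :: "(nat \<Rightarrow> nat) \<Rightarrow> fm \<Rightarrow> fm" where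
  "rename f Falsum = Falsum"
| "rename f (Mem i j) = Mem (f i) (f j)"
| "rename f (Equ i j) = Equ (f i) (f j)"
| "rename f (Impl p q) = Impl (rename f p) (rename f q)"
| "rename f (Forall p) = Forall (rename (case_nat 0 (\<lambda>i. Suc (f i))) p)"

definition inst :: "nat \<Rightarrow> fm \<Rightarrow> fm" where
  "inst t p = rename (case_nat t (\<lambda>i. i)) p"

text \<open>Classical natural deduction with equality. Hypotheses form an arbitrary set of formulas;
  free variables of hypotheses are parameters (they are not implicitly generalized).\<close>

inductive proves :: "fm set \<Rightarrow> fm \<Rightarrow> bool" (infix "\<turnstile>" 50) where
  Hyp: "p \<in> T \<Longrightarrow> T \<turnstile> p"
| ImplI: "insert p T \<turnstile> q \<Longrightarrow> T \<turnstile> Impl p q"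
| ImplE: "T \<turnstile> Impl p q \<Longrightarrow> T \<turnstile> p \<Longrightarrow> T \<turnstile> q"
| Contr: "insert (Neg p) T \<turnstile> Falsum \<Longrightarrow> T \<turnstile> p"
| ForallI: "rename Suc ` T \<turnstile> p \<Longrightarrow> T \<turnstile> Forall p"
| ForallE: "T \<turnstile> Forall p \<Longrightarrow> T \<turnstile> inst t p"
| EquI: "T \<turnstile> Equ i i"
| EquE: "T \<turnstile> Equ i j \<Longrightarrow> T \<turnstile> inst i p \<Longrightarrow> T \<turnstile> inst j p"

text \<open>All free indices of \<open>p\<close> are below \<open>free_bound p\<close>.\<close>

primrec free_bound :: "fm \<Rightarrow> nat" where
  "free_bound Falsum = 0"
| "free_bound (Mem i j) = max (Suc i) (Suc j)"
| "free_bound (Equ i j) = max (Suc i) (Suc j)"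
| "free_bound (Impl p q) = max (free_bound p) (free_bound q)"
| "free_bound (Forall p) = free_bound p - 1"

definition closure :: "fm \<Rightarrow> fm" where
  "closure p = (Forall ^^ free_bound p) p"

text \<open>In the last clause the bounding variable is \<open>y\<close> outside the quantifier, so it is not
  the bound variable. A bounded existential quantifier is the negation of a bounded universal one.\<close>

inductive Delta0 :: "fm \<Rightarrow> bool" where
  "Delta0 Falsum"
| "Delta0 (Mem i j)"
| "Delta0 (Equ i j)"
| "Delta0 p \<Longrightarrow> Delta0 q \<Longrightarrow> Delta0 (Impl p q)"
| "Delta0 p \<Longrightarrow> Delta0 (Forall (Impl (Mem 0 (Suc y)) p))"


section \<open>Readable notation for formulas\<close>

text \<open>Concrete formulas are written as functions of the number \<open>d\<close> of quantifiers in whose scope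
  they stand. Inside such a formula a variable is denoted by its level, counted from the outermost
  quantifier: the quantifier met at depth \<open>d\<close> binds level \<open>d\<close>, and level \<open>x < d\<close> is the de Bruijn
  index \<open>d - Suc x\<close> at depth \<open>d\<close>. So HOL variables of type \<^typ>\<open>nat\<close> stand for object variables,
  and nothing has to be shifted under quantifiers. A sentence is obtained at depth \<open>0\<close>; a formula
  in the levels \<open>0, \<dots>, d - 1\<close> is obtained at depth \<open>d\<close>.\<close>

type_synonym form = "nat \<Rightarrow> fm"

definition fMem :: "nat \<Rightarrow> nat \<Rightarrow> form" (infix "\<^bold>\<in>" 50) where
  "(x \<^bold>\<in> y) = (\<lambda>d. Mem (d - Suc x) (d - Suc y))"
definition fEqu :: "nat \<Rightarrow> nat \<Rightarrow> form" (infix "\<^bold>=" 50) where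
  "(x \<^bold>= y) = (\<lambda>d. Equ (d - Suc x) (d - Suc y))"
definition fNot :: "form \<Rightarrow> form" ("\<^bold>\<not> _" [40] 40) where
  "(\<^bold>\<not> P) = (\<lambda>d. Neg (P d))"
definition fAnd :: "form \<Rightarrow> form \<Rightarrow> form" (infixr "\<^bold>\<and>" 35) where
  "(P \<^bold>\<and> Q) = (\<lambda>d. Conj (P d) (Q d))"
definition fOr :: "form \<Rightarrow> form \<Rightarrow> form" (infixr "\<^bold>\<or>" 30) where
  "(P \<^bold>\<or> Q) = (\<lambda>d. Disj (P d) (Q d))"
definition fImp :: "form \<Rightarrow> form \<Rightarrow> form" (infixr "\<^bold>\<longrightarrow>" 25) where
  "(P \<^bold>\<longrightarrow> Q) = (\<lambda>d. Impl (P d) (Q d))"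
definition fIff :: "form \<Rightarrow> form \<Rightarrow> form" (infixr "\<^bold>\<longleftrightarrow>" 25) where
  "(P \<^bold>\<longleftrightarrow> Q) = (\<lambda>d. Iff (P d) (Q d))"
definition fAll :: "(nat \<Rightarrow> form) \<Rightarrow> form" (binder "\<^bold>\<forall>" 10) where
  "fAll P = (\<lambda>d. Forall (P d (Suc d)))"
definition fEx :: "(nat \<Rightarrow> form) \<Rightarrow> form" (binder "\<^bold>\<exists>" 10) where
  "fEx P = (\<lambda>d. Exists (P d (Suc d)))"

definition sentence :: "form \<Rightarrow> fm" where "sentence P = P 0"


section \<open>Basic set theory, as formulas\<close>

definition is_subset :: "nat \<Rightarrow> nat \<Rightarrow> form" where
  "is_subset x y = (\<^bold>\<forall>z. z \<^bold>\<in> x \<^bold>\<longrightarrow> z \<^bold>\<in> y)"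

definition is_zero :: "nat \<Rightarrow> form" where
  "is_zero x = (\<^bold>\<forall>z. \<^bold>\<not> z \<^bold>\<in> x)"

text \<open>\<open>y = x \<union> {x}\<close>\<close>

definition is_succ :: "nat \<Rightarrow> nat \<Rightarrow> form" where
  "is_succ x y = (\<^bold>\<forall>z. z \<^bold>\<in> y \<^bold>\<longleftrightarrow> z \<^bold>\<in> x \<^bold>\<or> z \<^bold>= x)"

definition is_upair :: "nat \<Rightarrow> nat \<Rightarrow> nat \<Rightarrow> form" where
  "is_upair x y p = (\<^bold>\<forall>z. z \<^bold>\<in> p \<^bold>\<longleftrightarrow> z \<^bold>= x \<^bold>\<or> z \<^bold>= y)"

text \<open>\<open>p = (x, y)\<close> (Kuratowski pair)\<close>

definition is_pair :: "nat \<Rightarrow> nat \<Rightarrow> nat \<Rightarrow> form" where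
  "is_pair x y p = (\<^bold>\<exists>u. \<^bold>\<exists>v. is_upair x x u \<^bold>\<and> is_upair x y v \<^bold>\<and> is_upair u v p)"

definition is_trans :: "nat \<Rightarrow> form" where
  "is_trans x = (\<^bold>\<forall>y. y \<^bold>\<in> x \<^bold>\<longrightarrow> is_subset y x)"

text \<open>Transitive and well-ordered by \<open>\<in>\<close>. Irreflexivity and transitivity of \<open>\<in>\<close> on \<open>x\<close> follow
  from the existence of minimal elements.\<close>

definition is_ord :: "nat \<Rightarrow> form" where
  "is_ord x = (is_trans x \<^bold>\<and>
     (\<^bold>\<forall>y. \<^bold>\<forall>z. y \<^bold>\<in> x \<^bold>\<and> z \<^bold>\<in> x \<^bold>\<longrightarrow> y \<^bold>\<in> z \<^bold>\<or> y \<^bold>= z \<^bold>\<or> z \<^bold>\<in> y) \<^bold>\<and>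
     (\<^bold>\<forall>s. is_subset s x \<^bold>\<and> \<^bold>\<not> is_zero s \<^bold>\<longrightarrow>
        (\<^bold>\<exists>u. u \<^bold>\<in> s \<^bold>\<and> (\<^bold>\<forall>v. v \<^bold>\<in> s \<^bold>\<longrightarrow> \<^bold>\<not> v \<^bold>\<in> u))))"

definition is_limit :: "nat \<Rightarrow> form" where
  "is_limit x = (is_ord x \<^bold>\<and> \<^bold>\<not> is_zero x \<^bold>\<and>
     (\<^bold>\<forall>y. y \<^bold>\<in> x \<^bold>\<longrightarrow> (\<^bold>\<exists>z. z \<^bold>\<in> x \<^bold>\<and> y \<^bold>\<in> z)))"

definition is_omega :: "nat \<Rightarrow> form" where
  "is_omega w = (is_limit w \<^bold>\<and> (\<^bold>\<forall>x. x \<^bold>\<in> w \<^bold>\<longrightarrow> \<^bold>\<not> is_limit x))"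

definition is_nat :: "nat \<Rightarrow> form" where
  "is_nat x = (\<^bold>\<exists>w. is_omega w \<^bold>\<and> x \<^bold>\<in> w)"

text \<open>\<open>x\<close> is the von Neumann numeral of the actual natural number \<open>k\<close>\<close>

primrec is_num :: "nat \<Rightarrow> nat \<Rightarrow> form" where
  "is_num 0 = (\<lambda>x. is_zero x)"
| "is_num (Suc k) = (\<lambda>x. \<^bold>\<exists>y. is_num k y \<^bold>\<and> is_succ y x)"

text \<open>\<open>(x, y) \<in> f\<close>\<close>

definition app :: "nat \<Rightarrow> nat \<Rightarrow> nat \<Rightarrow> form" where
  "app f x y = (\<^bold>\<exists>p. is_pair x y p \<^bold>\<and> p \<^bold>\<in> f)"

text \<open>\<open>f\<close> is a function with domain \<open>a\<close>\<close>

definition is_fun :: "nat \<Rightarrow> nat \<Rightarrow> form" where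
  "is_fun f a = ((\<^bold>\<forall>p. p \<^bold>\<in> f \<^bold>\<longrightarrow> (\<^bold>\<exists>x. \<^bold>\<exists>y. x \<^bold>\<in> a \<^bold>\<and> is_pair x y p)) \<^bold>\<and>
     (\<^bold>\<forall>x. x \<^bold>\<in> a \<^bold>\<longrightarrow> (\<^bold>\<exists>y. \<^bold>\<forall>z. app f x z \<^bold>\<longleftrightarrow> z \<^bold>= y)))"

definition maps :: "nat \<Rightarrow> nat \<Rightarrow> nat \<Rightarrow> form" where
  "maps f a b = (is_fun f a \<^bold>\<and> (\<^bold>\<forall>x. \<^bold>\<forall>y. app f x y \<^bold>\<longrightarrow> y \<^bold>\<in> b))"

definition is_injective :: "nat \<Rightarrow> form" where
  "is_injective f = (\<^bold>\<forall>x. \<^bold>\<forall>y. \<^bold>\<forall>z. app f x z \<^bold>\<and> app f y z \<^bold>\<longrightarrow> x \<^bold>= y)"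

definition card_le :: "nat \<Rightarrow> nat \<Rightarrow> form" where
  "card_le x y = (\<^bold>\<exists>f. maps f x y \<^bold>\<and> is_injective f)"

definition card_eq :: "nat \<Rightarrow> nat \<Rightarrow> form" where
  "card_eq x y = (\<^bold>\<exists>f. maps f x y \<^bold>\<and> is_injective f \<^bold>\<and>
     (\<^bold>\<forall>z. z \<^bold>\<in> y \<^bold>\<longrightarrow> (\<^bold>\<exists>u. app f u z)))"

definition card_less :: "nat \<Rightarrow> nat \<Rightarrow> form" where
  "card_less x y = (card_le x y \<^bold>\<and> \<^bold>\<not> card_eq x y)"


section \<open>Single axioms\<close>

definition ax_empty :: form where
  "ax_empty = (\<^bold>\<exists>x. is_zero x)"

definition ax_extensionality :: form where
  "ax_extensionality = (\<^bold>\<forall>x. \<^bold>\<forall>y. (\<^bold>\<forall>z. z \<^bold>\<in> x \<^bold>\<longleftrightarrow> z \<^bold>\<in> y) \<^bold>\<longrightarrow> x \<^bold>= y)"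

definition ax_pair :: form where
  "ax_pair = (\<^bold>\<forall>x. \<^bold>\<forall>y. \<^bold>\<exists>p. is_upair x y p)"

definition ax_union :: form where
  "ax_union = (\<^bold>\<forall>x. \<^bold>\<exists>u. \<^bold>\<forall>z. z \<^bold>\<in> u \<^bold>\<longleftrightarrow> (\<^bold>\<exists>y. y \<^bold>\<in> x \<^bold>\<and> z \<^bold>\<in> y))"

definition ax_product :: form where
  "ax_product = (\<^bold>\<forall>a. \<^bold>\<forall>b. \<^bold>\<exists>c. \<^bold>\<forall>z. z \<^bold>\<in> c \<^bold>\<longleftrightarrow>
     (\<^bold>\<exists>x. \<^bold>\<exists>y. x \<^bold>\<in> a \<^bold>\<and> y \<^bold>\<in> b \<^bold>\<and> is_pair x y z))"

definition ax_omega :: form where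
  "ax_omega = (\<^bold>\<exists>w. is_omega w)"

definition ax_foundation :: form where
  "ax_foundation = (\<^bold>\<forall>x. \<^bold>\<not> is_zero x \<^bold>\<longrightarrow>
     (\<^bold>\<exists>y. y \<^bold>\<in> x \<^bold>\<and> (\<^bold>\<forall>z. z \<^bold>\<in> y \<^bold>\<longrightarrow> \<^bold>\<not> z \<^bold>\<in> x)))"

definition ax_power :: form where
  "ax_power = (\<^bold>\<forall>x. \<^bold>\<exists>p. \<^bold>\<forall>z. z \<^bold>\<in> p \<^bold>\<longleftrightarrow> is_subset z x)"

definition ax_infinity :: form where
  "ax_infinity = (\<^bold>\<exists>w. (\<^bold>\<exists>e. is_zero e \<^bold>\<and> e \<^bold>\<in> w) \<^bold>\<and>
     (\<^bold>\<forall>x. x \<^bold>\<in> w \<^bold>\<longrightarrow> (\<^bold>\<exists>y. is_succ x y \<^bold>\<and> y \<^bold>\<in> w)))"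

definition ax_choice :: form where
  "ax_choice = (\<^bold>\<forall>a. (\<^bold>\<forall>x. x \<^bold>\<in> a \<^bold>\<longrightarrow> \<^bold>\<not> is_zero x) \<^bold>\<longrightarrow>
     (\<^bold>\<exists>f. is_fun f a \<^bold>\<and> (\<^bold>\<forall>x. \<^bold>\<forall>y. x \<^bold>\<in> a \<^bold>\<and> app f x y \<^bold>\<longrightarrow> y \<^bold>\<in> x)))"


section \<open>BST\<close>

text \<open>The instance \<open>\<forall>a. \<exists>b. \<forall>x. x \<in> b \<longleftrightarrow> x \<in> a \<and> p\<close>, universally closed. In \<open>p\<close>, index \<open>0\<close> is \<open>x\<close>
  and the other free indices are parameters, which have to be moved past \<open>b\<close> and \<open>a\<close>.\<close>

definition separation :: "fm \<Rightarrow> fm" where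
  "separation p = closure (Forall (Exists (Forall
     (Iff (Mem 0 1) (Conj (Mem 0 2) (rename (case_nat 0 (\<lambda>i. i + 3)) p))))))"

definition BST :: "fm set" where
  "BST = sentence ` {ax_empty, ax_extensionality, ax_pair, ax_union, ax_product, ax_omega}
     \<union> {separation p | p. Delta0 p}"


section \<open>Formulas and satisfaction inside set theory\<close>

text \<open>Formulas are coded by sets, using named variables \<open>v\<^sub>i\<close> for \<open>i \<in> \<omega>\<close>:
  \<open>\<bottom> \<mapsto> (0,(0,0))\<close>, \<open>v\<^sub>i \<in> v\<^sub>j \<mapsto> (1,(i,j))\<close>, \<open>v\<^sub>i = v\<^sub>j \<mapsto> (2,(i,j))\<close>, \<open>p \<longrightarrow> q \<mapsto> (3,(p,q))\<close>,
  \<open>\<forall>v\<^sub>i. p \<mapsto> (4,(i,p))\<close>.\<close>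

definition is_node :: "nat \<Rightarrow> nat \<Rightarrow> nat \<Rightarrow> nat \<Rightarrow> form" where
  "is_node k a b c = (\<^bold>\<exists>t. \<^bold>\<exists>p. is_num k t \<^bold>\<and> is_pair a b p \<^bold>\<and> is_pair t p c)"

definition code_Falsum :: "nat \<Rightarrow> form" where
  "code_Falsum c = (\<^bold>\<exists>e. is_zero e \<^bold>\<and> is_node 0 e e c)"
abbreviation "code_Mem \<equiv> is_node 1"
abbreviation "code_Equ \<equiv> is_node 2"
abbreviation "code_Impl \<equiv> is_node 3"
abbreviation "code_Forall \<equiv> is_node 4"

text \<open>\<open>f\<close> is a formation sequence of length \<open>k \<in> \<omega>\<close> whose formulas only contain (free or bound)
  variables \<open>v\<^sub>i\<close> with \<open>i \<in> w\<close>.\<close>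

definition formation_seq :: "nat \<Rightarrow> nat \<Rightarrow> nat \<Rightarrow> form" where
  "formation_seq f k w = (is_nat k \<^bold>\<and> is_fun f k \<^bold>\<and>
     (\<^bold>\<forall>i. \<^bold>\<forall>c. i \<^bold>\<in> k \<^bold>\<and> app f i c \<^bold>\<longrightarrow>
        code_Falsum c \<^bold>\<or>
        (\<^bold>\<exists>u. \<^bold>\<exists>v. u \<^bold>\<in> w \<^bold>\<and> v \<^bold>\<in> w \<^bold>\<and> (code_Mem u v c \<^bold>\<or> code_Equ u v c)) \<^bold>\<or>
        (\<^bold>\<exists>j. \<^bold>\<exists>l. \<^bold>\<exists>p. \<^bold>\<exists>q. j \<^bold>\<in> i \<^bold>\<and> l \<^bold>\<in> i \<^bold>\<and> app f j p \<^bold>\<and> app f l q \<^bold>\<and> code_Impl p q c) \<^bold>\<or>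
        (\<^bold>\<exists>u. \<^bold>\<exists>j. \<^bold>\<exists>p. u \<^bold>\<in> w \<^bold>\<and> j \<^bold>\<in> i \<^bold>\<and> app f j p \<^bold>\<and> code_Forall u p c)))"

definition is_formula :: "nat \<Rightarrow> nat \<Rightarrow> form" where
  "is_formula w c = (\<^bold>\<exists>f. \<^bold>\<exists>k. \<^bold>\<exists>i. formation_seq f k w \<^bold>\<and> app f i c)"

text \<open>\<open>S\<close> is a satisfaction relation for \<open>(A,\<in>)\<close>: a relation between the formulas in the range of
  \<open>f\<close> and the assignments \<open>s : n \<rightarrow> A\<close>, obeying the Tarski clauses.\<close>

definition satisfaction_rel :: "nat \<Rightarrow> nat \<Rightarrow> nat \<Rightarrow> nat \<Rightarrow> form" where
  "satisfaction_rel A n f S = (\<^bold>\<forall>i. \<^bold>\<forall>c. \<^bold>\<forall>s. app f i c \<^bold>\<and> maps s n A \<^bold>\<longrightarrow>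
     (code_Falsum c \<^bold>\<longrightarrow> \<^bold>\<not> app S c s) \<^bold>\<and>
     (\<^bold>\<forall>u. \<^bold>\<forall>v. code_Mem u v c \<^bold>\<longrightarrow>
        (app S c s \<^bold>\<longleftrightarrow> (\<^bold>\<exists>x. \<^bold>\<exists>y. app s u x \<^bold>\<and> app s v y \<^bold>\<and> x \<^bold>\<in> y))) \<^bold>\<and>
     (\<^bold>\<forall>u. \<^bold>\<forall>v. code_Equ u v c \<^bold>\<longrightarrow>
        (app S c s \<^bold>\<longleftrightarrow> (\<^bold>\<exists>x. \<^bold>\<exists>y. app s u x \<^bold>\<and> app s v y \<^bold>\<and> x \<^bold>= y))) \<^bold>\<and>
     (\<^bold>\<forall>p. \<^bold>\<forall>q. code_Impl p q c \<^bold>\<longrightarrow>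
        (app S c s \<^bold>\<longleftrightarrow> (app S p s \<^bold>\<longrightarrow> app S q s))) \<^bold>\<and>
     (\<^bold>\<forall>u. \<^bold>\<forall>p. code_Forall u p c \<^bold>\<longrightarrow>
        (app S c s \<^bold>\<longleftrightarrow>
          (\<^bold>\<forall>t. maps t n A \<^bold>\<and> (\<^bold>\<forall>j. \<^bold>\<forall>x. \<^bold>\<not> j \<^bold>= u \<^bold>\<longrightarrow> (app t j x \<^bold>\<longleftrightarrow> app s j x)) \<^bold>\<longrightarrow>
             app S p t))))"

text \<open>\<open>c\<close> is a formula in the variables \<open>v\<^sub>i\<close>, \<open>i < n\<close>, and \<open>S\<close> decides its satisfaction in \<open>(A,\<in>)\<close>
  by all assignments \<open>n \<rightarrow> A\<close>.\<close>

definition evaluates :: "nat \<Rightarrow> nat \<Rightarrow> nat \<Rightarrow> nat \<Rightarrow> form" where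
  "evaluates S A c n = (is_nat n \<^bold>\<and>
     (\<^bold>\<exists>f. \<^bold>\<exists>k. \<^bold>\<exists>i. formation_seq f k n \<^bold>\<and> app f i c \<^bold>\<and> satisfaction_rel A n f S))"

text \<open>\<open>(A,\<in>) \<Turnstile> c[s]\<close>\<close>

definition satisfies :: "nat \<Rightarrow> nat \<Rightarrow> nat \<Rightarrow> form" where
  "satisfies A c s = (\<^bold>\<exists>n. \<^bold>\<exists>S. evaluates S A c n \<^bold>\<and> maps s n A \<^bold>\<and> app S c s)"

text \<open>\<open>(A,\<in>) \<Turnstile> c\<close>; a formula with free variables is true iff its universal closure is.\<close>

definition true_in :: "nat \<Rightarrow> nat \<Rightarrow> form" where
  "true_in A c = (\<^bold>\<exists>n. \<^bold>\<exists>S. evaluates S A c n \<^bold>\<and> (\<^bold>\<forall>s. maps s n A \<^bold>\<longrightarrow> app S c s))"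


section \<open>The axioms of ZFC inside set theory\<close>

text \<open>A code is described by the formula, with one argument, that defines it. The following
  operations are the syntax operations on codes; their variable arguments denote elements
  of \<open>\<omega>\<close>.\<close>

type_synonym code = "nat \<Rightarrow> form"

definition cVar :: "nat \<Rightarrow> code" where "cVar p = (\<lambda>c. c \<^bold>= p)"
definition cFalse :: code where "cFalse = (\<lambda>c. code_Falsum c)"
definition cMem :: "nat \<Rightarrow> nat \<Rightarrow> code" where "cMem u v = (\<lambda>c. code_Mem u v c)"
definition cEqu :: "nat \<Rightarrow> nat \<Rightarrow> code" where "cEqu u v = (\<lambda>c. code_Equ u v c)"
definition cImp :: "code \<Rightarrow> code \<Rightarrow> code" where
  "cImp P Q = (\<lambda>c. \<^bold>\<exists>p. \<^bold>\<exists>q. P p \<^bold>\<and> Q q \<^bold>\<and> code_Impl p q c)"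
definition cAll :: "nat \<Rightarrow> code \<Rightarrow> code" where
  "cAll u P = (\<lambda>c. \<^bold>\<exists>p. P p \<^bold>\<and> code_Forall u p c)"
definition cNot :: "code \<Rightarrow> code" where "cNot P = cImp P cFalse"
definition cAnd :: "code \<Rightarrow> code \<Rightarrow> code" where "cAnd P Q = cNot (cImp P (cNot Q))"
definition cIff :: "code \<Rightarrow> code \<Rightarrow> code" where "cIff P Q = cAnd (cImp P Q) (cImp Q P)"
definition cEx :: "nat \<Rightarrow> code \<Rightarrow> code" where "cEx u P = cNot (cAll u (cNot P))"

text \<open>The code of an actual formula standing at depth \<open>d\<close>: levels become the names of variables.\<close>

primrec code_of :: "fm \<Rightarrow> nat \<Rightarrow> code" where
  "code_of Falsum = (\<lambda>d. cFalse)"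
| "code_of (Mem i j) = (\<lambda>d c. \<^bold>\<exists>u. \<^bold>\<exists>v. is_num (d - Suc i) u \<^bold>\<and> is_num (d - Suc j) v \<^bold>\<and> cMem u v c)"
| "code_of (Equ i j) = (\<lambda>d c. \<^bold>\<exists>u. \<^bold>\<exists>v. is_num (d - Suc i) u \<^bold>\<and> is_num (d - Suc j) v \<^bold>\<and> cEqu u v c)"
| "code_of (Impl p q) = (\<lambda>d. cImp (code_of p d) (code_of q d))"
| "code_of (Forall p) = (\<lambda>d c. \<^bold>\<exists>u. is_num d u \<^bold>\<and> cAll u (code_of p (Suc d)) c)"

text \<open>\<open>c\<close> is \<open>\<forall>a. \<exists>b. \<forall>x. x \<in> b \<longleftrightarrow> x \<in> a \<and> p\<close> for a formula \<open>p\<close> not containing \<open>b\<close>.\<close>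

definition is_separation :: "nat \<Rightarrow> form" where
  "is_separation c = (\<^bold>\<exists>om. \<^bold>\<exists>w. \<^bold>\<exists>p. \<^bold>\<exists>a. \<^bold>\<exists>b. \<^bold>\<exists>x.
     is_omega om \<^bold>\<and> is_subset w om \<^bold>\<and> a \<^bold>\<in> om \<^bold>\<and> b \<^bold>\<in> om \<^bold>\<and> x \<^bold>\<in> om \<^bold>\<and>
     \<^bold>\<not> a \<^bold>= b \<^bold>\<and> \<^bold>\<not> a \<^bold>= x \<^bold>\<and> \<^bold>\<not> b \<^bold>= x \<^bold>\<and> is_formula w p \<^bold>\<and> \<^bold>\<not> b \<^bold>\<in> w \<^bold>\<and>
     cAll a (cEx b (cAll x (cIff (cMem x b) (cAnd (cMem x a) (cVar p))))) c)"

text \<open>\<open>c\<close> is \<open>\<forall>a. (\<forall>x \<in> a. \<exists>!y. p) \<longrightarrow> (\<exists>b. \<forall>x \<in> a. \<exists>y \<in> b. p)\<close> for a formula \<open>p\<close> not containing \<open>b\<close>,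
  where \<open>\<exists>!y. p\<close> is expressed as \<open>\<exists>b. \<forall>y. p \<longleftrightarrow> y = b\<close>.\<close>

definition is_replacement :: "nat \<Rightarrow> form" where
  "is_replacement c = (\<^bold>\<exists>om. \<^bold>\<exists>w. \<^bold>\<exists>p. \<^bold>\<exists>a. \<^bold>\<exists>b. \<^bold>\<exists>x. \<^bold>\<exists>y.
     is_omega om \<^bold>\<and> is_subset w om \<^bold>\<and> a \<^bold>\<in> om \<^bold>\<and> b \<^bold>\<in> om \<^bold>\<and> x \<^bold>\<in> om \<^bold>\<and> y \<^bold>\<in> om \<^bold>\<and>
     \<^bold>\<not> a \<^bold>= b \<^bold>\<and> \<^bold>\<not> a \<^bold>= x \<^bold>\<and> \<^bold>\<not> a \<^bold>= y \<^bold>\<and> \<^bold>\<not> b \<^bold>= x \<^bold>\<and> \<^bold>\<not> b \<^bold>= y \<^bold>\<and> \<^bold>\<not> x \<^bold>= y \<^bold>\<and>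
     is_formula w p \<^bold>\<and> \<^bold>\<not> b \<^bold>\<in> w \<^bold>\<and>
     cAll a (cImp
       (cAll x (cImp (cMem x a) (cEx b (cAll y (cIff (cVar p) (cEqu y b))))))
       (cEx b (cAll x (cImp (cMem x a) (cEx y (cAnd (cMem y b) (cVar p))))))) c)"

definition is_ZFC_axiom :: "nat \<Rightarrow> form" where
  "is_ZFC_axiom c = (
     code_of (sentence ax_extensionality) 0 c \<^bold>\<or>
     code_of (sentence ax_foundation) 0 c \<^bold>\<or>
     code_of (sentence ax_pair) 0 c \<^bold>\<or>
     code_of (sentence ax_union) 0 c \<^bold>\<or>
     code_of (sentence ax_power) 0 c \<^bold>\<or>
     code_of (sentence ax_infinity) 0 c \<^bold>\<or>
     code_of (sentence ax_choice) 0 c \<^bold>\<or>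
     is_separation c \<^bold>\<or> is_replacement c)"

text \<open>\<open>(M,\<in>) \<Turnstile> ZFC\<close>; structures are nonempty.\<close>

definition satisfies_ZFC :: "nat \<Rightarrow> form" where
  "satisfies_ZFC M = (\<^bold>\<not> is_zero M \<^bold>\<and> (\<^bold>\<forall>c. is_ZFC_axiom c \<^bold>\<longrightarrow> true_in M c))"

definition is_model :: "nat \<Rightarrow> form" where
  "is_model M = (is_trans M \<^bold>\<and> satisfies_ZFC M)"


section \<open>LZFC\<close>

definition Loc_ZFC :: form where
  "Loc_ZFC = (\<^bold>\<forall>x. \<^bold>\<exists>y. x \<^bold>\<in> y \<^bold>\<and> is_trans y \<^bold>\<and> satisfies_ZFC y)"

definition LZFC :: "fm set" where
  "LZFC = insert (sentence Loc_ZFC) BST"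


section \<open>Constructibility\<close>

text \<open>\<open>X = {a \<in> A. (A,\<in>) \<Turnstile> c[r,a]}\<close> for some formula \<open>c\<close> in the variables \<open>v\<^sub>0, \<dots>, v\<^sub>m\<close> and parameters
  \<open>r : m \<rightarrow> A\<close>, where \<open>r,a\<close> is the assignment \<open>t\<close> extending \<open>r\<close> by \<open>v\<^sub>m \<mapsto> a\<close>. For \<open>A = \<emptyset>\<close> the choice
  \<open>m = 0\<close> remains, so \<open>\<emptyset>\<close> is definable over \<open>\<emptyset>\<close>.\<close>

definition is_definable_subset :: "nat \<Rightarrow> nat \<Rightarrow> form" where
  "is_definable_subset X A = (\<^bold>\<exists>m. \<^bold>\<exists>n. \<^bold>\<exists>c. \<^bold>\<exists>r. \<^bold>\<exists>S.
     is_nat m \<^bold>\<and> is_succ m n \<^bold>\<and> evaluates S A c n \<^bold>\<and> maps r m A \<^bold>\<and>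
     (\<^bold>\<forall>a. a \<^bold>\<in> X \<^bold>\<longleftrightarrow> a \<^bold>\<in> A \<^bold>\<and>
        (\<^bold>\<exists>t. maps t n A \<^bold>\<and> is_subset r t \<^bold>\<and> app t m a \<^bold>\<and> app S c t)))"

text \<open>\<open>D = Def(A)\<close>\<close>

definition is_Def :: "nat \<Rightarrow> nat \<Rightarrow> form" where
  "is_Def A D = (\<^bold>\<forall>X. X \<^bold>\<in> D \<^bold>\<longleftrightarrow> is_definable_subset X A)"

text \<open>\<open>f\<close> is the sequence \<open>(L\<^sub>\<beta>)\<close> for \<open>\<beta> < \<alpha>\<close>.\<close>

definition is_L_hierarchy :: "nat \<Rightarrow> nat \<Rightarrow> form" where
  "is_L_hierarchy f \<alpha> = (is_ord \<alpha> \<^bold>\<and> is_fun f \<alpha> \<^bold>\<and>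
     (\<^bold>\<forall>\<beta>. \<^bold>\<forall>y. \<beta> \<^bold>\<in> \<alpha> \<^bold>\<and> app f \<beta> y \<^bold>\<longrightarrow>
        (is_zero \<beta> \<^bold>\<longrightarrow> is_zero y) \<^bold>\<and>
        (\<^bold>\<forall>\<gamma>. \<^bold>\<forall>z. is_succ \<gamma> \<beta> \<^bold>\<and> app f \<gamma> z \<^bold>\<longrightarrow> is_Def z y) \<^bold>\<and>
        (is_limit \<beta> \<^bold>\<longrightarrow>
          (\<^bold>\<forall>x. x \<^bold>\<in> y \<^bold>\<longleftrightarrow> (\<^bold>\<exists>\<gamma>. \<^bold>\<exists>z. \<gamma> \<^bold>\<in> \<beta> \<^bold>\<and> app f \<gamma> z \<^bold>\<and> x \<^bold>\<in> z)))))"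

text \<open>\<open>y = L\<^sub>\<beta>\<close>\<close>

definition is_L :: "nat \<Rightarrow> nat \<Rightarrow> form" where
  "is_L \<beta> y = (\<^bold>\<exists>f. \<^bold>\<exists>\<alpha>. is_L_hierarchy f \<alpha> \<^bold>\<and> \<beta> \<^bold>\<in> \<alpha> \<^bold>\<and> app f \<beta> y)"

definition V_eq_L :: form where
  "V_eq_L = (\<^bold>\<forall>x. \<^bold>\<exists>\<beta>. \<^bold>\<exists>y. is_ord \<beta> \<^bold>\<and> is_L \<beta> y \<^bold>\<and> x \<^bold>\<in> y)"


section \<open>Greatest cardinality and the Tall Model Axiom\<close>

definition GC :: form where
  "GC = (\<^bold>\<exists>\<kappa>. is_ord \<kappa> \<^bold>\<and> (\<^bold>\<forall>y. card_le y \<kappa>))"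

text \<open>\<open>(M,\<in>) \<Turnstile> \<bar>x\<bar> < \<bar>y\<bar>\<close>: satisfaction of the code of \<open>\<bar>v\<^sub>0\<bar> < \<bar>v\<^sub>1\<bar>\<close>, that is of the formula
  \<^term>\<open>card_less 0 1\<close> in the levels \<open>0\<close> and \<open>1\<close>, by an assignment with \<open>v\<^sub>0 \<mapsto> x\<close> and \<open>v\<^sub>1 \<mapsto> y\<close>.\<close>

definition models_card_less :: "nat \<Rightarrow> nat \<Rightarrow> nat \<Rightarrow> form" where
  "models_card_less M x y = (\<^bold>\<exists>c. \<^bold>\<exists>s. \<^bold>\<exists>u. \<^bold>\<exists>v.
     code_of (card_less 0 1 2) 2 c \<^bold>\<and> is_num 0 u \<^bold>\<and> is_num 1 v \<^bold>\<and> app s u x \<^bold>\<and> app s v y \<^bold>\<and>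
     satisfies M c s)"

definition TMA :: form where
  "TMA = (\<^bold>\<forall>\<kappa>. is_ord \<kappa> \<^bold>\<longrightarrow>
     (\<^bold>\<exists>\<alpha>. is_ord \<alpha> \<^bold>\<and> \<kappa> \<^bold>\<in> \<alpha> \<^bold>\<and>
       (\<^bold>\<forall>\<delta>. is_ord \<delta> \<^bold>\<and> (\<alpha> \<^bold>\<in> \<delta> \<^bold>\<or> \<alpha> \<^bold>= \<delta>) \<^bold>\<longrightarrow>
         (\<^bold>\<exists>M. is_model M \<^bold>\<and> \<delta> \<^bold>\<in> M \<^bold>\<and> models_card_less M \<kappa> \<alpha>))))"

end

theory Submission
  imports Defs "HOL-Library.Countable" "HOL-Library.Infinite_Set"
begin

text \<open>The calculus is complete, so it suffices to argue in an arbitrary structure satisfying LZFC and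
  \<open>V = L\<close>. By \<open>Loc(ZFC)\<close> every set lies in a transitive model of ZFC, and such models supply the
  foundation, separation and replacement that BST lacks.

  Suppose no ordinal is a greatest cardinality, and let \<open>\<kappa>\<close> be an ordinal. Some \<open>y\<close> does not inject into
  \<open>\<kappa>\<close>; a model containing \<open>y\<close> well-orders it, which gives an ordinal \<open>\<alpha> > \<kappa>\<close> that does not inject into
  \<open>\<kappa>\<close> either. Every model containing \<open>\<alpha>\<close> then satisfies \<open>|\<kappa>| < |\<alpha>|\<close>, so TMA holds.

  Conversely, let every set inject into \<open>\<kappa>\<close>, let \<open>\<alpha>\<close> witness TMA for \<open>\<kappa>\<close>, and let \<open>f\<close> be an injection of
  \<open>\<alpha>\<close> into \<open>\<kappa>\<close>. By \<open>V = L\<close>, \<open>f \<in> L\<^sub>\<beta>\<close> for some \<open>\<beta>\<close>. The hierarchy is absolute, so a model containing a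
  sufficiently large \<open>\<delta>\<close> contains \<open>L\<^sub>\<beta>\<close> and hence \<open>f\<close>. By Schroeder-Bernstein \<open>|\<kappa>| = |\<alpha>|\<close> holds in it,
  against the choice of \<open>\<alpha>\<close>.\<close>

section \<open>Completeness of the calculus\<close>

text \<open>The structure is arbitrary, so its \<open>om\<close> may contain nonstandard numbers.
  Induction in HOL therefore reaches only actual formulas and numerals; coded formulas and formation
  sequences need induction inside the structure. BST separates only with Delta0 formulas, so it does
  not provide the failure set of such an induction. The remedy is to place all parameters, often
  including the model \<open>M\<close> under study, into a second model \<open>N\<close> and to use
  full separation there; absoluteness shows that the set found in \<open>N\<close> is the intended
  one. Satisfaction is accordingly treated in two ways. For actual formulas, coded satisfaction is
  matched with \<open>nsat\<close>. For possibly nonstandard codes, which enter the definition of L,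
  a satisfaction relation of the universe is copied into \<open>M\<close> row by row. No recursion
  theorem is developed inside \<open>M\<close>: formation sequences, satisfaction relations and the
  L hierarchy are given in the universe, and \<open>M\<close> is shown to contain them or their
  restrictions by induction on the length.\<close>

primrec sat :: "('a \<Rightarrow> 'a \<Rightarrow> bool) \<Rightarrow> 'a set \<Rightarrow> (nat \<Rightarrow> 'a) \<Rightarrow> fm \<Rightarrow> bool" where
  "sat E D e Falsum = False"
| "sat E D e (Mem i j) = E (e i) (e j)"
| "sat E D e (Equ i j) = (e i = e j)"
| "sat E D e (Impl p q) = (sat E D e p \<longrightarrow> sat E D e q)"
| "sat E D e (Forall p) = (\<forall>a\<in>D. sat E D (case_nat a e) p)"

lemma sat_Neg [simp]: "sat E D e (Neg p) \<longleftrightarrow> \<not> sat E D e p"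
  and sat_Conj [simp]: "sat E D e (Conj p q) \<longleftrightarrow> sat E D e p \<and> sat E D e q"
  and sat_Disj [simp]: "sat E D e (Disj p q) \<longleftrightarrow> sat E D e p \<or> sat E D e q"
  and sat_Iff [simp]: "sat E D e (Iff p q) \<longleftrightarrow> (sat E D e p \<longleftrightarrow> sat E D e q)"
  and sat_Exists [simp]: "sat E D e (Exists p) \<longleftrightarrow> (\<exists>a\<in>D. sat E D (case_nat a e) p)"
  by (auto simp: Neg_def Conj_def Disj_def Iff_def Exists_def)

lemma case_nat_comp: "(\<lambda>i. case_nat a e (case_nat 0 (\<lambda>i. Suc (f i)) i)) = case_nat a (\<lambda>i. e (f i))"
  by (auto split: nat.split)

lemma sat_rename: "sat E D e (rename f p) \<longleftrightarrow> sat E D (\<lambda>i. e (f i)) p"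
  by (induction p arbitrary: e f) (simp_all add: case_nat_comp)

lemma sat_cong:
  "(\<And>i. i < free_bound p \<Longrightarrow> e i = e' i) \<Longrightarrow> sat E D e p \<longleftrightarrow> sat E D e' p"
proof (induction p arbitrary: e e')
  case (Forall p)
  have "sat E D (case_nat a e) p \<longleftrightarrow> sat E D (case_nat a e') p" for a
    by (rule Forall.IH) (use Forall.prems in \<open>auto split: nat.split\<close>)
  then show ?case by simp
next
  case (Impl p q)
  have "sat E D e p \<longleftrightarrow> sat E D e' p" "sat E D e q \<longleftrightarrow> sat E D e' q"
    by (rule Impl.IH; use Impl.prems in simp)+
  then show ?case by simp
qed auto

lemma sat_bij:
  assumes "bij_betw b D' D" "\<And>i. e i \<in> D'"
  shows "sat (\<lambda>x y. E (b x) (b y)) D' e p \<longleftrightarrow> sat E D (\<lambda>i. b (e i)) p"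
  using assms(2)
proof (induction p arbitrary: e)
  case (Equ i j)
  then show ?case using assms(1) by (auto simp: bij_betw_def inj_on_def)
next
  case (Forall p)
  have "sat (\<lambda>x y. E (b x) (b y)) D' (case_nat a e) p \<longleftrightarrow> sat E D (case_nat (b a) (\<lambda>i. b (e i))) p"
    if "a \<in> D'" for a
  proof -
    have "(\<lambda>i. b (case_nat a e i)) = case_nat (b a) (\<lambda>i. b (e i))"
      by (auto split: nat.split)
    then show ?thesis
      using Forall.IH[of "case_nat a e"] Forall.prems that by (auto split: nat.split)
  qed
  moreover have "D = b ` D'" using assms(1) by (simp add: bij_betw_def)
  ultimately show ?case by simp
qed auto

section \<open>Renaming of formulas and derivations\<close>

lemma rename_rename: "rename f (rename g p) = rename (\<lambda>i. f (g i)) p"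
proof (induction p arbitrary: f g)
  case (Forall p)
  have "(\<lambda>i. case_nat 0 (\<lambda>i. Suc (f i)) (case_nat 0 (\<lambda>i. Suc (g i)) i)) =
      case_nat 0 (\<lambda>i. Suc (f (g i)))"
    by (auto split: nat.split)
  then show ?case by (simp add: Forall)
qed auto

lemma case_nat_0_Suc: "case_nat 0 (\<lambda>i. Suc i) = (\<lambda>i. i)"
  by (auto split: nat.split)

lemma rename_id: "rename (\<lambda>i. i) p = p"
  by (induction p) (simp_all add: case_nat_0_Suc)

lemma rename_cong:
  "(\<And>i. i < free_bound p \<Longrightarrow> f i = g i) \<Longrightarrow> rename f p = rename g p"
proof (induction p arbitrary: f g)
  case (Forall p)
  have "rename (case_nat 0 (\<lambda>i. Suc (f i))) p = rename (case_nat 0 (\<lambda>i. Suc (g i))) p"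
    by (rule Forall.IH) (use Forall.prems in \<open>auto split: nat.split\<close>)
  then show ?case by simp
next
  case (Impl p q)
  have "rename f p = rename g p" "rename f q = rename g q"
    by (rule Impl.IH; use Impl.prems in simp)+
  then show ?case by simp
qed auto

lemma rename_inst: "rename f (inst t p) = inst (f t) (rename (case_nat 0 (\<lambda>i. Suc (f i))) p)"
  unfolding inst_def rename_rename by (rule arg_cong[where f="\<lambda>g. rename g p"]) (auto split: nat.split)

lemma inst_rename: "inst v (rename (case_nat 0 (\<lambda>i. Suc (f i))) p) = rename (case_nat v f) p"
  unfolding inst_def rename_rename by (rule arg_cong[where f="\<lambda>g. rename g p"]) (auto split: nat.split)

text \<open>Free indices of hypotheses are parameters, so a derivation survives every renaming,
  injective or not. Completeness uses this to turn a fresh index into the bound one and to undo the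
  doubling of indices by halving them.\<close>

lemma proves_rename: "T \<turnstile> p \<Longrightarrow> rename f ` T \<turnstile> rename f p"
proof (induction arbitrary: f rule: proves.induct)
  case (Hyp p T)
  then show ?case by (simp add: proves.Hyp)
next
  case (ImplI p T q)
  from ImplI.IH[of f] show ?case by (simp add: proves.ImplI)
next
  case (ImplE T p q)
  from ImplE.IH[of f] show ?case by (metis proves.ImplE rename.simps(4))
next
  case (Contr p T)
  from Contr.IH[of f] show ?case by (simp add: Neg_def proves.Contr)
next
  case (ForallI T p)
  have "rename (case_nat 0 (\<lambda>i. Suc (f i))) ` (rename Suc ` T) = rename Suc ` (rename f ` T)"
    by (auto simp: image_image rename_rename)
  with ForallI.IH[of "case_nat 0 (\<lambda>i. Suc (f i))"] show ?case
    by (simp add: proves.ForallI)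
next
  case (ForallE T p t)
  from proves.ForallE[OF ForallE.IH[of f, simplified]] show ?case by (simp add: rename_inst)
next
  case (EquI T i)
  show ?case by (simp add: proves.EquI)
next
  case (EquE T i j p)
  from EquE.IH[of f] show ?case unfolding rename_inst by (metis proves.EquE rename.simps(3))
qed

lemma proves_weaken: "T \<turnstile> p \<Longrightarrow> T \<subseteq> T' \<Longrightarrow> T' \<turnstile> p"
proof (induction arbitrary: T' rule: proves.induct)
  case (ImplI p T q)
  then show ?case by (meson insert_mono proves.ImplI)
next
  case (Contr p T)
  then show ?case by (meson insert_mono proves.Contr)
next
  case (ForallI T p)
  then show ?case by (meson image_mono proves.ForallI)
next
  case (ImplE T p q)
  then show ?case by (meson proves.ImplE)
next
  case (EquE T i j p)
  then show ?case by (meson proves.EquE)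
qed (auto intro: proves.Hyp proves.EquI proves.ForallE)

lemma proves_finite: "T \<turnstile> p \<Longrightarrow> \<exists>F. finite F \<and> F \<subseteq> T \<and> F \<turnstile> p"
proof (induction rule: proves.induct)
  case (Hyp p T)
  then show ?case by (intro exI[of _ "{p}"]) (auto intro: proves.Hyp)
next
  case (ImplI p T q)
  then obtain F where F: "finite F" "F \<subseteq> insert p T" "F \<turnstile> q" by blast
  then have "insert p (F - {p}) \<turnstile> q" by (blast intro: proves_weaken)
  with F show ?case by (intro exI[of _ "F - {p}"]) (auto intro: proves.ImplI)
next
  case (ImplE T p q)
  then obtain F G where "finite F" "F \<subseteq> T" "F \<turnstile> Impl p q" "finite G" "G \<subseteq> T" "G \<turnstile> p" by blast
  then show ?case
    by (intro exI[of _ "F \<union> G"]) (auto intro: proves.ImplE[of _ p] proves_weaken)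
next
  case (Contr p T)
  then obtain F where F: "finite F" "F \<subseteq> insert (Neg p) T" "F \<turnstile> Falsum" by blast
  then have "insert (Neg p) (F - {Neg p}) \<turnstile> Falsum" by (blast intro: proves_weaken)
  with F show ?case by (intro exI[of _ "F - {Neg p}"]) (auto intro: proves.Contr)
next
  case (ForallI T p)
  then obtain F where "finite F" "F \<subseteq> rename Suc ` T" "F \<turnstile> p" by blast
  moreover from this obtain G where "G \<subseteq> T" "finite G" "F = rename Suc ` G"
    by (meson finite_subset_image)
  ultimately show ?case by (auto intro: proves.ForallI)
next
  case (EquE T i j p)
  then obtain F G where "finite F" "F \<subseteq> T" "F \<turnstile> Equ i j" "finite G" "G \<subseteq> T" "G \<turnstile> inst i p" by blast
  then show ?case
    by (intro exI[of _ "F \<union> G"]) (auto intro: proves.EquE[of _ i] proves_weaken)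
qed (meson proves.ForallE proves.EquI empty_subsetI finite.emptyI)+

lemma proves_cut: "insert p T \<turnstile> q \<Longrightarrow> T \<turnstile> p \<Longrightarrow> T \<turnstile> q"
  by (meson proves.ImplE proves.ImplI)

text \<open>Renaming by \<^term>\<open>\<lambda>i. if i = v then 0 else Suc i\<close> makes the fresh \<^term>\<open>v\<close> the bound variable.\<close>

lemma proves_generalize:
  assumes "T \<turnstile> inst v p"
    and T: "\<And>q. q \<in> T \<Longrightarrow> rename (\<lambda>i. if i = v then 0 else Suc i) q = rename Suc q"
    and p: "free_bound p \<le> Suc v"
  shows "T \<turnstile> Forall p"
proof (rule proves.ForallI)
  let ?f = "\<lambda>i. if i = v then 0 else Suc i"
  have "rename ?f ` T \<turnstile> rename ?f (inst v p)"
    using assms(1) by (rule proves_rename)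
  moreover have "rename ?f ` T = rename Suc ` T" using T by (auto intro!: image_cong)
  \<comment> \<open>Index \<open>0\<close> goes to \<open>v\<close> and back to \<open>0\<close>. An
    index \<open>Suc i\<close> goes to \<open>i\<close> and back to \<open>Suc i\<close> unless
    \<open>i = v\<close>, which the bound on \<open>free_bound p\<close> excludes.\<close>
  moreover have "rename ?f (inst v p) = rename (\<lambda>i. i) p"
    unfolding inst_def rename_rename
    by (rule rename_cong) (use p in \<open>auto split: nat.split\<close>)
  ultimately show "rename Suc ` T \<turnstile> p" by (simp add: rename_id)
qed

section \<open>Consistency and the Henkin construction\<close>

definition consistent :: "fm set \<Rightarrow> bool" where "consistent T \<longleftrightarrow> \<not> T \<turnstile> Falsum"

lemma consistent_Neg: "consistent T \<Longrightarrow> \<not> consistent (insert p T) \<Longrightarrow> consistent (insert (Neg p) T)"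
  unfolding consistent_def by (metis proves.Contr proves_cut)

text \<open>The Henkin step: if the negated instance at a fresh \<open>v\<close> were inconsistent
  with \<open>T\<close>, the instance would be provable and could be generalized. Freshness of
  \<open>v\<close> for \<open>T\<close> is expressed by two renamings having the same effect, which
  avoids a separate notion of free variable.\<close>

lemma consistent_Neg_inst:
  assumes "consistent T" "\<not> consistent (insert (Forall p) T)"
    and T: "\<And>q. q \<in> T \<Longrightarrow> rename (\<lambda>i. if i = v then 0 else Suc i) q = rename Suc q"
    and p: "free_bound p \<le> Suc v"
  shows "consistent (insert (Neg (inst v p)) T)"
proof (rule ccontr)
  assume "\<not> consistent (insert (Neg (inst v p)) T)"
  then have "T \<turnstile> inst v p" unfolding consistent_def by (auto intro: proves.Contr)
  then have "T \<turnstile> Forall p" using T p by (rule proves_generalize)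
  with assms(1,2) show False unfolding consistent_def by (blast intro: proves_cut)
qed

instance fm :: countable
  by countable_datatype

definition fresh_bound :: "fm set \<Rightarrow> nat \<Rightarrow> bool" where
  "fresh_bound T v \<longleftrightarrow> (\<forall>q\<in>T. free_bound q \<le> v)"

text \<open>The base theory only uses even variables; the odd ones serve as Henkin constants.\<close>

locale henkin =
  fixes T0 :: "fm set"
  assumes cons: "consistent T0"
    and even: "\<And>q i. q \<in> T0 \<Longrightarrow> odd i \<Longrightarrow> rename (\<lambda>j. if j = i then 0 else Suc j) q = rename Suc q"
begin

definition witness :: "fm set \<Rightarrow> fm \<Rightarrow> nat" where
  "witness F q = (SOME v. odd v \<and> free_bound q \<le> v \<and> fresh_bound F v)"

lemma witness:
  assumes "finite F"
  shows "odd (witness F q)" "free_bound q \<le> witness F q" "fresh_bound F (witness F q)"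
proof -
  let ?m = "free_bound q + (\<Sum>p\<in>F. free_bound p)"
  \<comment> \<open>The sum bounds every free index involved; doubling it and adding one gives an
    odd number above all of them.\<close>
  have "odd (2 * ?m + 1) \<and> free_bound q \<le> 2 * ?m + 1 \<and> fresh_bound F (2 * ?m + 1)"
    using assms unfolding fresh_bound_def
    by (auto dest: member_le_sum[OF _ _ assms, of _ free_bound, simplified] intro: le_SucI trans_le_add2)
  then have "\<exists>v. odd v \<and> free_bound q \<le> v \<and> fresh_bound F v" by blast
  from someI_ex[OF this]
  show "odd (witness F q)" "free_bound q \<le> witness F q" "fresh_bound F (witness F q)"
    unfolding witness_def by blast+
qed

text \<open>The Lindenbaum and Henkin constructions in one pass over all formulas. A rejected
  universal formula receives a counterexample at once. Other rejected formulas leave nothing behind,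
  since their negations become derivable. Each stage stays finite, so a fresh odd index is always
  left.\<close>

primrec stage :: "nat \<Rightarrow> fm set" where
  "stage 0 = {}"
| "stage (Suc n) = (let F = stage n; q = from_nat n in
     if consistent (insert q (T0 \<union> F)) then insert q F
     else (case q of Forall p \<Rightarrow> insert (Neg (inst (witness F q) p)) F | _ \<Rightarrow> F))"

lemma finite_stage: "finite (stage n)"
  by (induction n) (auto simp: Let_def split: fm.split)

lemma consistent_stage: "consistent (T0 \<union> stage n)"
proof (induction n)
  case (Suc n)
  let ?F = "stage n" and ?q = "from_nat n :: fm"
  show ?case
  proof (cases "consistent (insert ?q (T0 \<union> ?F))")
    case False
    show ?thesis
    proof (cases "\<exists>p. ?q = Forall p")
      case True
      then obtain p where p: "?q = Forall p" by blast
      let ?v = "witness ?F ?q"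
      note w = witness[OF finite_stage[of n], of ?q]
      have "consistent (insert (Neg (inst ?v p)) (T0 \<union> ?F))"
      proof (rule consistent_Neg_inst[OF Suc])
        show "\<not> consistent (insert (Forall p) (T0 \<union> ?F))" using False p by simp
        show "free_bound p \<le> Suc ?v" using w(2) p by simp
        fix q assume q: "q \<in> T0 \<union> ?F"
        \<comment> \<open>Freshness has two sources: the formulas of \<open>T0\<close> do not depend
          on odd indices, and the finitely many added ones only use indices below
          \<open>?v\<close>.\<close>
        show "rename (\<lambda>i. if i = ?v then 0 else Suc i) q = rename Suc q"
        proof (cases "q \<in> T0")
          case True then show ?thesis using even w(1) by blast
        next
          case False
          then have "free_bound q \<le> ?v" using q w(3) by (auto simp: fresh_bound_def)
          then show ?thesis by (intro rename_cong) auto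
        qed
      qed
      then show ?thesis using False p by (simp add: Let_def)
    next
      case no_Forall: False
      then show ?thesis using Suc False by (auto simp: Let_def split: fm.split)
    qed
  qed (simp add: Let_def)
qed (simp add: cons)

definition "T1 = T0 \<union> (\<Union>n. stage n)"

lemma stage_mono: "m \<le> n \<Longrightarrow> stage m \<subseteq> stage n"
  by (rule lift_Suc_mono_le) (auto simp: Let_def split: fm.split)

lemma consistent_T1: "consistent T1"
proof (rule ccontr)
  assume "\<not> consistent T1"
  then obtain F where F: "finite F" "F \<subseteq> T1" "F \<turnstile> Falsum"
    using proves_finite unfolding consistent_def by blast
  have "\<exists>n. F \<subseteq> T0 \<union> stage n"
    using F(1,2)
  proof (induction rule: finite_induct)
    case (insert q F)
    then obtain n where n: "F \<subseteq> T0 \<union> stage n" by blast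
    obtain m where m: "q \<in> T0 \<union> stage m" using insert.prems unfolding T1_def by blast
    have "insert q F \<subseteq> T0 \<union> stage (max m n)"
      using n m stage_mono[of m "max m n"] stage_mono[of n "max m n"] by auto
    then show ?case by blast
  qed simp
  with F(3) consistent_stage show False unfolding consistent_def by (blast intro: proves_weaken)
qed

text \<open>Formula \<open>p\<close> was considered at stage \<open>to_nat p\<close>; a rejection
  there persists because \<open>T1\<close> has more hypotheses.\<close>

lemma T1_decides: "p \<in> T1 \<or> \<not> consistent (insert p T1)"
proof (cases "consistent (insert p (T0 \<union> stage (to_nat p)))")
  case True
  then have "p \<in> stage (Suc (to_nat p))" by (simp add: Let_def)
  then show ?thesis unfolding T1_def by blast
next
  case False
  have "insert p (T0 \<union> stage (to_nat p)) \<subseteq> insert p T1" unfolding T1_def by blast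
  with False show ?thesis unfolding consistent_def by (blast intro: proves_weaken)
qed

lemma T1_proves: "T1 \<turnstile> p \<longleftrightarrow> p \<in> T1"
  using T1_decides[of p] consistent_T1 unfolding consistent_def
  by (blast intro: proves.Hyp proves_cut)

lemma T1_Falsum: "Falsum \<notin> T1"
  using consistent_T1 T1_proves unfolding consistent_def by blast

lemma T1_Neg: "Neg p \<in> T1 \<longleftrightarrow> p \<notin> T1"
  using T1_decides[of p] consistent_T1 consistent_Neg[OF consistent_T1, of p] T1_decides[of "Neg p"]
  by (metis Neg_def T1_Falsum T1_proves proves.ImplE)

lemma T1_Impl: "Impl p q \<in> T1 \<longleftrightarrow> (p \<in> T1 \<longrightarrow> q \<in> T1)"
proof
  assume "p \<in> T1 \<longrightarrow> q \<in> T1"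
  moreover have "T1 \<turnstile> Impl p q" if "q \<in> T1"
    using that by (auto intro: proves.ImplI proves.Hyp)
  moreover have "T1 \<turnstile> Impl p q" if "Neg p \<in> T1"
  proof (rule proves.ImplI, rule proves.Contr)
    show "insert (Neg q) (insert p T1) \<turnstile> Falsum"
      by (rule proves.ImplE[of _ p]) (use that in \<open>auto intro: proves.Hyp simp: Neg_def\<close>)
  qed
  ultimately show "Impl p q \<in> T1" using T1_Neg T1_proves by blast
qed (metis T1_proves proves.ImplE)

text \<open>Here the witnesses pay off: a rejected \<open>Forall p\<close> left a negated instance
  in the next stage.\<close>

lemma T1_Forall: "Forall p \<in> T1 \<longleftrightarrow> (\<forall>v. inst v p \<in> T1)"
proof
  assume all: "\<forall>v. inst v p \<in> T1"
  show "Forall p \<in> T1"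
  proof (rule ccontr)
    assume no: "Forall p \<notin> T1"
    let ?n = "to_nat (Forall p)"
    have "\<not> consistent (insert (Forall p) (T0 \<union> stage ?n))"
    proof
      assume "consistent (insert (Forall p) (T0 \<union> stage ?n))"
      then have "Forall p \<in> stage (Suc ?n)" by (simp add: Let_def)
      with no show False unfolding T1_def by blast
    qed
    then have "Neg (inst (witness (stage ?n) (Forall p)) p) \<in> stage (Suc ?n)"
      by (simp add: Let_def)
    then have "Neg (inst (witness (stage ?n) (Forall p)) p) \<in> T1" unfolding T1_def by blast
    with all T1_Neg show False by blast
  qed
qed (metis T1_proves proves.ForallE)

lemma T1_EquE: "Equ i j \<in> T1 \<Longrightarrow> inst i p \<in> T1 \<Longrightarrow> inst j p \<in> T1"
  by (metis T1_proves proves.EquE)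

lemma T1_refl: "Equ i i \<in> T1"
  by (metis T1_proves proves.EquI)

lemma T1_sym: "Equ i j \<in> T1 \<Longrightarrow> Equ j i \<in> T1"
  \<comment> \<open>Leibniz's law for the property of being equal to \<open>i\<close>: at
    \<open>i\<close> it is reflexivity, at \<open>j\<close> the claim.\<close>
  using T1_EquE[of i j "Equ 0 (Suc i)"] T1_refl by (simp add: inst_def)

lemma T1_trans: "Equ i j \<in> T1 \<Longrightarrow> Equ j k \<in> T1 \<Longrightarrow> Equ i k \<in> T1"
  using T1_EquE[of j k "Equ (Suc i) 0"] by (simp add: inst_def)

text \<open>Least representatives of the provable-equality classes form the carrier, so that the
  equality of the term model is equality in HOL.\<close>

definition rep :: "nat \<Rightarrow> nat" where "rep i = (LEAST j. Equ i j \<in> T1)"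

lemma rep: "Equ i (rep i) \<in> T1"
  unfolding rep_def using T1_refl by (rule LeastI)

lemma rep_eq: "rep i = rep j \<longleftrightarrow> Equ i j \<in> T1"
proof
  assume "Equ i j \<in> T1"
  then have "(\<lambda>k. Equ i k \<in> T1) = (\<lambda>k. Equ j k \<in> T1)" using T1_sym T1_trans by blast
  then show "rep i = rep j" unfolding rep_def by simp
qed (metis rep T1_sym T1_trans)

lemma Mem_rep: "Mem (rep i) (rep j) \<in> T1 \<longleftrightarrow> Mem i j \<in> T1"
proof -
  have "Mem i' j' \<in> T1" if "Mem i j \<in> T1" "Equ i i' \<in> T1" "Equ j j' \<in> T1" for i j i' j'
    using T1_EquE[OF that(2), of "Mem 0 (Suc j)"] T1_EquE[OF that(3), of "Mem (Suc i') 0"] that(1)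
    by (simp add: inst_def)
  then show ?thesis using rep T1_sym by meson
qed

text \<open>The truth lemma with an arbitrary \<open>f\<close> as assignment: under a quantifier the
  chosen element \<open>rep v\<close> is absorbed into \<open>f\<close>, which keeps the induction
  hypothesis applicable.\<close>

lemma truth: "sat (\<lambda>i j. Mem i j \<in> T1) (range rep) (\<lambda>i. rep (f i)) p \<longleftrightarrow> rename f p \<in> T1"
proof (induction p arbitrary: f)
  case (Forall p)
  have "sat (\<lambda>i j. Mem i j \<in> T1) (range rep) (case_nat (rep v) (\<lambda>i. rep (f i))) p \<longleftrightarrow>
      inst v (rename (case_nat 0 (\<lambda>i. Suc (f i))) p) \<in> T1" for v
  proof -
    have "case_nat (rep v) (\<lambda>i. rep (f i)) = (\<lambda>i. rep (case_nat v f i))"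
      by (auto split: nat.split)
    then show ?thesis by (simp only: Forall.IH inst_rename)
  qed
  then show ?case by (simp add: T1_Forall)
qed (simp_all add: T1_Falsum T1_Impl rep_eq Mem_rep)

end

theorem completeness:
  assumes "\<And>(E :: nat \<Rightarrow> nat \<Rightarrow> bool) D e.
    (\<And>i. e i \<in> D) \<Longrightarrow> (\<And>p. p \<in> T \<Longrightarrow> sat E D e p) \<Longrightarrow> sat E D e q"
  shows "T \<turnstile> q"
proof (rule ccontr)
  assume no: "\<not> T \<turnstile> q"
  \<comment> \<open>An arbitrary theory may use every index as a parameter. Doubling the indices
    frees all odd ones, and halving them restores the original theory.\<close>
  let ?d = "\<lambda>i::nat. 2 * i" and ?h = "\<lambda>i::nat. i div 2"
  let ?T = "rename ?d ` insert (Neg q) T"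
  have "consistent ?T"
  proof (rule ccontr)
    assume "\<not> consistent ?T"
    then have "rename ?h ` ?T \<turnstile> rename ?h Falsum"
      unfolding consistent_def using proves_rename by fastforce
    then have "insert (Neg q) T \<turnstile> Falsum"
      by (simp add: image_image rename_rename rename_id)
    with no show False by (blast intro: proves.Contr)
  qed
  moreover have "rename (\<lambda>j. if j = i then 0 else Suc j) p = rename Suc p" if "p \<in> ?T" "odd i" for p i
  proof -
    have "(\<lambda>j. if 2 * j = i then 0 else Suc (2 * j)) = (\<lambda>j. Suc (2 * j))"
      using that(2) by (intro ext) auto
    with that(1) show ?thesis by (auto simp: rename_rename)
  qed
  ultimately interpret henkin ?T by unfold_locales
  have *: "sat (\<lambda>i j. Mem i j \<in> T1) (range rep) (\<lambda>i. rep (2 * i)) p" if "p \<in> insert (Neg q) T" for p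
    using that truth[of ?d p] unfolding T1_def by blast
  from assms[of "\<lambda>i. rep (2 * i)" "range rep" "\<lambda>i j. Mem i j \<in> T1"] *
  have "sat (\<lambda>i j. Mem i j \<in> T1) (range rep) (\<lambda>i. rep (2 * i)) q" by blast
  with *[of "Neg q"] show False by simp
qed

text \<open>Pairing and extensionality force the domain to be infinite, so its elements can be renamed
  to all natural numbers.\<close>

corollary completeness_UNIV:
  assumes ax: "sentence ax_empty \<in> T" "sentence ax_extensionality \<in> T" "sentence ax_pair \<in> T"
    and sat: "\<And>(E :: nat \<Rightarrow> nat \<Rightarrow> bool) e. (\<And>p. p \<in> T \<Longrightarrow> sat E UNIV e p) \<Longrightarrow> sat E UNIV e q"
  shows "T \<turnstile> q"
proof (rule completeness)
  fix E :: "nat \<Rightarrow> nat \<Rightarrow> bool" and D e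
  assume e: "\<And>i. e i \<in> D" and T: "\<And>p. p \<in> T \<Longrightarrow> sat E D e p"
  note defs = sentence_def fEx_def fAll_def fIff_def fImp_def fMem_def fEqu_def fOr_def fNot_def
  obtain z where z: "z \<in> D" "\<forall>x\<in>D. \<not> E x z"
    using T[OF ax(1)] by (auto simp: ax_empty_def is_zero_def defs)
  have ext: "x = y" if "x \<in> D" "y \<in> D" "\<forall>z\<in>D. E z x \<longleftrightarrow> E z y" for x y
    using T[OF ax(2)] that by (auto simp: ax_extensionality_def defs eval_nat_numeral)
  have "\<forall>x\<in>D. \<forall>y\<in>D. \<exists>p\<in>D. \<forall>z\<in>D. E z p \<longleftrightarrow> z = x \<or> z = y"
    using T[OF ax(3)] by (simp add: ax_pair_def is_upair_def defs eval_nat_numeral)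
  then have "\<forall>x\<in>D. \<exists>p\<in>D. \<forall>z\<in>D. E z p \<longleftrightarrow> z = x"
    by fastforce
  then obtain s where s: "\<forall>x\<in>D. s x \<in> D \<and> (\<forall>z\<in>D. E z (s x) \<longleftrightarrow> z = x)"
    by metis
  \<comment> \<open>The singleton map \<open>s\<close> is injective and misses the empty set
    \<open>z\<close>, which is impossible on a finite domain.\<close>
  have "infinite D"
  proof
    assume "finite D"
    have "inj_on s D" using s by (metis inj_onI)
    moreover have "s ` D \<subseteq> D" using s by blast
    ultimately have "s ` D = D" using \<open>finite D\<close> by (metis endo_inj_surj)
    then show False using z s by (metis imageE)
  qed
  then obtain b where b: "bij_betw b (UNIV :: nat set) D"
    using bij_enumerate by blast
  define e' where "e' = (\<lambda>i. inv_into UNIV b (e i))"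
  have e': "(\<lambda>i. b (e' i)) = e"
    using e b unfolding e'_def by (simp add: bij_betw_def f_inv_into_f)
  have "sat (\<lambda>x y. E (b x) (b y)) UNIV e' p \<longleftrightarrow> sat E D e p" for p
    using sat_bij[OF b, of e' E p] e' by simp
  with sat[of "\<lambda>x y. E (b x) (b y)" e'] T show "sat E D e q" by blast
qed

section \<open>Environments and named variables\<close>

text \<open>The environment of a formula standing at depth \<^term>\<open>length xs\<close>: level \<^term>\<open>i\<close> denotes
  \<^term>\<open>xs ! i\<close>, and the indices that are not bound by a level are read off \<^term>\<open>e\<close>.\<close>

definition env :: "(nat \<Rightarrow> 'a) \<Rightarrow> 'a list \<Rightarrow> nat \<Rightarrow> 'a" where
  "env e xs i = (if i < length xs then xs ! (length xs - Suc i) else e (i - length xs))"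

lemma case_nat_env: "case_nat a (env e xs) = env e (xs @ [a])"
  by (auto simp: env_def nth_append fun_eq_iff split: nat.split)

lemma env_Nil: "env e [] = e"
  by (simp add: env_def fun_eq_iff)

lemma Delta0_Neg: "Delta0 p \<Longrightarrow> Delta0 (Neg p)"
  unfolding Neg_def by (intro Delta0.intros)

text \<open>Codes inside set theory use named variables. De Bruijn formulas are first translated
  into this type, whose constructors match the five kinds of code one for one.\<close>

datatype nfm = NFalsum | NMem nat nat | NEqu nat nat | NImpl nfm nfm | NForall nat nfm

definition NNot :: "nfm \<Rightarrow> nfm" where "NNot p = NImpl p NFalsum"
definition NAnd :: "nfm \<Rightarrow> nfm \<Rightarrow> nfm" where "NAnd p q = NNot (NImpl p (NNot q))"
definition NIff :: "nfm \<Rightarrow> nfm \<Rightarrow> nfm" where "NIff p q = NAnd (NImpl p q) (NImpl q p)"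
definition NExists :: "nat \<Rightarrow> nfm \<Rightarrow> nfm" where "NExists u p = NNot (NForall u (NNot p))"

primrec named :: "fm \<Rightarrow> nat \<Rightarrow> nfm" where
  "named Falsum d = NFalsum"
| "named (Mem i j) d = NMem (d - Suc i) (d - Suc j)"
| "named (Equ i j) d = NEqu (d - Suc i) (d - Suc j)"
| "named (Impl p q) d = NImpl (named p d) (named q d)"
| "named (Forall p) d = NForall d (named p (Suc d))"

primrec vars :: "nfm \<Rightarrow> nat set" where
  "vars NFalsum = {}"
| "vars (NMem i j) = {i, j}"
| "vars (NEqu i j) = {i, j}"
| "vars (NImpl p q) = vars p \<union> vars q"
| "vars (NForall u p) = insert u (vars p)"

lemma finite_vars: "finite (vars p)"
  by (induction p) auto

primrec nsat :: "('a \<Rightarrow> 'a \<Rightarrow> bool) \<Rightarrow> 'a set \<Rightarrow> (nat \<Rightarrow> 'a) \<Rightarrow> nfm \<Rightarrow> bool" where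
  "nsat E D e NFalsum = False"
| "nsat E D e (NMem i j) = E (e i) (e j)"
| "nsat E D e (NEqu i j) = (e i = e j)"
| "nsat E D e (NImpl p q) = (nsat E D e p \<longrightarrow> nsat E D e q)"
| "nsat E D e (NForall u p) = (\<forall>a\<in>D. nsat E D (e(u := a)) p)"

lemma nsat_simps [simp]:
  "nsat E D e (NNot p) \<longleftrightarrow> \<not> nsat E D e p"
  "nsat E D e (NAnd p q) \<longleftrightarrow> nsat E D e p \<and> nsat E D e q"
  "nsat E D e (NIff p q) \<longleftrightarrow> (nsat E D e p \<longleftrightarrow> nsat E D e q)"
  "nsat E D e (NExists u p) \<longleftrightarrow> (\<exists>a\<in>D. nsat E D (e(u := a)) p)"
  by (auto simp: NNot_def NAnd_def NIff_def NExists_def)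

lemma nsat_cong: "(\<And>i. i \<in> vars p \<Longrightarrow> e i = e' i) \<Longrightarrow> nsat E D e p \<longleftrightarrow> nsat E D e' p"
proof (induction p arbitrary: e e')
  case (NForall u p)
  have "nsat E D (e(u := a)) p \<longleftrightarrow> nsat E D (e'(u := a)) p" for a
    by (rule NForall.IH) (use NForall.prems in auto)
  then show ?case by simp
next
  case (NImpl p q)
  have "nsat E D e p \<longleftrightarrow> nsat E D e' p" "nsat E D e q \<longleftrightarrow> nsat E D e' q"
    by (rule NImpl.IH; use NImpl.prems in simp)+
  then show ?case by simp
qed auto

text \<open>At depth \<^term>\<open>0 :: nat\<close> the truncated subtraction would identify unbound indices with the
  first quantified variable.\<close>

lemma nsat_named:
  "0 < d \<or> free_bound p = 0 \<Longrightarrow> nsat E D e (named p d) \<longleftrightarrow> sat E D (\<lambda>i. e (d - Suc i)) p"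
proof (induction p arbitrary: e d)
  case (Forall p)
  have "sat E D (\<lambda>i. (e(d := a)) (Suc d - Suc i)) p \<longleftrightarrow> sat E D (case_nat a (\<lambda>i. e (d - Suc i))) p" for a
    by (rule sat_cong) (use Forall.prems in \<open>auto split: nat.split\<close>)
  with Forall.IH show ?case by simp
qed auto

text \<open>An index that no level binds is sent by truncated subtraction to variable
  \<open>0\<close>. The default of \<open>env\<close> that matches the named translation is
  therefore \<open>hd xs\<close>.\<close>

lemma env_hd:
  "xs \<noteq> [] \<Longrightarrow> (\<And>i. i < length xs \<Longrightarrow> e i = xs ! i) \<Longrightarrow> env (\<lambda>_. hd xs) xs = (\<lambda>i. e (length xs - Suc i))"
  by (auto simp: env_def hd_conv_nth fun_eq_iff)

lemma sat_Forall_power: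
  "sat E UNIV e ((Forall ^^ n) p) \<Longrightarrow> (\<And>i. n \<le> i \<Longrightarrow> e' i = e (i - n)) \<Longrightarrow> sat E UNIV e' p"
proof (induction n arbitrary: e)
  case 0
  then have "e' = e" by auto
  with 0 show ?case by simp
next
  case (Suc n)
  \<comment> \<open>The outermost of the \<open>Suc n\<close> quantifiers binds index
    \<open>n\<close> of \<open>p\<close>, hence the instance \<open>e' n\<close>.\<close>
  have "sat E UNIV (case_nat (e' n) e) ((Forall ^^ n) p)" using Suc.prems(1) by simp
  moreover have "e' i = case_nat (e' n) e (i - n)" if "n \<le> i" for i
    using Suc.prems(2)[of i] that by (cases "i - n") (auto simp: diff_Suc)
  ultimately show ?case using Suc.IH by blast
qed

text \<open>The axioms are assumed in one environment only; this lets the parameters of a separation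
  instance be chosen freely.\<close>

lemma sat_closure: "sat E UNIV e (closure p) \<Longrightarrow> sat E UNIV e' p"
  unfolding closure_def
  by (drule sat_Forall_power[where e'="\<lambda>i. if i < free_bound p then e' i else e (i - free_bound p)"])
    (auto simp: sat_cong[of p "\<lambda>i. if i < free_bound p then e' i else e (i - free_bound p)" e'])

text \<open>Postorder, so that the list is a formation sequence.\<close>

primrec subs :: "nfm \<Rightarrow> nfm list" where
  "subs NFalsum = [NFalsum]"
| "subs (NMem i j) = [NMem i j]"
| "subs (NEqu i j) = [NEqu i j]"
| "subs (NImpl p q) = subs p @ subs q @ [NImpl p q]"
| "subs (NForall u p) = subs p @ [NForall u p]"

definition subclosed :: "nfm list \<Rightarrow> bool" where
  "subclosed ps \<longleftrightarrow> (\<forall>i<length ps.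
     (\<forall>p q. ps ! i = NImpl p q \<longrightarrow> (\<exists>j<i. ps ! j = p) \<and> (\<exists>j<i. ps ! j = q)) \<and>
     (\<forall>u p. ps ! i = NForall u p \<longrightarrow> (\<exists>j<i. ps ! j = p)))"

lemma subclosed_append:
  assumes "subclosed ps" "subclosed qs" shows "subclosed (ps @ qs)"
  unfolding subclosed_def
proof (intro allI impI)
  fix i assume i: "i < length (ps @ qs)"
  have shift: "\<exists>j<i. (ps @ qs) ! j = p" if "\<exists>j<i - length ps. qs ! j = p" "\<not> i < length ps" for p
  proof -
    from that obtain j where "j < i - length ps" "qs ! j = p" by blast
    then show ?thesis by (intro exI[of _ "length ps + j"]) auto
  qed
  have stay: "\<exists>j<i. (ps @ qs) ! j = p" if "\<exists>j<i. ps ! j = p" "i < length ps" for p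
    using that by (metis less_trans nth_append)
  show "(\<forall>p q. (ps @ qs) ! i = NImpl p q \<longrightarrow> (\<exists>j<i. (ps @ qs) ! j = p) \<and> (\<exists>j<i. (ps @ qs) ! j = q)) \<and>
     (\<forall>u p. (ps @ qs) ! i = NForall u p \<longrightarrow> (\<exists>j<i. (ps @ qs) ! j = p))"
  proof (cases "i < length ps")
    case True
    with assms(1) show ?thesis unfolding subclosed_def nth_append[of ps qs i]
      using stay by auto
  next
    case False
    then have "i - length ps < length qs" using i by auto
    with False assms(2) show ?thesis unfolding subclosed_def nth_append[of ps qs i]
      using shift by auto
  qed
qed

lemma subclosed_snoc:
  assumes "subclosed ps" "\<forall>p q. r = NImpl p q \<longrightarrow> p \<in> set ps \<and> q \<in> set ps"
    "\<forall>u p. r = NForall u p \<longrightarrow> p \<in> set ps"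
  shows "subclosed (ps @ [r])"
  using assms unfolding subclosed_def
  by (auto simp: nth_append less_Suc_eq in_set_conv_nth) (metis less_trans)+

lemma subs_self: "p \<in> set (subs p)"
  by (cases p) auto

lemma subclosed_subs: "subclosed (subs p)"
proof (induction p)
  case (NImpl p q)
  then have "subclosed ((subs p @ subs q) @ [NImpl p q])"
    by (intro subclosed_snoc subclosed_append) (auto simp: subs_self)
  then show ?case by simp
next
  case (NForall u p)
  then show ?case by (auto intro!: subclosed_snoc simp: subs_self)
qed (simp_all add: subclosed_def)

lemma vars_subs: "q \<in> set (subs p) \<Longrightarrow> vars q \<subseteq> vars p"
  by (induction p) auto

lemma subs_trans: "q \<in> set (subs p) \<Longrightarrow> set (subs q) \<subseteq> set (subs p)"
  by (induction p) auto

section \<open>Models of LZFC\<close>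

text \<open>With the whole type as universe, set-theoretic quantifiers are plain HOL quantifiers.
  This is why the countable domain was renamed to all natural numbers.\<close>

locale lzfc =
  fixes E :: "'a \<Rightarrow> 'a \<Rightarrow> bool" (infix "\<lhd>" 50) and e0 :: "nat \<Rightarrow> 'a"
  assumes lzfc: "p \<in> LZFC \<Longrightarrow> sat E UNIV e0 p"
begin

text \<open>The domain is a parameter, so that one absoluteness lemma serves both the universe and
  the set of elements of a model.\<close>

definition holds :: "'a set \<Rightarrow> (nat \<Rightarrow> 'a) \<Rightarrow> 'a list \<Rightarrow> form \<Rightarrow> bool" where
  "holds D e xs P \<longleftrightarrow> sat E D (env e xs) (P (length xs))"

lemma holds_simps [simp]:
  "x < length xs \<Longrightarrow> y < length xs \<Longrightarrow> holds D e xs (x \<^bold>\<in> y) \<longleftrightarrow> xs ! x \<lhd> xs ! y"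
  "x < length xs \<Longrightarrow> y < length xs \<Longrightarrow> holds D e xs (x \<^bold>= y) \<longleftrightarrow> xs ! x = xs ! y"
  "holds D e xs (\<^bold>\<not> P) \<longleftrightarrow> \<not> holds D e xs P"
  "holds D e xs (P \<^bold>\<and> Q) \<longleftrightarrow> holds D e xs P \<and> holds D e xs Q"
  "holds D e xs (P \<^bold>\<or> Q) \<longleftrightarrow> holds D e xs P \<or> holds D e xs Q"
  "holds D e xs (P \<^bold>\<longrightarrow> Q) \<longleftrightarrow> (holds D e xs P \<longrightarrow> holds D e xs Q)"
  "holds D e xs (P \<^bold>\<longleftrightarrow> Q) \<longleftrightarrow> (holds D e xs P \<longleftrightarrow> holds D e xs Q)"
  "holds D e xs (fAll R) \<longleftrightarrow> (\<forall>a\<in>D. holds D e (xs @ [a]) (R (length xs)))"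
  "holds D e xs (fEx R) \<longleftrightarrow> (\<exists>a\<in>D. holds D e (xs @ [a]) (R (length xs)))"
  by (auto simp: holds_def env_def fMem_def fEqu_def fNot_def fAnd_def fOr_def fImp_def fIff_def
      fAll_def fEx_def case_nat_env Suc_diff_Suc)

lemma holds_sentence: "sat E D e (sentence P) \<longleftrightarrow> holds D e [] P"
  by (simp add: holds_def sentence_def env_Nil)

lemma LZFC_holds: "sentence P \<in> LZFC \<Longrightarrow> holds UNIV e0 [] P"
  using lzfc holds_sentence by blast

subsection \<open>Elementary operations\<close>

lemma ext: "(\<And>z. z \<lhd> x \<longleftrightarrow> z \<lhd> y) \<Longrightarrow> x = y"
  using LZFC_holds[of ax_extensionality]
  by (simp add: LZFC_def BST_def ax_extensionality_def nth_append)

lemma ex_zero: "\<exists>x. \<forall>z. \<not> z \<lhd> x"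
  using LZFC_holds[of ax_empty]
  by (simp add: LZFC_def BST_def ax_empty_def is_zero_def nth_append)

lemma ex_upair: "\<exists>p. \<forall>z. z \<lhd> p \<longleftrightarrow> z = x \<or> z = y"
  using LZFC_holds[of ax_pair]
  by (simp add: LZFC_def BST_def ax_pair_def is_upair_def nth_append)

lemma ex_union: "\<exists>u. \<forall>z. z \<lhd> u \<longleftrightarrow> (\<exists>y. y \<lhd> x \<and> z \<lhd> y)"
  using LZFC_holds[of ax_union]
  by (simp add: LZFC_def BST_def ax_union_def nth_append)

definition zero :: 'a where "zero = (SOME x. \<forall>z. \<not> z \<lhd> x)"
definition up :: "'a \<Rightarrow> 'a \<Rightarrow> 'a" where "up x y = (SOME p. \<forall>z. z \<lhd> p \<longleftrightarrow> z = x \<or> z = y)"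
definition un :: "'a \<Rightarrow> 'a" where "un x = (SOME u. \<forall>z. z \<lhd> u \<longleftrightarrow> (\<exists>y. y \<lhd> x \<and> z \<lhd> y))"

lemma zero [simp]: "\<not> z \<lhd> zero"
  using someI_ex[OF ex_zero] unfolding zero_def by blast

lemma up [simp]: "z \<lhd> up x y \<longleftrightarrow> z = x \<or> z = y"
  using someI_ex[OF ex_upair] unfolding up_def by blast

lemma un [simp]: "z \<lhd> un x \<longleftrightarrow> (\<exists>y. y \<lhd> x \<and> z \<lhd> y)"
  using someI_ex[OF ex_union] unfolding un_def by blast

definition cup :: "'a \<Rightarrow> 'a \<Rightarrow> 'a" where "cup x y = un (up x y)"
definition suc :: "'a \<Rightarrow> 'a" where "suc x = cup x (up x x)"
definition op :: "'a \<Rightarrow> 'a \<Rightarrow> 'a" where "op x y = up (up x x) (up x y)"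

lemma cup [simp]: "z \<lhd> cup x y \<longleftrightarrow> z \<lhd> x \<or> z \<lhd> y"
  unfolding cup_def by auto

lemma suc [simp]: "z \<lhd> suc x \<longleftrightarrow> z \<lhd> x \<or> z = x"
  unfolding suc_def by auto

lemma zero_iff: "x = zero \<longleftrightarrow> (\<forall>z. \<not> z \<lhd> x)"
  by (metis ext zero)

lemma up_iff: "p = up x y \<longleftrightarrow> (\<forall>z. z \<lhd> p \<longleftrightarrow> z = x \<or> z = y)"
  by (metis ext up)

lemma suc_iff: "y = suc x \<longleftrightarrow> (\<forall>z. z \<lhd> y \<longleftrightarrow> z \<lhd> x \<or> z = x)"
  by (metis ext suc)

lemma up_eq: "up a b = up c d \<longleftrightarrow> a = c \<and> b = d \<or> a = d \<and> b = c"
proof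
  assume "up a b = up c d"
  then have "\<forall>z. z = a \<or> z = b \<longleftrightarrow> z = c \<or> z = d" using up by metis
  then show "a = c \<and> b = d \<or> a = d \<and> b = c" by metis
qed (auto intro: ext)

lemma op_eq [simp]: "op a b = op c d \<longleftrightarrow> a = c \<and> b = d"
  unfolding op_def up_eq by auto

primrec num :: "nat \<Rightarrow> 'a" where
  "num 0 = zero"
| "num (Suc k) = suc (num k)"

lemma mem_num: "z \<lhd> num k \<longleftrightarrow> (\<exists>j<k. z = num j)"
  by (induction k) (auto simp: less_Suc_eq)

lemma num_irrefl: "\<not> num k \<lhd> num k"
proof (induction k)
  case (Suc k)
  show ?case
  proof
    assume "num (Suc k) \<lhd> num (Suc k)"
    then have "num (Suc k) \<lhd> num k \<or> num (Suc k) = num k" by simp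
    then have "num k \<lhd> num k"
    proof
      assume "num (Suc k) \<lhd> num k"
      then obtain j where j: "j < k" "num (Suc k) = num j" using mem_num by blast
      have "num k \<lhd> num j" unfolding j(2)[symmetric] by simp
      then show ?thesis using j(1) less_trans unfolding mem_num[of _ j] mem_num[of _ k] by blast
    next
      assume *: "num (Suc k) = num k"
      have "num k \<lhd> num (Suc k)" by simp
      then show ?thesis unfolding * .
    qed
    with Suc show False ..
  qed
qed simp

lemma num_eq [simp]: "num i = num j \<longleftrightarrow> i = j"
  by (metis linorder_neqE_nat mem_num num_irrefl)

lemma mem_num_num [simp]: "num i \<lhd> num k \<longleftrightarrow> i < k"
  by (auto simp: mem_num)

definition node :: "nat \<Rightarrow> 'a \<Rightarrow> 'a \<Rightarrow> 'a" where "node k a b = op (num k) (op a b)"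

lemma node_eq [simp]: "node k a b = node l c d \<longleftrightarrow> k = l \<and> a = c \<and> b = d"
  by (auto simp: node_def)

definition sub :: "'a \<Rightarrow> 'a \<Rightarrow> bool" where "sub x y \<longleftrightarrow> (\<forall>z. z \<lhd> x \<longrightarrow> z \<lhd> y)"
definition tr :: "'a \<Rightarrow> bool" where "tr x \<longleftrightarrow> (\<forall>y. y \<lhd> x \<longrightarrow> sub y x)"
definition isfun :: "'a \<Rightarrow> 'a \<Rightarrow> bool" where
  "isfun f a \<longleftrightarrow> (\<forall>p. p \<lhd> f \<longrightarrow> (\<exists>x y. x \<lhd> a \<and> p = op x y)) \<and> (\<forall>x. x \<lhd> a \<longrightarrow> (\<exists>y. \<forall>z. op x z \<lhd> f \<longleftrightarrow> z = y))"
definition mapsto :: "'a \<Rightarrow> 'a \<Rightarrow> 'a \<Rightarrow> bool" where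
  "mapsto f a b \<longleftrightarrow> isfun f a \<and> (\<forall>x y. op x y \<lhd> f \<longrightarrow> y \<lhd> b)"
definition injective :: "'a \<Rightarrow> bool" where
  "injective f \<longleftrightarrow> (\<forall>x y z. op x z \<lhd> f \<and> op y z \<lhd> f \<longrightarrow> x = y)"

subsection \<open>Absoluteness for transitive domains\<close>

definition el :: "'a \<Rightarrow> 'a set" where "el x = {z. z \<lhd> x}"

lemma mem_el [simp]: "z \<in> el x \<longleftrightarrow> z \<lhd> x"
  by (simp add: el_def)

definition trD :: "'a set \<Rightarrow> bool" where "trD D \<longleftrightarrow> (\<forall>x\<in>D. \<forall>y. y \<lhd> x \<longrightarrow> y \<in> D)"
definition ok :: "'a set \<Rightarrow> 'a list \<Rightarrow> bool" where "ok D xs \<longleftrightarrow> trD D \<and> set xs \<subseteq> D"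

lemma trD_UNIV [simp]: "trD UNIV"
  by (simp add: trD_def)

lemma ok_UNIV [simp]: "ok UNIV xs"
  by (simp add: ok_def)

lemma ok_Nil [simp]: "ok D [] \<longleftrightarrow> trD D"
  and ok_append [simp]: "ok D (xs @ ys) \<longleftrightarrow> ok D xs \<and> set ys \<subseteq> D"
  and ok_Cons [simp]: "ok D (a # xs) \<longleftrightarrow> ok D xs \<and> a \<in> D"
  by (auto simp: ok_def)

lemma trD_el: "trD (el M) \<longleftrightarrow> tr M"
  by (auto simp: trD_def tr_def sub_def)

lemma trD_mem: "trD D \<Longrightarrow> x \<in> D \<Longrightarrow> y \<lhd> x \<Longrightarrow> y \<in> D"
  by (auto simp: trD_def)

lemma ok_mem: "ok D xs \<Longrightarrow> i < length xs \<Longrightarrow> y \<lhd> xs ! i \<Longrightarrow> y \<in> D"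
  by (meson nth_mem ok_def subsetD trD_mem)

lemma ok_nth: "ok D xs \<Longrightarrow> i < length xs \<Longrightarrow> xs ! i \<in> D"
  by (meson nth_mem ok_def subsetD)

lemma op_D: "trD D \<Longrightarrow> op x y \<in> D \<Longrightarrow> x \<in> D \<and> y \<in> D"
  unfolding op_def by (metis trD_mem up)

lemma op_ok: "ok D xs \<Longrightarrow> i < length xs \<Longrightarrow> op x y \<lhd> xs ! i \<Longrightarrow> x \<in> D \<and> y \<in> D"
  by (metis ok_def ok_mem op_D)

text \<open>Rewrite rules that turn truth of a formula in a transitive domain into a predicate of
  the universe. Formulas with unbounded quantifiers get such a rule under the extra hypothesis that
  the required witnesses lie in the domain.\<close>

named_theorems abs

lemma abs_subset [abs]: "ok D xs \<Longrightarrow> x < length xs \<Longrightarrow> y < length xs \<Longrightarrow>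
    holds D e xs (is_subset x y) \<longleftrightarrow> sub (xs ! x) (xs ! y)"
  by (auto simp: is_subset_def sub_def nth_append dest: ok_mem)

lemma abs_zero [abs]: "ok D xs \<Longrightarrow> x < length xs \<Longrightarrow> holds D e xs (is_zero x) \<longleftrightarrow> xs ! x = zero"
  by (auto simp: is_zero_def zero_iff nth_append dest: ok_mem)

lemma abs_succ [abs]: "ok D xs \<Longrightarrow> x < length xs \<Longrightarrow> y < length xs \<Longrightarrow>
    holds D e xs (is_succ x y) \<longleftrightarrow> xs ! y = suc (xs ! x)"
  unfolding suc_iff by (auto simp: is_succ_def nth_append dest: ok_mem ok_nth)

lemma abs_upair [abs]: "ok D xs \<Longrightarrow> x < length xs \<Longrightarrow> y < length xs \<Longrightarrow> p < length xs \<Longrightarrow>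
    holds D e xs (is_upair x y p) \<longleftrightarrow> xs ! p = up (xs ! x) (xs ! y)"
  unfolding up_iff by (auto simp: is_upair_def nth_append dest: ok_mem ok_nth)

lemma abs_pair [abs]:
  assumes "ok D xs" "x < length xs" "y < length xs" "p < length xs"
  shows "holds D e xs (is_pair x y p) \<longleftrightarrow> xs ! p = op (xs ! x) (xs ! y)"
proof -
  \<comment> \<open>Both auxiliary sets of a Kuratowski pair are elements of it, so transitivity
    puts them into \<open>D\<close>.\<close>
  have "up (xs ! x) (xs ! x) \<in> D \<and> up (xs ! x) (xs ! y) \<in> D" if "xs ! p = op (xs ! x) (xs ! y)"
    using that ok_mem[OF assms(1,4)] unfolding op_def by simp
  with assms show ?thesis by (auto simp: is_pair_def nth_append abs op_def cong: bex_cong)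
qed

lemma abs_trans [abs]: "ok D xs \<Longrightarrow> x < length xs \<Longrightarrow> holds D e xs (is_trans x) \<longleftrightarrow> tr (xs ! x)"
  by (auto simp: is_trans_def tr_def nth_append abs dest: ok_mem)

lemma abs_num [abs]: "ok D xs \<Longrightarrow> x < length xs \<Longrightarrow> holds D e xs (is_num k x) \<longleftrightarrow> xs ! x = num k"
proof (induction k arbitrary: xs x)
  case (Suc k)
  have "num k \<in> D" if "xs ! x = suc (num k)"
    using ok_mem[OF Suc.prems, of "num k"] that by simp
  with Suc show ?case by (auto simp: nth_append abs)
qed (simp add: abs)

lemma abs_app [abs]: "ok D xs \<Longrightarrow> f < length xs \<Longrightarrow> x < length xs \<Longrightarrow> y < length xs \<Longrightarrow>
    holds D e xs (app f x y) \<longleftrightarrow> op (xs ! x) (xs ! y) \<lhd> xs ! f"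
  by (auto simp: app_def nth_append abs dest: ok_mem)

lemma abs_fun [abs]:
  assumes "ok D xs" "f < length xs" "a < length xs"
  shows "holds D e xs (is_fun f a) \<longleftrightarrow> isfun (xs ! f) (xs ! a)"
proof -
  have "holds D e xs (is_fun f a) \<longleftrightarrow> (\<forall>p\<in>D. p \<lhd> xs ! f \<longrightarrow> (\<exists>x\<in>D. \<exists>y\<in>D. x \<lhd> xs ! a \<and> p = op x y))
      \<and> (\<forall>x\<in>D. x \<lhd> xs ! a \<longrightarrow> (\<exists>y\<in>D. \<forall>z\<in>D. op x z \<lhd> xs ! f \<longleftrightarrow> z = y))"
    using assms by (simp add: is_fun_def nth_append abs cong: ball_cong bex_cong)
  also have "\<dots> \<longleftrightarrow> isfun (xs ! f) (xs ! a)" (is "?L \<longleftrightarrow> ?R")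
  proof
    assume L: ?L
    have f: "x \<in> D" "y \<in> D" if "op x y \<lhd> xs ! f" for x y
      using op_ok[OF assms(1,2) that] by auto
    have "\<exists>x y. x \<lhd> xs ! a \<and> p = op x y" if "p \<lhd> xs ! f" for p
      using L that ok_mem[OF assms(1,2) that] by blast
    moreover have "\<exists>y. \<forall>z. op x z \<lhd> xs ! f \<longleftrightarrow> z = y" if x: "x \<lhd> xs ! a" for x
    proof -
      from L x ok_mem[OF assms(1,3) x] obtain y where y: "y \<in> D" "\<forall>z\<in>D. op x z \<lhd> xs ! f \<longleftrightarrow> z = y"
        by blast
      have "op x z \<lhd> xs ! f \<longleftrightarrow> z = y" for z
        using y f(2)[of x z] by blast
      then show ?thesis by blast
    qed
    ultimately show ?R unfolding isfun_def by blast
  next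
    assume R: ?R
    have "\<exists>x\<in>D. \<exists>y\<in>D. x \<lhd> xs ! a \<and> p = op x y" if p: "p \<lhd> xs ! f" for p
    proof -
      from R p obtain x y where "x \<lhd> xs ! a" "p = op x y" unfolding isfun_def by blast
      with p op_ok[OF assms(1,2), of x y] show ?thesis by blast
    qed
    moreover have "\<exists>y\<in>D. \<forall>z\<in>D. op x z \<lhd> xs ! f \<longleftrightarrow> z = y" if x: "x \<lhd> xs ! a" for x
    proof -
      from R x obtain y where y: "\<forall>z. op x z \<lhd> xs ! f \<longleftrightarrow> z = y" unfolding isfun_def by blast
      with op_ok[OF assms(1,2), of x y] show ?thesis by blast
    qed
    ultimately show ?L by blast
  qed
  finally show ?thesis .
qed

lemma abs_maps [abs]:
  assumes "ok D xs" "f < length xs" "a < length xs" "b < length xs"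
  shows "holds D e xs (maps f a b) \<longleftrightarrow> mapsto (xs ! f) (xs ! a) (xs ! b)"
  using assms op_ok[OF assms(1,2)]
  by (auto simp: maps_def mapsto_def nth_append abs cong: ball_cong)

lemma abs_injective [abs]:
  assumes "ok D xs" "f < length xs"
  shows "holds D e xs (is_injective f) \<longleftrightarrow> injective (xs ! f)"
proof -
  have "holds D e xs (is_injective f) \<longleftrightarrow>
      (\<forall>x\<in>D. \<forall>y\<in>D. \<forall>z\<in>D. op x z \<lhd> xs ! f \<and> op y z \<lhd> xs ! f \<longrightarrow> x = y)"
    using assms by (simp add: is_injective_def nth_append abs cong: ball_cong bex_cong)
  also have "\<dots> \<longleftrightarrow> injective (xs ! f)"
    unfolding injective_def using op_ok[OF assms] by blast
  finally show ?thesis .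
qed

lemma abs_node [abs]:
  assumes "ok D xs" "a < length xs" "b < length xs" "c < length xs"
  shows "holds D e xs (is_node k a b c) \<longleftrightarrow> xs ! c = node k (xs ! a) (xs ! b)"
proof -
  have "num k \<in> D \<and> op (xs ! a) (xs ! b) \<in> D" if "xs ! c = op (num k) (op (xs ! a) (xs ! b))"
    using that op_D ok_nth[OF assms(1,4)] assms(1) unfolding ok_def by metis
  with assms show ?thesis
    by (auto simp: is_node_def node_def nth_append abs cong: bex_cong)
qed

lemma node_D: "trD D \<Longrightarrow> node k a b \<in> D \<Longrightarrow> a \<in> D \<and> b \<in> D"
  unfolding node_def using op_D by blast

lemma node_ok: "ok D xs \<Longrightarrow> c < length xs \<Longrightarrow> xs ! c = node k a b \<Longrightarrow> a \<in> D \<and> b \<in> D"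
  by (metis node_D ok_def ok_nth)

lemma abs_Falsum [abs]:
  "ok D xs \<Longrightarrow> c < length xs \<Longrightarrow> holds D e xs (code_Falsum c) \<longleftrightarrow> xs ! c = node 0 zero zero"
  by (auto simp: code_Falsum_def nth_append abs dest: node_ok cong: bex_cong)

subsection \<open>Internal syntax and satisfaction\<close>

definition nFalse :: 'a where "nFalse = node 0 zero zero"
definition nImp :: "'a \<Rightarrow> 'a \<Rightarrow> 'a" where "nImp p q = node 3 p q"
definition nAll :: "'a \<Rightarrow> 'a \<Rightarrow> 'a" where "nAll u p = node 4 u p"
definition nNot :: "'a \<Rightarrow> 'a" where "nNot p = nImp p nFalse"
definition nAnd :: "'a \<Rightarrow> 'a \<Rightarrow> 'a" where "nAnd p q = nNot (nImp p (nNot q))"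
definition nIff :: "'a \<Rightarrow> 'a \<Rightarrow> 'a" where "nIff p q = nAnd (nImp p q) (nImp q p)"
definition nEx :: "'a \<Rightarrow> 'a \<Rightarrow> 'a" where "nEx u p = nNot (nAll u (nNot p))"

primrec ncode :: "nfm \<Rightarrow> 'a" where
  "ncode NFalsum = nFalse"
| "ncode (NMem i j) = node 1 (num i) (num j)"
| "ncode (NEqu i j) = node 2 (num i) (num j)"
| "ncode (NImpl p q) = nImp (ncode p) (ncode q)"
| "ncode (NForall u p) = nAll (num u) (ncode p)"

lemma ncode_simps [simp]:
  "ncode (NNot p) = nNot (ncode p)"
  "ncode (NAnd p q) = nAnd (ncode p) (ncode q)"
  "ncode (NIff p q) = nIff (ncode p) (ncode q)"
  "ncode (NExists u p) = nEx (num u) (ncode p)"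
  by (simp_all add: NNot_def NAnd_def NIff_def NExists_def nNot_def nAnd_def nIff_def nEx_def)

lemma ncode_eq: "ncode p = ncode q \<longleftrightarrow> p = q"
proof (induction p arbitrary: q)
qed (case_tac q; auto simp: nFalse_def nImp_def nAll_def)+

text \<open>The description must stay correct when levels are appended, because \<open>cImp\<close>
  and \<open>cAll\<close> use it below further quantifiers.\<close>

definition denotes :: "'a set \<Rightarrow> (nat \<Rightarrow> 'a) \<Rightarrow> 'a list \<Rightarrow> code \<Rightarrow> 'a \<Rightarrow> bool" where
  "denotes D e xs P a \<longleftrightarrow> (\<forall>ys c. ok D (xs @ ys) \<longrightarrow> c < length (xs @ ys) \<longrightarrow>
     (holds D e (xs @ ys) (P c) \<longleftrightarrow> (xs @ ys) ! c = a))"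

lemma denotes_append: "denotes D e xs P a \<Longrightarrow> denotes D e (xs @ ys) P a"
  by (simp add: denotes_def)

lemma denotes_at: "denotes D e xs P a \<Longrightarrow> ok D xs \<Longrightarrow> c < length xs \<Longrightarrow> holds D e xs (P c) \<longleftrightarrow> xs ! c = a"
  unfolding denotes_def by (metis append_Nil2)

lemma denotesI:
  assumes "\<And>zs c. ok D zs \<Longrightarrow> c < length zs \<Longrightarrow> (\<And>i. i < length xs \<Longrightarrow> zs ! i = xs ! i) \<Longrightarrow>
    length xs \<le> length zs \<Longrightarrow> (\<And>P a. denotes D e xs P a \<Longrightarrow> denotes D e zs P a) \<Longrightarrow>
    holds D e zs (P c) \<longleftrightarrow> zs ! c = a"
  shows "denotes D e xs P a"
  unfolding denotes_def
proof (intro allI impI)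
  fix ys c assume "ok D (xs @ ys)" "c < length (xs @ ys)"
  then show "holds D e (xs @ ys) (P c) \<longleftrightarrow> (xs @ ys) ! c = a"
    by (rule assms) (simp_all add: denotes_append nth_append)
qed

lemma denotes_Var: "p < length xs \<Longrightarrow> denotes D e xs (cVar p) (xs ! p)"
  by (rule denotesI) (simp add: cVar_def)

lemma denotes_False: "denotes D e xs cFalse nFalse"
  by (rule denotesI) (simp add: cFalse_def abs nFalse_def)

lemma denotes_Mem: "u < length xs \<Longrightarrow> v < length xs \<Longrightarrow> denotes D e xs (cMem u v) (node 1 (xs ! u) (xs ! v))"
  by (rule denotesI) (simp add: cMem_def abs)

lemma denotes_Equ: "u < length xs \<Longrightarrow> v < length xs \<Longrightarrow> denotes D e xs (cEqu u v) (node 2 (xs ! u) (xs ! v))"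
  by (rule denotesI) (simp add: cEqu_def abs)

lemma denotes_Imp:
  assumes P: "denotes D e xs P a" and Q: "denotes D e xs Q b"
  shows "denotes D e xs (cImp P Q) (nImp a b)"
proof (rule denotesI)
  fix zs c assume *: "ok D zs" "c < length zs"
    and nth: "\<And>i. i < length xs \<Longrightarrow> zs ! i = xs ! i" and len: "length xs \<le> length zs"
    and den: "\<And>P a. denotes D e xs P a \<Longrightarrow> denotes D e zs P a"
  have "holds D e zs (cImp P Q c) \<longleftrightarrow> (\<exists>p\<in>D. \<exists>q\<in>D. p = a \<and> q = b \<and> zs ! c = node 3 p q)"
    using * denotes_at[OF denotes_append[OF den[OF P]]] denotes_at[OF denotes_append[OF den[OF Q]]]
    by (simp add: cImp_def abs nth_append cong: bex_cong)
  also have "\<dots> \<longleftrightarrow> zs ! c = nImp a b"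
    using node_ok[OF *] unfolding nImp_def by blast
  finally show "holds D e zs (cImp P Q c) \<longleftrightarrow> zs ! c = nImp a b" .
qed

lemma denotes_All:
  assumes u: "u < length xs" and P: "denotes D e xs P a"
  shows "denotes D e xs (cAll u P) (nAll (xs ! u) a)"
proof (rule denotesI)
  fix zs c assume *: "ok D zs" "c < length zs"
    and nth: "\<And>i. i < length xs \<Longrightarrow> zs ! i = xs ! i" and len: "length xs \<le> length zs"
    and den: "\<And>P a. denotes D e xs P a \<Longrightarrow> denotes D e zs P a"
  have "holds D e zs (cAll u P c) \<longleftrightarrow> (\<exists>p\<in>D. p = a \<and> zs ! c = node 4 (xs ! u) p)"
    using * u nth len denotes_at[OF denotes_append[OF den[OF P]]]
    by (simp add: cAll_def abs nth_append cong: bex_cong)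
  also have "\<dots> \<longleftrightarrow> zs ! c = nAll (xs ! u) a"
    using node_ok[OF *] unfolding nAll_def by blast
  finally show "holds D e zs (cAll u P c) \<longleftrightarrow> zs ! c = nAll (xs ! u) a" .
qed

lemma denotes_Not: "denotes D e xs P a \<Longrightarrow> denotes D e xs (cNot P) (nNot a)"
  unfolding cNot_def nNot_def by (intro denotes_Imp denotes_False)

lemma denotes_And: "denotes D e xs P a \<Longrightarrow> denotes D e xs Q b \<Longrightarrow> denotes D e xs (cAnd P Q) (nAnd a b)"
  unfolding cAnd_def nAnd_def by (intro denotes_Imp denotes_Not)

lemma denotes_Iff: "denotes D e xs P a \<Longrightarrow> denotes D e xs Q b \<Longrightarrow> denotes D e xs (cIff P Q) (nIff a b)"
  unfolding cIff_def nIff_def by (intro denotes_Imp denotes_And)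

lemma denotes_Ex: "u < length xs \<Longrightarrow> denotes D e xs P a \<Longrightarrow> denotes D e xs (cEx u P) (nEx (xs ! u) a)"
  unfolding cEx_def nEx_def by (intro denotes_Not denotes_All)

text \<open>Both translations name the variable of a quantifier after its depth, so the internal
  description and the external code agree.\<close>

lemma denotes_code_of: "denotes D e xs (code_of p d) (ncode (named p d))"
proof (induction p arbitrary: d xs)
  case (Mem i j)
  show ?case
  proof (rule denotesI)
    fix zs c assume *: "ok D zs" "c < length zs"
    and nth: "\<And>i. i < length xs \<Longrightarrow> zs ! i = xs ! i" and len: "length xs \<le> length zs"
    and den: "\<And>P a. denotes D e xs P a \<Longrightarrow> denotes D e zs P a"
    have "holds D e zs (code_of (Mem i j) d c) \<longleftrightarrow>
        (\<exists>u\<in>D. \<exists>v\<in>D. u = num (d - Suc i) \<and> v = num (d - Suc j) \<and> zs ! c = node 1 u v)"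
      using * by (simp add: cMem_def abs nth_append cong: bex_cong)
    also have "\<dots> \<longleftrightarrow> zs ! c = ncode (named (Mem i j) d)"
      using node_ok[OF *] by auto
    finally show "holds D e zs (code_of (Mem i j) d c) \<longleftrightarrow> zs ! c = ncode (named (Mem i j) d)" .
  qed
next
  case (Equ i j)
  show ?case
  proof (rule denotesI)
    fix zs c assume *: "ok D zs" "c < length zs"
    and nth: "\<And>i. i < length xs \<Longrightarrow> zs ! i = xs ! i" and len: "length xs \<le> length zs"
    and den: "\<And>P a. denotes D e xs P a \<Longrightarrow> denotes D e zs P a"
    have "holds D e zs (code_of (Equ i j) d c) \<longleftrightarrow>
        (\<exists>u\<in>D. \<exists>v\<in>D. u = num (d - Suc i) \<and> v = num (d - Suc j) \<and> zs ! c = node 2 u v)"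
      using * by (simp add: cEqu_def abs nth_append cong: bex_cong)
    also have "\<dots> \<longleftrightarrow> zs ! c = ncode (named (Equ i j) d)"
      using node_ok[OF *] by auto
    finally show "holds D e zs (code_of (Equ i j) d c) \<longleftrightarrow> zs ! c = ncode (named (Equ i j) d)" .
  qed
next
  case (Forall p)
  show ?case
  proof (rule denotesI)
    fix zs c assume *: "ok D zs" "c < length zs"
    and nth: "\<And>i. i < length xs \<Longrightarrow> zs ! i = xs ! i" and len: "length xs \<le> length zs"
    and den: "\<And>P a. denotes D e xs P a \<Longrightarrow> denotes D e zs P a"
    have **: "denotes D e (zs @ [num d]) (cAll (length zs) (code_of p (Suc d)))
        (nAll ((zs @ [num d]) ! length zs) (ncode (named p (Suc d))))"
      by (intro denotes_All Forall.IH) simp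
    have "holds D e zs (code_of (Forall p) d c) \<longleftrightarrow>
        (\<exists>u\<in>D. u = num d \<and> zs ! c = nAll u (ncode (named p (Suc d))))"
      using * denotes_at[OF **, of c] by (auto simp add: abs nth_append)
    also have "\<dots> \<longleftrightarrow> zs ! c = ncode (named (Forall p) d)"
      using node_ok[OF *] unfolding nAll_def by (auto simp: nAll_def)
    finally show "holds D e zs (code_of (Forall p) d c) \<longleftrightarrow> zs ! c = ncode (named (Forall p) d)" .
  qed
qed (auto intro: denotes_False denotes_Imp)

lemma abs_code_of [abs]: "ok D xs \<Longrightarrow> c < length xs \<Longrightarrow>
    holds D e xs (code_of p d c) \<longleftrightarrow> xs ! c = ncode (named p d)"
  using denotes_at denotes_code_of by blast

section \<open>Formation sequences and Tarski clauses\<close>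

definition formstep :: "'a \<Rightarrow> 'a \<Rightarrow> 'a \<Rightarrow> 'a \<Rightarrow> bool" where
  "formstep f w i c \<longleftrightarrow> c = nFalse \<or>
     (\<exists>u v. u \<lhd> w \<and> v \<lhd> w \<and> (c = node 1 u v \<or> c = node 2 u v)) \<or>
     (\<exists>j l p q. j \<lhd> i \<and> l \<lhd> i \<and> op j p \<lhd> f \<and> op l q \<lhd> f \<and> c = nImp p q) \<or>
     (\<exists>u j p. u \<lhd> w \<and> j \<lhd> i \<and> op j p \<lhd> f \<and> c = nAll u p)"
definition fseq :: "'a \<Rightarrow> 'a \<Rightarrow> 'a \<Rightarrow> bool" where
  "fseq f k w \<longleftrightarrow> isfun f k \<and> (\<forall>i c. i \<lhd> k \<and> op i c \<lhd> f \<longrightarrow> formstep f w i c)"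

definition tarski :: "'a \<Rightarrow> 'a \<Rightarrow> 'a \<Rightarrow> 'a \<Rightarrow> 'a \<Rightarrow> bool" where
  "tarski A n S c s \<longleftrightarrow> (c = nFalse \<longrightarrow> \<not> op c s \<lhd> S) \<and>
     (\<forall>u v. c = node 1 u v \<longrightarrow> (op c s \<lhd> S \<longleftrightarrow> (\<exists>x y. op u x \<lhd> s \<and> op v y \<lhd> s \<and> x \<lhd> y))) \<and>
     (\<forall>u v. c = node 2 u v \<longrightarrow> (op c s \<lhd> S \<longleftrightarrow> (\<exists>x y. op u x \<lhd> s \<and> op v y \<lhd> s \<and> x = y))) \<and>
     (\<forall>p q. c = nImp p q \<longrightarrow> (op c s \<lhd> S \<longleftrightarrow> (op p s \<lhd> S \<longrightarrow> op q s \<lhd> S))) \<and>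
     (\<forall>u p. c = nAll u p \<longrightarrow> (op c s \<lhd> S \<longleftrightarrow>
       (\<forall>t. mapsto t n A \<and> (\<forall>j x. j \<noteq> u \<longrightarrow> (op j x \<lhd> t \<longleftrightarrow> op j x \<lhd> s)) \<longrightarrow> op p t \<lhd> S)))"
definition satrel :: "'a \<Rightarrow> 'a \<Rightarrow> 'a \<Rightarrow> 'a \<Rightarrow> bool" where
  "satrel A n f S \<longleftrightarrow> (\<forall>i c s. op i c \<lhd> f \<and> mapsto s n A \<longrightarrow> tarski A n S c s)"

lemma abs_fseq [abs]:
  assumes "ok D xs" "f < length xs" "k < length xs" "w < length xs"
  shows "holds D e xs (formation_seq f k w) \<longleftrightarrow>
    holds D e xs (is_nat k) \<and> fseq (xs ! f) (xs ! k) (xs ! w)"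
proof -
  let ?f = "xs ! f" and ?k = "xs ! k" and ?w = "xs ! w"
  have w: "u \<in> D" if "u \<lhd> ?w" for u using that ok_mem assms by blast
  have f: "j \<in> D" "p \<in> D" if "op j p \<lhd> ?f" for j p using that op_ok assms by blast+
  have "holds D e xs (formation_seq f k w) \<longleftrightarrow> holds D e xs (is_nat k) \<and> isfun ?f ?k \<and>
     (\<forall>i\<in>D. \<forall>c\<in>D. i \<lhd> ?k \<and> op i c \<lhd> ?f \<longrightarrow> c = nFalse \<or>
     (\<exists>u\<in>D. \<exists>v\<in>D. u \<lhd> ?w \<and> v \<lhd> ?w \<and> (c = node 1 u v \<or> c = node 2 u v)) \<or>
     (\<exists>j\<in>D. \<exists>l\<in>D. \<exists>p\<in>D. \<exists>q\<in>D. j \<lhd> i \<and> l \<lhd> i \<and> op j p \<lhd> ?f \<and> op l q \<lhd> ?f \<and> c = nImp p q) \<or>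
     (\<exists>u\<in>D. \<exists>j\<in>D. \<exists>p\<in>D. u \<lhd> ?w \<and> j \<lhd> i \<and> op j p \<lhd> ?f \<and> c = nAll u p))" (is "_ \<longleftrightarrow> _ \<and> _ \<and> ?L")
    using assms by (simp add: formation_seq_def abs nth_append nFalse_def nImp_def nAll_def cong: ball_cong bex_cong)
  moreover have "(\<exists>u\<in>D. \<exists>v\<in>D. u \<lhd> ?w \<and> v \<lhd> ?w \<and> (c = node 1 u v \<or> c = node 2 u v)) \<longleftrightarrow>
      (\<exists>u v. u \<lhd> ?w \<and> v \<lhd> ?w \<and> (c = node 1 u v \<or> c = node 2 u v))" for c
    using w by blast
  moreover have "(\<exists>j\<in>D. \<exists>l\<in>D. \<exists>p\<in>D. \<exists>q\<in>D. j \<lhd> i \<and> l \<lhd> i \<and> op j p \<lhd> ?f \<and> op l q \<lhd> ?f \<and> c = nImp p q) \<longleftrightarrow>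
      (\<exists>j l p q. j \<lhd> i \<and> l \<lhd> i \<and> op j p \<lhd> ?f \<and> op l q \<lhd> ?f \<and> c = nImp p q)" for c i
    using f by blast
  moreover have "(\<exists>u\<in>D. \<exists>j\<in>D. \<exists>p\<in>D. u \<lhd> ?w \<and> j \<lhd> i \<and> op j p \<lhd> ?f \<and> c = nAll u p) \<longleftrightarrow>
      (\<exists>u j p. u \<lhd> ?w \<and> j \<lhd> i \<and> op j p \<lhd> ?f \<and> c = nAll u p)" for c i
    using w f by blast
  moreover have "(\<forall>i\<in>D. \<forall>c\<in>D. i \<lhd> ?k \<and> op i c \<lhd> ?f \<longrightarrow> Q i c) \<longleftrightarrow> (\<forall>i c. i \<lhd> ?k \<and> op i c \<lhd> ?f \<longrightarrow> Q i c)" for Q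
    using f by blast
  ultimately show ?thesis unfolding fseq_def formstep_def by simp
qed

text \<open>The quantifiers over assignments are not bounded by any parameter. Hence the hypothesis
  that \<open>D\<close> contains all assignments, which holds in the universe and, for
  \<open>n\<close> in \<open>om\<close>, in every model containing \<open>A\<close>.\<close>

lemma abs_satrel [abs]:
  assumes "ok D xs" "A < length xs" "n < length xs" "f < length xs" "S < length xs"
    and s: "\<And>s. mapsto s (xs ! n) (xs ! A) \<Longrightarrow> s \<in> D"
  shows "holds D e xs (satisfaction_rel A n f S) \<longleftrightarrow> satrel (xs ! A) (xs ! n) (xs ! f) (xs ! S)"
proof -
  let ?A = "xs ! A" and ?n = "xs ! n" and ?f = "xs ! f" and ?S = "xs ! S"
  have tD: "trD D" using assms(1) by (simp add: ok_def)
  have "holds D e xs (satisfaction_rel A n f S) \<longleftrightarrow> (\<forall>i\<in>D. \<forall>c\<in>D. \<forall>s\<in>D. op i c \<lhd> ?f \<and> mapsto s ?n ?A \<longrightarrow>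
     (c = nFalse \<longrightarrow> \<not> op c s \<lhd> ?S) \<and>
     (\<forall>u\<in>D. \<forall>v\<in>D. c = node 1 u v \<longrightarrow> (op c s \<lhd> ?S \<longleftrightarrow> (\<exists>x\<in>D. \<exists>y\<in>D. op u x \<lhd> s \<and> op v y \<lhd> s \<and> x \<lhd> y))) \<and>
     (\<forall>u\<in>D. \<forall>v\<in>D. c = node 2 u v \<longrightarrow> (op c s \<lhd> ?S \<longleftrightarrow> (\<exists>x\<in>D. \<exists>y\<in>D. op u x \<lhd> s \<and> op v y \<lhd> s \<and> x = y))) \<and>
     (\<forall>p\<in>D. \<forall>q\<in>D. c = nImp p q \<longrightarrow> (op c s \<lhd> ?S \<longleftrightarrow> (op p s \<lhd> ?S \<longrightarrow> op q s \<lhd> ?S))) \<and>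
     (\<forall>u\<in>D. \<forall>p\<in>D. c = nAll u p \<longrightarrow> (op c s \<lhd> ?S \<longleftrightarrow>
       (\<forall>t\<in>D. mapsto t ?n ?A \<and> (\<forall>j\<in>D. \<forall>x\<in>D. j \<noteq> u \<longrightarrow> (op j x \<lhd> t \<longleftrightarrow> op j x \<lhd> s)) \<longrightarrow> op p t \<lhd> ?S))))"
    (is "_ \<longleftrightarrow> (\<forall>i\<in>D. \<forall>c\<in>D. \<forall>s\<in>D. ?H i c s \<longrightarrow> ?L c s)")
    using assms(1-5)
    by (simp add: satisfaction_rel_def abs nth_append nFalse_def nImp_def nAll_def cong: ball_cong bex_cong cong del: imp_cong)
  also have "\<dots> \<longleftrightarrow> (\<forall>i\<in>D. \<forall>c\<in>D. \<forall>s\<in>D. ?H i c s \<longrightarrow> tarski ?A ?n ?S c s)"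
  proof (intro ball_cong refl imp_cong)
    fix c s assume cs: "c \<in> D" "s \<in> D"
    have 1: "u \<in> D \<and> x \<in> D" if "op u x \<lhd> t" "t \<in> D" for u x t
      using that tD op_D trD_mem by blast
    have 2: "u \<in> D \<and> v \<in> D" if "c = node k u v" for k u v
      using node_D[OF tD] cs(1) that by blast
    have 3: "(\<exists>x\<in>D. \<exists>y\<in>D. op u x \<lhd> s \<and> op v y \<lhd> s \<and> Q x y) \<longleftrightarrow> (\<exists>x y. op u x \<lhd> s \<and> op v y \<lhd> s \<and> Q x y)"
      for u v Q using 1[OF _ cs(2)] by blast
    have 4: "(\<forall>j\<in>D. \<forall>x\<in>D. j \<noteq> u \<longrightarrow> (op j x \<lhd> t \<longleftrightarrow> op j x \<lhd> s)) \<longleftrightarrow>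
        (\<forall>j x. j \<noteq> u \<longrightarrow> (op j x \<lhd> t \<longleftrightarrow> op j x \<lhd> s))" if "t \<in> D" for t u
      using 1[OF _ cs(2)] 1[OF _ that] by blast
    have 5: "(\<forall>t\<in>D. mapsto t ?n ?A \<and> (\<forall>j\<in>D. \<forall>x\<in>D. j \<noteq> u \<longrightarrow> (op j x \<lhd> t \<longleftrightarrow> op j x \<lhd> s)) \<longrightarrow> op p t \<lhd> ?S) \<longleftrightarrow>
        (\<forall>t. mapsto t ?n ?A \<and> (\<forall>j x. j \<noteq> u \<longrightarrow> (op j x \<lhd> t \<longleftrightarrow> op j x \<lhd> s)) \<longrightarrow> op p t \<lhd> ?S)" for u p
      using 4 s by blast
    have 6: "(\<forall>u\<in>D. \<forall>v\<in>D. c = node k u v \<longrightarrow> Q u v) \<longleftrightarrow> (\<forall>u v. c = node k u v \<longrightarrow> Q u v)" for k Q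
      using 2 by blast
    show "?L c s = tarski ?A ?n ?S c s" unfolding tarski_def 3 5 nImp_def nAll_def 6 ..
  qed
  also have "\<dots> \<longleftrightarrow> satrel ?A ?n ?f ?S"
  proof -
    have "(\<forall>i\<in>D. \<forall>c\<in>D. \<forall>s\<in>D. ?H i c s \<longrightarrow> Q c s) \<longleftrightarrow> (\<forall>i c s. ?H i c s \<longrightarrow> Q c s)" for Q
      using op_ok[OF assms(1,4)] s by blast
    then show ?thesis unfolding satrel_def .
  qed
  finally show ?thesis .
qed

definition ord :: "'a \<Rightarrow> bool" where
  "ord x \<longleftrightarrow> tr x \<and> (\<forall>y z. y \<lhd> x \<and> z \<lhd> x \<longrightarrow> y \<lhd> z \<or> y = z \<or> z \<lhd> y) \<and>
     (\<forall>s. sub s x \<and> s \<noteq> zero \<longrightarrow> (\<exists>u. u \<lhd> s \<and> (\<forall>v. v \<lhd> s \<longrightarrow> \<not> v \<lhd> u)))"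
definition limit :: "'a \<Rightarrow> bool" where
  "limit x \<longleftrightarrow> ord x \<and> x \<noteq> zero \<and> (\<forall>y. y \<lhd> x \<longrightarrow> (\<exists>z. z \<lhd> x \<and> y \<lhd> z))"
definition isom :: "'a \<Rightarrow> bool" where
  "isom w \<longleftrightarrow> limit w \<and> (\<forall>x. x \<lhd> w \<longrightarrow> \<not> limit x)"
definition isnat :: "'a \<Rightarrow> bool" where
  "isnat x \<longleftrightarrow> (\<exists>w. isom w \<and> x \<lhd> w)"

text \<open>Over the universe the unbounded subset quantifier of \<open>is_ord\<close> is read
  literally. The versions for transitive domains need foundation and follow once it has been
  derived.\<close>

lemma absU_ord: "x < length xs \<Longrightarrow> holds UNIV e xs (is_ord x) \<longleftrightarrow> ord (xs ! x)"
  by (simp add: is_ord_def ord_def abs nth_append)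
lemma absU_limit: "x < length xs \<Longrightarrow> holds UNIV e xs (is_limit x) \<longleftrightarrow> limit (xs ! x)"
  by (simp add: is_limit_def limit_def absU_ord abs nth_append)
lemma absU_omega: "x < length xs \<Longrightarrow> holds UNIV e xs (is_omega x) \<longleftrightarrow> isom (xs ! x)"
  by (simp add: is_omega_def isom_def absU_limit abs nth_append)
lemma absU_nat: "x < length xs \<Longrightarrow> holds UNIV e xs (is_nat x) \<longleftrightarrow> isnat (xs ! x)"
  by (simp add: is_nat_def isnat_def absU_omega abs nth_append)
lemmas absU = absU_ord absU_limit absU_omega absU_nat

definition evals :: "'a \<Rightarrow> 'a \<Rightarrow> 'a \<Rightarrow> 'a \<Rightarrow> bool" where
  "evals S A c n \<longleftrightarrow> isnat n \<and> (\<exists>f k i. isnat k \<and> fseq f k n \<and> op i c \<lhd> f \<and> satrel A n f S)"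
definition truein :: "'a \<Rightarrow> 'a \<Rightarrow> bool" where
  "truein A c \<longleftrightarrow> (\<exists>n S. evals S A c n \<and> (\<forall>s. mapsto s n A \<longrightarrow> op c s \<lhd> S))"
definition isformula :: "'a \<Rightarrow> 'a \<Rightarrow> bool" where
  "isformula w c \<longleftrightarrow> (\<exists>f k i. isnat k \<and> fseq f k w \<and> op i c \<lhd> f)"

lemma absU_evaluates: "S < length xs \<Longrightarrow> A < length xs \<Longrightarrow> c < length xs \<Longrightarrow> n < length xs \<Longrightarrow>
    holds UNIV e xs (evaluates S A c n) \<longleftrightarrow> evals (xs ! S) (xs ! A) (xs ! c) (xs ! n)"
  by (simp add: evaluates_def evals_def absU abs nth_append)
lemma absU_true: "A < length xs \<Longrightarrow> c < length xs \<Longrightarrow>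
    holds UNIV e xs (true_in A c) \<longleftrightarrow> truein (xs ! A) (xs ! c)"
  by (simp add: true_in_def truein_def absU_evaluates abs nth_append)
lemma absU_formula: "w < length xs \<Longrightarrow> c < length xs \<Longrightarrow>
    holds UNIV e xs (is_formula w c) \<longleftrightarrow> isformula (xs ! w) (xs ! c)"
  by (simp add: is_formula_def isformula_def absU abs nth_append)

section \<open>Codes of the ZFC axioms\<close>

definition sepcode :: "'a \<Rightarrow> 'a \<Rightarrow> 'a \<Rightarrow> 'a \<Rightarrow> 'a" where
  "sepcode a b x p = nAll a (nEx b (nAll x (nIff (node 1 x b) (nAnd (node 1 x a) p))))"
definition replcode :: "'a \<Rightarrow> 'a \<Rightarrow> 'a \<Rightarrow> 'a \<Rightarrow> 'a \<Rightarrow> 'a" where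
  "replcode a b x y p = nAll a (nImp
     (nAll x (nImp (node 1 x a) (nEx b (nAll y (nIff p (node 2 y b))))))
     (nEx b (nAll x (nImp (node 1 x a) (nEx y (nAnd (node 1 y b) p))))))"
definition sepax :: "'a \<Rightarrow> bool" where
  "sepax c \<longleftrightarrow> (\<exists>om w p a b x. isom om \<and> sub w om \<and> a \<lhd> om \<and> b \<lhd> om \<and> x \<lhd> om \<and>
     a \<noteq> b \<and> a \<noteq> x \<and> b \<noteq> x \<and> isformula w p \<and> \<not> b \<lhd> w \<and> c = sepcode a b x p)"
definition replax :: "'a \<Rightarrow> bool" where
  "replax c \<longleftrightarrow> (\<exists>om w p a b x y. isom om \<and> sub w om \<and> a \<lhd> om \<and> b \<lhd> om \<and> x \<lhd> om \<and> y \<lhd> om \<and>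
     a \<noteq> b \<and> a \<noteq> x \<and> a \<noteq> y \<and> b \<noteq> x \<and> b \<noteq> y \<and> x \<noteq> y \<and>
     isformula w p \<and> \<not> b \<lhd> w \<and> c = replcode a b x y p)"

lemma absU_sep: 
  assumes "c < length xs"
  shows "holds UNIV e xs (is_separation c) \<longleftrightarrow> sepax (xs ! c)"
proof -
  let ?n = "length xs"
  have *: "holds UNIV e (xs @ [om, w, p, a, b, x])
      (cAll (?n+3) (cEx (?n+4) (cAll (?n+5) (cIff (cMem (?n+5) (?n+4)) (cAnd (cMem (?n+5) (?n+3)) (cVar (?n+2)))))) c)
      \<longleftrightarrow> xs ! c = sepcode a b x p" for om w p a b x
  proof -
    let ?zs = "xs @ [om, w, p, a, b, x]"
    have "denotes UNIV e ?zs
      (cAll (?n+3) (cEx (?n+4) (cAll (?n+5) (cIff (cMem (?n+5) (?n+4)) (cAnd (cMem (?n+5) (?n+3)) (cVar (?n+2)))))))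
      (sepcode (?zs ! (?n+3)) (?zs ! (?n+4)) (?zs ! (?n+5)) (?zs ! (?n+2)))"
      unfolding sepcode_def
      by (intro denotes_All denotes_Ex denotes_Iff denotes_And denotes_Mem denotes_Var) simp_all
    from denotes_at[OF this, of c] assms show ?thesis
      by (simp add: nth_append)
  qed
  show ?thesis
    using assms *
    by (simp add: is_separation_def sepax_def absU absU_formula abs nth_append eval_nat_numeral)
qed

lemma absU_repl: 
  assumes "c < length xs"
  shows "holds UNIV e xs (is_replacement c) \<longleftrightarrow> replax (xs ! c)"
proof -
  let ?n = "length xs"
  have *: "holds UNIV e (xs @ [om, w, p, a, b, x, y])
      (cAll (?n+3) (cImp (cAll (?n+5) (cImp (cMem (?n+5) (?n+3)) (cEx (?n+4) (cAll (?n+6) (cIff (cVar (?n+2)) (cEqu (?n+6) (?n+4)))))))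
        (cEx (?n+4) (cAll (?n+5) (cImp (cMem (?n+5) (?n+3)) (cEx (?n+6) (cAnd (cMem (?n+6) (?n+4)) (cVar (?n+2)))))))) c)
      \<longleftrightarrow> xs ! c = replcode a b x y p" for om w p a b x y
  proof -
    let ?zs = "xs @ [om, w, p, a, b, x, y]"
    have "denotes UNIV e ?zs
      (cAll (?n+3) (cImp (cAll (?n+5) (cImp (cMem (?n+5) (?n+3)) (cEx (?n+4) (cAll (?n+6) (cIff (cVar (?n+2)) (cEqu (?n+6) (?n+4)))))))
        (cEx (?n+4) (cAll (?n+5) (cImp (cMem (?n+5) (?n+3)) (cEx (?n+6) (cAnd (cMem (?n+6) (?n+4)) (cVar (?n+2)))))))))
      (replcode (?zs ! (?n+3)) (?zs ! (?n+4)) (?zs ! (?n+5)) (?zs ! (?n+6)) (?zs ! (?n+2)))"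
      unfolding replcode_def
      by (intro denotes_All denotes_Ex denotes_Iff denotes_And denotes_Imp denotes_Mem denotes_Equ denotes_Var) simp_all
    from denotes_at[OF this, of c] assms show ?thesis
      by (simp add: nth_append)
  qed
  show ?thesis
    using assms *
    by (simp add: is_replacement_def replax_def absU absU_formula abs nth_append eval_nat_numeral)
qed

definition axiom_forms :: "form set" where
  "axiom_forms = {ax_extensionality, ax_foundation, ax_pair, ax_union, ax_power, ax_infinity, ax_choice}"
definition zfcax :: "'a \<Rightarrow> bool" where
  "zfcax c \<longleftrightarrow> (\<exists>P\<in>axiom_forms. c = ncode (named (sentence P) 0)) \<or> sepax c \<or> replax c"
definition model :: "'a \<Rightarrow> bool" where
  "model M \<longleftrightarrow> tr M \<and> M \<noteq> zero \<and> (\<forall>c. zfcax c \<longrightarrow> truein M c)"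

lemma absU_zfc: "M < length xs \<Longrightarrow> holds UNIV e xs (satisfies_ZFC M) \<longleftrightarrow>
    xs ! M \<noteq> zero \<and> (\<forall>c. zfcax c \<longrightarrow> truein (xs ! M) c)"
  by (simp add: satisfies_ZFC_def is_ZFC_axiom_def zfcax_def axiom_forms_def absU_true absU_sep absU_repl abs nth_append)

lemma absU_model: "M < length xs \<Longrightarrow> holds UNIV e xs (is_model M) \<longleftrightarrow> model (xs ! M)"
  by (simp add: is_model_def model_def absU_zfc abs)

lemma ex_model: "\<exists>M. x \<lhd> M \<and> model M"
  using LZFC_holds[of Loc_ZFC]
  by (simp add: LZFC_def Loc_ZFC_def absU_zfc abs model_def)

subsection \<open>Assignments\<close>

text \<open>Until models can be exploited this is the only comprehension at hand. It yields the
  removal of a point, intersections and differences.\<close>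

lemma Delta0_separation:
  assumes "Delta0 p"
  shows "\<exists>b. \<forall>x. x \<lhd> b \<longleftrightarrow> x \<lhd> a \<and> sat E UNIV (case_nat x e) p"
proof -
  have "separation p \<in> LZFC" using assms by (auto simp: LZFC_def BST_def)
  from sat_closure[OF lzfc[OF this, unfolded separation_def]]
  have *: "sat E UNIV e (Forall (Exists (Forall (Iff (Mem 0 1)
      (Conj (Mem 0 2) (rename (case_nat 0 (\<lambda>i. i + 3)) p))))))" .
  have "(\<lambda>i. case_nat x (case_nat b (case_nat c e)) (case_nat 0 (\<lambda>i. i + 3) i)) = case_nat x e" for x b c
    by (auto simp: fun_eq_iff eval_nat_numeral split: nat.split)
  then have r: "sat E UNIV (case_nat x (case_nat b (case_nat c e))) (rename (case_nat 0 (\<lambda>i. i + 3)) p) \<longleftrightarrow>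
      sat E UNIV (case_nat x e) p" for x b c
    by (simp only: sat_rename)
  from *[unfolded sat.simps sat_Exists sat_Iff sat_Conj r] show ?thesis
    by (simp add: eval_nat_numeral)
qed

lemma ex_rem: "\<exists>b. \<forall>x. x \<lhd> b \<longleftrightarrow> x \<lhd> a \<and> x \<noteq> q"
  using Delta0_separation[OF Delta0_Neg[OF Delta0.intros(3)], of a "\<lambda>_. q" 0 1] by simp

lemma ex_prod: "\<exists>c. \<forall>z. z \<lhd> c \<longleftrightarrow> (\<exists>x y. x \<lhd> a \<and> y \<lhd> b \<and> z = op x y)"
  using LZFC_holds[of ax_product]
  by (simp add: LZFC_def BST_def ax_product_def abs)

lemma isfun_mem: "isfun f a \<Longrightarrow> op x y \<lhd> f \<Longrightarrow> x \<lhd> a"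
  unfolding isfun_def by fastforce

lemma isfun_unique: "isfun f a \<Longrightarrow> op x y \<lhd> f \<Longrightarrow> op x z \<lhd> f \<Longrightarrow> y = z"
proof -
  assume f: "isfun f a" "op x y \<lhd> f" "op x z \<lhd> f"
  then obtain w where "\<forall>z. op x z \<lhd> f \<longleftrightarrow> z = w"
    using isfun_mem unfolding isfun_def by blast
  with f(2,3) have "y = w" "z = w" by auto
  then show "y = z" by simp
qed

lemma isfun_ex: "isfun f a \<Longrightarrow> x \<lhd> a \<Longrightarrow> \<exists>y. op x y \<lhd> f"
  unfolding isfun_def by blast

lemma isfunI:
  assumes "\<And>p. p \<lhd> f \<Longrightarrow> \<exists>x y. x \<lhd> a \<and> p = op x y" "\<And>x. x \<lhd> a \<Longrightarrow> \<exists>y. op x y \<lhd> f"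
    "\<And>x y z. op x y \<lhd> f \<Longrightarrow> op x z \<lhd> f \<Longrightarrow> y = z"
  shows "isfun f a"
proof -
  have "\<exists>y. \<forall>z. op x z \<lhd> f \<longleftrightarrow> z = y" if "x \<lhd> a" for x
    using assms(2)[OF that] assms(3) by blast
  with assms(1) show ?thesis unfolding isfun_def by blast
qed

text \<open>One pair is deleted and one is added, so Delta0 separation is enough at this
  point.\<close>

lemma ex_update:
  assumes s: "mapsto s n A" and "u \<lhd> n" "a \<lhd> A"
  shows "\<exists>t. mapsto t n A \<and> op u a \<lhd> t \<and> (\<forall>j x. j \<noteq> u \<longrightarrow> (op j x \<lhd> t \<longleftrightarrow> op j x \<lhd> s))"
proof -
  have f: "isfun s n" using s by (simp add: mapsto_def)
  obtain y where y: "op u y \<lhd> s" using isfun_ex[OF f assms(2)] by blast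
  obtain b where b: "\<And>x. x \<lhd> b \<longleftrightarrow> x \<lhd> s \<and> x \<noteq> op u y" using ex_rem by metis
  let ?t = "cup b (up (op u a) (op u a))"
  have mem: "op j x \<lhd> ?t \<longleftrightarrow> (if j = u then x = a else op j x \<lhd> s)" for j x
    using b isfun_unique[OF f y] by auto
  have "isfun ?t n"
  proof (rule isfunI)
    fix p assume "p \<lhd> ?t"
    then show "\<exists>x y. x \<lhd> n \<and> p = op x y"
      using f b assms(2) unfolding isfun_def by auto
  next
    fix x assume "x \<lhd> n"
    then show "\<exists>y. op x y \<lhd> ?t" using isfun_ex[OF f] unfolding mem by metis
  next
    fix x y z assume "op x y \<lhd> ?t" "op x z \<lhd> ?t"
    then show "y = z" using isfun_unique[OF f] unfolding mem by (metis (full_types))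
  qed
  moreover have "y \<lhd> A" if "op x y \<lhd> ?t" for x y
    using that s assms(3) unfolding mem mapsto_def by (metis (full_types))
  ultimately have "mapsto ?t n A" by (simp add: mapsto_def)
  with mem show ?thesis by (metis (full_types))
qed

definition val :: "'a \<Rightarrow> nat \<Rightarrow> 'a" where "val s i = (THE y. op (num i) y \<lhd> s)"

lemma val: "isfun s n \<Longrightarrow> num i \<lhd> n \<Longrightarrow> op (num i) y \<lhd> s \<longleftrightarrow> y = val s i"
proof -
  assume "isfun s n" "num i \<lhd> n"
  then obtain w where w: "\<And>z. op (num i) z \<lhd> s \<longleftrightarrow> z = w"
    unfolding isfun_def by blast
  then show "op (num i) y \<lhd> s \<longleftrightarrow> y = val s i" unfolding val_def by simp
qed

text \<open>Since \<open>n\<close> may be nonstandard, only finitely many values are prescribed, by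
  HOL induction on their number \<open>K\<close>, starting from the constant assignment with value
  \<open>\<rho> 0\<close>.\<close>

lemma ex_assignment:
  assumes \<rho>: "\<And>i. \<rho> i \<lhd> A"
  shows "\<exists>s. mapsto s n A \<and> (\<forall>i<K. num i \<lhd> n \<longrightarrow> val s i = \<rho> i)"
proof (induction K)
  case 0
  obtain c where c: "\<And>z. z \<lhd> c \<longleftrightarrow> (\<exists>x y. x \<lhd> n \<and> y \<lhd> up (\<rho> 0) (\<rho> 0) \<and> z = op x y)"
    using ex_prod by metis
  have "isfun c n" by (rule isfunI) (auto simp: c)
  then have "mapsto c n A" using \<rho> by (auto simp: mapsto_def c)
  then show ?case by blast
next
  case (Suc K)
  then obtain s where s: "mapsto s n A" "\<forall>i<K. num i \<lhd> n \<longrightarrow> val s i = \<rho> i" by blast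
  show ?case
  proof (cases "num K \<lhd> n")
    case False
    with s show ?thesis by (metis less_Suc_eq)
  next
    case True
    then obtain t where t: "mapsto t n A" "op (num K) (\<rho> K) \<lhd> t"
      "\<forall>j x. j \<noteq> num K \<longrightarrow> (op j x \<lhd> t \<longleftrightarrow> op j x \<lhd> s)"
      using ex_update[OF s(1) True \<rho>] by blast
    have "val t i = \<rho> i" if "i < Suc K" "num i \<lhd> n" for i
    proof (cases "i = K")
      case True
      with t that show ?thesis using val[of t n i "\<rho> K"] by (simp add: mapsto_def)
    next
      case False
      then have "val t i = val s i" using t(3) by (simp add: val_def)
      with s that False show ?thesis by simp
    qed
    with t(1) show ?thesis by blast
  qed
qed

text \<open>Matches the quantifier over variants of an assignment in \<open>tarski\<close> with the
  function update in \<open>nsat\<close>.\<close>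

lemma all_variants:
  assumes s: "mapsto s n A" and u: "num u \<lhd> n"
  shows "(\<forall>t. mapsto t n A \<and> (\<forall>j x. j \<noteq> num u \<longrightarrow> (op j x \<lhd> t \<longleftrightarrow> op j x \<lhd> s)) \<longrightarrow> Q (val t)) \<longleftrightarrow>
    (\<forall>a. a \<lhd> A \<longrightarrow> Q ((val s)(u := a)))" (is "?L \<longleftrightarrow> ?R")
proof -
  have v: "val t = (val s)(u := val t u)"
    if "\<forall>j x. j \<noteq> num u \<longrightarrow> (op j x \<lhd> t \<longleftrightarrow> op j x \<lhd> s)" for t
    using that by (auto simp: fun_eq_iff val_def)
  show ?thesis
  proof
    assume L: ?L
    show ?R
    proof (intro allI impI)
      fix a assume "a \<lhd> A"
      from ex_update[OF s u this] obtain t where t: "mapsto t n A" "op (num u) a \<lhd> t"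
        "\<forall>j x. j \<noteq> num u \<longrightarrow> (op j x \<lhd> t \<longleftrightarrow> op j x \<lhd> s)" by blast
      with u have "val t u = a" using val[of t n u a] by (simp add: mapsto_def)
      with L t v[OF t(3)] show "Q ((val s)(u := a))" by metis
    qed
  next
    assume R: ?R
    show ?L
    proof (intro allI impI, elim conjE)
      fix t assume t: "mapsto t n A" "\<forall>j x. j \<noteq> num u \<longrightarrow> (op j x \<lhd> t \<longleftrightarrow> op j x \<lhd> s)"
      have "val t u \<lhd> A" using t(1) u val[of t n u "val t u"] by (simp add: mapsto_def)
      with R v[OF t(2)] show "Q (val t)" by metis
    qed
  qed
qed

section \<open>From coded to actual satisfaction\<close>

lemma fseq_cases:
  assumes "fseq f k w" "op i c \<lhd> f"
  shows "c = nFalse \<or>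
     (\<exists>u v. u \<lhd> w \<and> v \<lhd> w \<and> (c = node 1 u v \<or> c = node 2 u v)) \<or>
     (\<exists>j l p q. j \<lhd> i \<and> l \<lhd> i \<and> op j p \<lhd> f \<and> op l q \<lhd> f \<and> c = nImp p q) \<or>
     (\<exists>u j p. u \<lhd> w \<and> j \<lhd> i \<and> op j p \<lhd> f \<and> c = nAll u p)"
  using assms isfun_mem unfolding fseq_def formstep_def by blast

lemma node_distinct [simp]:
  "nImp p q \<noteq> nFalse" "nAll u p \<noteq> nFalse" "node 1 u v \<noteq> nFalse" "node 2 u v \<noteq> nFalse"
  "node (Suc 0) u v \<noteq> nFalse"
  "nImp p q \<noteq> nAll u r" "nImp p q \<noteq> node 1 u v" "nImp p q \<noteq> node 2 u v" "nImp p q \<noteq> node (Suc 0) u v"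
  "nAll u p \<noteq> nImp q r" "nAll u p \<noteq> node 1 a b" "nAll u p \<noteq> node 2 a b" "nAll u p \<noteq> node (Suc 0) a b"
  "nFalse \<noteq> nImp p q" "nFalse \<noteq> nAll u p" "nFalse \<noteq> node 1 u v" "nFalse \<noteq> node 2 u v"
  "nFalse \<noteq> node (Suc 0) u v"
  "node 1 a b \<noteq> nImp p q" "node 1 a b \<noteq> nAll u p" "node 2 a b \<noteq> nImp p q" "node 2 a b \<noteq> nAll u p"
  "node (Suc 0) a b \<noteq> nImp p q" "node (Suc 0) a b \<noteq> nAll u p"
  and node_inject [simp]:
  "nImp p q = nImp r s \<longleftrightarrow> p = r \<and> q = s" "nAll u p = nAll v q \<longleftrightarrow> u = v \<and> p = q"
  by (auto simp: nFalse_def nImp_def nAll_def)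

text \<open>Induction on the actual formula. The formation sequence may have nonstandard length, but
  it lists the subformulas of each of its entries, and there the Tarski clauses mirror the recursion
  of \<open>nsat\<close>.\<close>

lemma bridge:
  assumes f: "fseq f k n" and S: "satrel A n f S" and "op i (ncode p) \<lhd> f"
  shows "(\<forall>v\<in>vars p. num v \<lhd> n) \<and>
    (\<forall>s. mapsto s n A \<longrightarrow> (op (ncode p) s \<lhd> S \<longleftrightarrow> nsat E (el A) (val s) p))"
  using assms(3)
proof (induction p arbitrary: i)
  case NFalsum
  with S show ?case unfolding satrel_def tarski_def by auto
next
  case (NMem a b)
  from fseq_cases[OF f NMem] have ab: "num a \<lhd> n" "num b \<lhd> n" by auto
  have "op (ncode (NMem a b)) s \<lhd> S \<longleftrightarrow> nsat E (el A) (val s) (NMem a b)" if s: "mapsto s n A" for s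
  proof -
    have "op (node 1 (num a) (num b)) s \<lhd> S \<longleftrightarrow> (\<exists>x y. op (num a) x \<lhd> s \<and> op (num b) y \<lhd> s \<and> x \<lhd> y)"
      using S NMem s unfolding satrel_def tarski_def by auto
    then show ?thesis using s val[of s n a] val[of s n b] ab by (simp add: mapsto_def)
  qed
  with ab show ?case by simp
next
  case (NEqu a b)
  from fseq_cases[OF f NEqu] have ab: "num a \<lhd> n" "num b \<lhd> n" by auto
  have "op (ncode (NEqu a b)) s \<lhd> S \<longleftrightarrow> nsat E (el A) (val s) (NEqu a b)" if s: "mapsto s n A" for s
  proof -
    have "op (node 2 (num a) (num b)) s \<lhd> S \<longleftrightarrow> (\<exists>x y. op (num a) x \<lhd> s \<and> op (num b) y \<lhd> s \<and> x = y)"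
      using S NEqu s unfolding satrel_def tarski_def by auto
    then show ?thesis using s val[of s n a] val[of s n b] ab by (simp add: mapsto_def)
  qed
  with ab show ?case by simp
next
  case (NImpl p q)
  from fseq_cases[OF f NImpl.prems] obtain j l where
    "op j (ncode p) \<lhd> f" "op l (ncode q) \<lhd> f" by auto
  note IH = NImpl.IH(1)[OF this(1)] NImpl.IH(2)[OF this(2)]
  have "op (nImp (ncode p) (ncode q)) s \<lhd> S \<longleftrightarrow> (op (ncode p) s \<lhd> S \<longrightarrow> op (ncode q) s \<lhd> S)"
    if s: "mapsto s n A" for s
    using S NImpl.prems s unfolding satrel_def tarski_def by auto
  with IH show ?case by auto
next
  case (NForall u p)
  from fseq_cases[OF f NForall.prems] obtain j where u: "num u \<lhd> n" and "op j (ncode p) \<lhd> f" by auto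
  note IH = NForall.IH[OF this(2)]
  have "op (nAll (num u) (ncode p)) s \<lhd> S \<longleftrightarrow> nsat E (el A) (val s) (NForall u p)"
    if s: "mapsto s n A" for s
  proof -
    have "op (nAll (num u) (ncode p)) s \<lhd> S \<longleftrightarrow>
       (\<forall>t. mapsto t n A \<and> (\<forall>j x. j \<noteq> num u \<longrightarrow> (op j x \<lhd> t \<longleftrightarrow> op j x \<lhd> s)) \<longrightarrow> op (ncode p) t \<lhd> S)"
      using S NForall.prems s unfolding satrel_def tarski_def by auto
    also have "\<dots> \<longleftrightarrow> (\<forall>t. mapsto t n A \<and> (\<forall>j x. j \<noteq> num u \<longrightarrow> (op j x \<lhd> t \<longleftrightarrow> op j x \<lhd> s)) \<longrightarrow>
        nsat E (el A) (val t) p)"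
      using IH by blast
    also have "\<dots> \<longleftrightarrow> (\<forall>a. a \<lhd> A \<longrightarrow> nsat E (el A) ((val s)(u := a)) p)"
      by (rule all_variants[OF s u])
    finally show ?thesis by (simp add: Ball_def)
  qed
  with IH u show ?case by simp
qed

text \<open>The internal truth of an actual axiom becomes its truth over \<open>el M\<close>. Only
  the variables of \<open>p\<close> matter, and they lie below some \<open>K\<close>, so an
  assignment with finitely many prescribed values suffices.\<close>

lemma model_nsat:
  assumes M: "model M" and c: "zfcax (ncode p)" and \<rho>: "\<And>i. \<rho> i \<lhd> M"
  shows "nsat E (el M) \<rho> p"
proof -
  from M c have "truein M (ncode p)" unfolding model_def by blast
  then obtain n S f k i where *: "fseq f k n" "op i (ncode p) \<lhd> f" "satrel M n f S"
    "\<forall>s. mapsto s n M \<longrightarrow> op (ncode p) s \<lhd> S"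
    unfolding truein_def evals_def by blast
  note b = bridge[OF *(1,3,2)]
  obtain K where K: "\<forall>v\<in>vars p. v < K" using finite_vars[of p] finite_nat_set_iff_bounded by blast
  obtain s where s: "mapsto s n M" "\<forall>i<K. num i \<lhd> n \<longrightarrow> val s i = \<rho> i"
    using ex_assignment[of \<rho> M n K] \<rho> by blast
  have "nsat E (el M) (val s) p" using *(4) b s(1) by blast
  moreover have "val s i = \<rho> i" if "i \<in> vars p" for i using s(2) K b that by blast
  ultimately show ?thesis using nsat_cong[of p "val s" \<rho>] by blast
qed

lemma model_ne: "model M \<Longrightarrow> \<exists>x. x \<lhd> M"
  unfolding model_def by (metis zero_iff)

lemma model_axiom:
  assumes M: "model M" and P: "P \<in> axiom_forms"
  shows "holds (el M) e [] P"
proof -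
  obtain x where x: "x \<lhd> M" using model_ne[OF M] by blast
  have "nsat E (el M) (\<lambda>_. x) (named (sentence P) 0)"
    by (rule model_nsat[OF M]) (use P x in \<open>auto simp: zfcax_def\<close>)
  moreover have fb: "free_bound (sentence P) = 0"
    using P unfolding axiom_forms_def
    by (auto simp: sentence_def ax_extensionality_def ax_foundation_def ax_pair_def ax_union_def ax_power_def
      ax_infinity_def ax_choice_def is_subset_def is_zero_def is_succ_def is_upair_def is_pair_def app_def is_fun_def
      fMem_def fEqu_def fNot_def fAnd_def fOr_def fImp_def fIff_def fAll_def fEx_def
      Neg_def Conj_def Disj_def Iff_def Exists_def)
  ultimately have "sat E (el M) (\<lambda>_. x) (sentence P)" by (simp add: nsat_named)
  then have "sat E (el M) e (sentence P)" using fb sat_cong[of "sentence P" e "\<lambda>_. x"] by simp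
  then show ?thesis by (simp add: holds_sentence)
qed

lemma model_tr: "model M \<Longrightarrow> tr M" "model M \<Longrightarrow> trD (el M)"
  by (auto simp: model_def trD_el)

text \<open>A transitive model containing \<open>x\<close> has all elements of \<open>x\<close> and
  all their elements, so a minimal element found in it is minimal in the universe.\<close>

lemma foundation: 
  assumes "z \<lhd> x" shows "\<exists>y. y \<lhd> x \<and> (\<forall>z. z \<lhd> y \<longrightarrow> \<not> z \<lhd> x)"
proof -
  obtain M where M: "x \<lhd> M" "model M" using ex_model by blast
  have mem: "y \<lhd> M" if "y \<lhd> u" "u \<lhd> M" for y u
    using that model_tr[OF M(2)] by (auto simp: tr_def sub_def)
  have "\<forall>x\<in>el M. x \<noteq> zero \<longrightarrow> (\<exists>y\<in>el M. y \<lhd> x \<and> (\<forall>z\<in>el M. z \<lhd> y \<longrightarrow> \<not> z \<lhd> x))"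
    using model_axiom[OF M(2), of ax_foundation e0]
    by (simp add: axiom_forms_def ax_foundation_def abs model_tr[OF M(2)])
  moreover have "x \<noteq> zero" using assms by auto
  ultimately obtain y where "y \<lhd> x" "\<forall>z\<in>el M. z \<lhd> y \<longrightarrow> \<not> z \<lhd> x" using M(1) by auto
  with M(1) mem show ?thesis by fastforce
qed

subsection \<open>Ordinals and natural numbers\<close>

lemma irrefl: "\<not> x \<lhd> x"
  using foundation[of x "up x x"] by auto

lemma no_cycle2: "x \<lhd> y \<Longrightarrow> \<not> y \<lhd> x"
  using foundation[of x "up x y"] by auto

lemma no_cycle3: "x \<lhd> y \<Longrightarrow> y \<lhd> z \<Longrightarrow> \<not> z \<lhd> x"
  using foundation[of x "cup (up x y) (up z z)"] by auto

lemma ex_mem: "x \<noteq> zero \<longleftrightarrow> (\<exists>y. y \<lhd> x)"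
  using zero_iff by blast

lemma ord_iff: "ord x \<longleftrightarrow> tr x \<and> (\<forall>y z. y \<lhd> x \<and> z \<lhd> x \<longrightarrow> y \<lhd> z \<or> y = z \<or> z \<lhd> y)"
  unfolding ord_def using foundation by (auto simp: ex_mem) blast

lemma ord_tr: "ord x \<Longrightarrow> y \<lhd> x \<Longrightarrow> z \<lhd> y \<Longrightarrow> z \<lhd> x"
  unfolding ord_def tr_def sub_def by blast

lemma ord_mem:
  assumes x: "ord x" and y: "y \<lhd> x" shows "ord y"
proof -
  have "a \<lhd> y" if "a \<lhd> b" "b \<lhd> y" for a b
  proof -
    have "a \<lhd> x" using x y that ord_tr by blast
    with x y have "a \<lhd> y \<or> a = y \<or> y \<lhd> a" unfolding ord_iff by blast
    with that no_cycle2 no_cycle3 show ?thesis by blast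
  qed
  moreover have "a \<lhd> b \<or> a = b \<or> b \<lhd> a" if "a \<lhd> y" "b \<lhd> y" for a b
    using x y that ord_tr[OF x y] unfolding ord_iff by blast
  ultimately show ?thesis unfolding ord_iff tr_def sub_def by blast
qed

lemma ex_Int: "\<exists>b. \<forall>x. x \<lhd> b \<longleftrightarrow> x \<lhd> a \<and> x \<lhd> c"
  using Delta0_separation[OF Delta0.intros(2), of a "\<lambda>_. c" 0 1] by simp

lemma ex_Diff: "\<exists>b. \<forall>x. x \<lhd> b \<longleftrightarrow> x \<lhd> a \<and> \<not> x \<lhd> c"
  using Delta0_separation[OF Delta0_Neg[OF Delta0.intros(2)], of a "\<lambda>_. c" 0 1] by simp

text \<open>A minimal element \<open>m\<close> of the difference \<open>x - i\<close> equals
  \<open>i\<close>: the elements of \<open>m\<close> escape the difference, and an element of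
  \<open>i\<close> is comparable with \<open>m\<close> but cannot be \<open>m\<close> or lie above
  it, since \<open>i\<close> is transitive.\<close>

lemma tr_sub_ord:
  assumes x: "ord x" and i: "tr i" "sub i x" and ne: "i \<noteq> x"
  shows "i \<lhd> x"
proof -
  obtain d where d: "\<And>z. z \<lhd> d \<longleftrightarrow> z \<lhd> x \<and> \<not> z \<lhd> i" using ex_Diff by metis
  have "\<exists>z. z \<lhd> d" using ne i(2) d ext unfolding sub_def by blast
  then obtain m where m: "m \<lhd> d" "\<forall>z. z \<lhd> m \<longrightarrow> \<not> z \<lhd> d" using foundation by blast
  have "i = m"
  proof (rule ext)
    fix z
    show "z \<lhd> i \<longleftrightarrow> z \<lhd> m"
    proof
      assume z: "z \<lhd> i"
      then have "z \<lhd> x" using i(2) unfolding sub_def by blast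
      moreover have "m \<lhd> x" "\<not> m \<lhd> i" using m(1) d by auto
      moreover have "\<not> m \<lhd> z" using z i(1) \<open>\<not> m \<lhd> i\<close> unfolding tr_def sub_def by blast
      ultimately show "z \<lhd> m" using x z unfolding ord_iff by blast
    next
      assume "z \<lhd> m"
      moreover have "m \<lhd> x" using m(1) d by blast
      ultimately show "z \<lhd> i" using m(2) d ord_tr[OF x] by blast
    qed
  qed
  with m(1) d show ?thesis by blast
qed

text \<open>The intersection is transitive, so it equals or belongs to each of \<open>x\<close> and
  \<open>y\<close>. Belonging to both would make it an element of itself.\<close>

lemma ord_linear:
  assumes x: "ord x" and y: "ord y" shows "x \<lhd> y \<or> x = y \<or> y \<lhd> x"
proof -
  obtain i where i: "\<And>z. z \<lhd> i \<longleftrightarrow> z \<lhd> x \<and> z \<lhd> y" using ex_Int by metis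
  have tr: "tr i" using i ord_tr[OF x] ord_tr[OF y] unfolding tr_def sub_def by blast
  have sub: "sub i x" "sub i y" using i unfolding sub_def by auto
  show ?thesis
    using tr_sub_ord[OF x tr sub(1)] tr_sub_ord[OF y tr sub(2)] i irrefl by metis
qed

lemma ord_sub: "ord x \<Longrightarrow> ord y \<Longrightarrow> sub x y \<longleftrightarrow> x \<lhd> y \<or> x = y"
  using ord_linear ord_tr irrefl unfolding sub_def by meson

lemma ord_zero: "ord zero"
  unfolding ord_iff tr_def by simp

lemma ord_suc: "ord x \<Longrightarrow> ord (suc x)"
  unfolding ord_iff tr_def sub_def by auto

lemma ord_cases:
  assumes "ord x"
  shows "x = zero \<or> (\<exists>y. y \<lhd> x \<and> x = suc y) \<or> limit x"
proof -
  have "x = suc y" if y: "y \<lhd> x" "\<forall>z. z \<lhd> x \<longrightarrow> \<not> y \<lhd> z" for y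
  proof (rule ext)
    show "z \<lhd> x \<longleftrightarrow> z \<lhd> suc y" for z
      using assms y ord_tr[OF assms y(1)] unfolding ord_iff by auto
  qed
  with assms show ?thesis unfolding limit_def by blast
qed

definition om :: 'a where "om = (SOME w. isom w)"

lemma isom_om: "isom om"
proof -
  have "\<exists>w. isom w"
    using LZFC_holds[of ax_omega] by (simp add: LZFC_def BST_def ax_omega_def absU)
  then show ?thesis unfolding om_def by (rule someI_ex)
qed

lemma ord_om: "ord om" and limit_om: "limit om"
  using isom_om by (auto simp: isom_def limit_def)

lemma isom_iff: "isom w \<longleftrightarrow> w = om"
proof
  assume w: "isom w"
  then have "ord w" by (simp add: isom_def limit_def)
  from ord_linear[OF this ord_om] w isom_om show "w = om" unfolding isom_def by blast
qed (simp add: isom_om)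

lemma isnat_iff: "isnat x \<longleftrightarrow> x \<lhd> om"
  unfolding isnat_def isom_iff by blast

lemma zero_om: "zero \<lhd> om"
  using limit_om ord_linear[OF ord_zero ord_om] by (auto simp: limit_def)

lemma suc_om: assumes n: "n \<lhd> om" shows "suc n \<lhd> om"
proof -
  obtain z where z: "z \<lhd> om" "n \<lhd> z" using n limit_om unfolding limit_def by blast
  have "suc n \<lhd> z \<or> suc n = z \<or> z \<lhd> suc n"
    using n z ord_mem[OF ord_om] by (intro ord_linear ord_suc) auto
  moreover have "\<not> z \<lhd> suc n" using z no_cycle2 irrefl by auto
  ultimately show ?thesis using z(1) ord_tr[OF ord_om] by blast
qed

lemma om_cases: "n \<lhd> om \<Longrightarrow> n = zero \<or> (\<exists>m. m \<lhd> om \<and> m \<lhd> n \<and> n = suc m)"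
  using ord_cases[of n] ord_mem[OF ord_om] ord_tr[OF ord_om] isom_om unfolding isom_def by blast

text \<open>Induction over the \<open>om\<close> of the structure, whose elements need not be
  numerals. The first premise says that the failures form a set; callers obtain it from a difference
  or by separation in a model.\<close>

lemma om_induct:
  assumes "\<exists>b. \<forall>x. x \<lhd> b \<longleftrightarrow> x \<lhd> om \<and> \<not> Q x"
    and "Q zero" "\<And>n. n \<lhd> om \<Longrightarrow> Q n \<Longrightarrow> Q (suc n)" and n: "n \<lhd> om"
  shows "Q n"
proof (rule ccontr)
  assume no: "\<not> Q n"
  obtain b where b: "\<And>x. x \<lhd> b \<longleftrightarrow> x \<lhd> om \<and> \<not> Q x" using assms(1) by blast
  with no n have "n \<lhd> b" by blast
  then obtain m where m: "m \<lhd> b" "\<forall>z. z \<lhd> m \<longrightarrow> \<not> z \<lhd> b" using foundation by blast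
  then have "m \<lhd> om" "\<not> Q m" using b by auto
  then obtain k where "k \<lhd> om" "k \<lhd> m" "m = suc k" using om_cases assms(2) by blast
  with m(2) b assms(3) \<open>\<not> Q m\<close> show False by blast
qed

lemma num_om: "num k \<lhd> om"
  by (induction k) (auto intro: zero_om suc_om)

lemma nat_mem_om: "n \<lhd> om \<Longrightarrow> m \<lhd> n \<Longrightarrow> m \<lhd> om"
  using ord_tr[OF ord_om] by blast

lemma abs_ord [abs]:
  assumes "ok D xs" "x < length xs"
  shows "holds D e xs (is_ord x) \<longleftrightarrow> ord (xs ! x)"
proof -
  let ?x = "xs ! x"
  have "holds D e xs (is_ord x) \<longleftrightarrow> tr ?x \<and> (\<forall>y\<in>D. \<forall>z\<in>D. y \<lhd> ?x \<and> z \<lhd> ?x \<longrightarrow> y \<lhd> z \<or> y = z \<or> z \<lhd> y) \<and>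
     (\<forall>s\<in>D. sub s ?x \<and> s \<noteq> zero \<longrightarrow> (\<exists>u\<in>D. u \<lhd> s \<and> (\<forall>v\<in>D. v \<lhd> s \<longrightarrow> \<not> v \<lhd> u)))"
    using assms by (simp add: is_ord_def abs nth_append cong: ball_cong bex_cong)
  \<comment> \<open>The subset quantifier is unbounded and might range over fewer sets in
    \<open>D\<close>; foundation makes the clause true in every transitive domain.\<close>
  moreover have "\<exists>u\<in>D. u \<lhd> s \<and> (\<forall>v\<in>D. v \<lhd> s \<longrightarrow> \<not> v \<lhd> u)" if "s \<in> D" "s \<noteq> zero" for s
  proof -
    from that(2) obtain y where "y \<lhd> s" using zero_iff by blast
    from foundation[OF this] obtain u where "u \<lhd> s" "\<forall>z. z \<lhd> u \<longrightarrow> \<not> z \<lhd> s" by blast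
    moreover have "u \<in> D" using assms(1) that(1) \<open>u \<lhd> s\<close> trD_mem unfolding ok_def by blast
    ultimately show ?thesis by blast
  qed
  moreover have "(\<forall>y\<in>D. \<forall>z\<in>D. y \<lhd> ?x \<and> z \<lhd> ?x \<longrightarrow> Q y z) \<longleftrightarrow> (\<forall>y z. y \<lhd> ?x \<and> z \<lhd> ?x \<longrightarrow> Q y z)" for Q
    using ok_mem[OF assms] by blast
  ultimately show ?thesis unfolding ord_iff by simp
qed

lemma abs_limit [abs]:
  assumes "ok D xs" "x < length xs"
  shows "holds D e xs (is_limit x) \<longleftrightarrow> limit (xs ! x)"
proof -
  have "holds D e xs (is_limit x) \<longleftrightarrow> ord (xs ! x) \<and> xs ! x \<noteq> zero \<and>
     (\<forall>y\<in>D. y \<lhd> xs ! x \<longrightarrow> (\<exists>z\<in>D. z \<lhd> xs ! x \<and> y \<lhd> z))"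
    using assms by (simp add: is_limit_def abs nth_append cong: ball_cong bex_cong)
  then show ?thesis unfolding limit_def using ok_mem[OF assms] by blast
qed

lemma abs_omega [abs]:
  assumes "ok D xs" "x < length xs"
  shows "holds D e xs (is_omega x) \<longleftrightarrow> xs ! x = om"
proof -
  have "holds D e xs (is_omega x) \<longleftrightarrow> limit (xs ! x) \<and> (\<forall>y\<in>D. y \<lhd> xs ! x \<longrightarrow> \<not> limit y)"
    using assms by (simp add: is_omega_def abs nth_append cong: ball_cong bex_cong)
  then show ?thesis unfolding isom_iff[symmetric] isom_def using ok_mem[OF assms] by blast
qed

lemma abs_nat [abs]: "ok D xs \<Longrightarrow> x < length xs \<Longrightarrow> om \<in> D \<Longrightarrow> holds D e xs (is_nat x) \<longleftrightarrow> xs ! x \<lhd> om"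
  by (auto simp: is_nat_def abs nth_append)

subsection \<open>Codes of actual formulas\<close>

lemma ex_listfun: "\<exists>f. \<forall>p. p \<lhd> f \<longleftrightarrow> (\<exists>i<length xs. p = op (num i) (xs ! i))"
proof (induction xs rule: rev_induct)
  case (snoc x xs)
  then obtain f where "\<And>p. p \<lhd> f \<longleftrightarrow> (\<exists>i<length xs. p = op (num i) (xs ! i))" by blast
  then have "p \<lhd> cup f (up (op (num (length xs)) x) (op (num (length xs)) x)) \<longleftrightarrow>
      (\<exists>i<length (xs @ [x]). p = op (num i) ((xs @ [x]) ! i))" for p
    by (auto simp: nth_append less_Suc_eq)
  then show ?case by blast
qed (auto intro: exI[of _ zero])

text \<open>The postorder list of subformulas serves as formation sequence. It has actual finite
  length, so finitely many adjunctions produce it.\<close>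

lemma ex_formation:
  assumes "\<forall>v\<in>vars p. num v \<lhd> w"
  shows "\<exists>f k. k \<lhd> om \<and> fseq f k w \<and> (\<forall>i c. op i c \<lhd> f \<longleftrightarrow>
    (\<exists>m<length (subs p). i = num m \<and> c = ncode (subs p ! m)))"
proof -
  let ?l = "length (subs p)"
  obtain f where "\<forall>q. q \<lhd> f \<longleftrightarrow> (\<exists>i<?l. q = op (num i) (map ncode (subs p) ! i))"
    using ex_listfun[of "map ncode (subs p)"] unfolding length_map by blast
  then have f': "q \<lhd> f \<longleftrightarrow> (\<exists>i<?l. q = op (num i) (ncode (subs p ! i)))" for q
    by (auto cong: conj_cong)
  then have f: "op i c \<lhd> f \<longleftrightarrow> (\<exists>m<?l. i = num m \<and> c = ncode (subs p ! m))" for i c by auto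
  have fn: "isfun f (num ?l)"
  proof (rule isfunI)
    fix q assume "q \<lhd> f"
    then show "\<exists>x y. x \<lhd> num ?l \<and> q = op x y" unfolding f' by (metis mem_num_num)
  next
    fix x assume "x \<lhd> num ?l"
    then show "\<exists>y. op x y \<lhd> f" unfolding f mem_num by blast
  qed (auto simp: f)
  have cl: "formstep f w i c" if "op i c \<lhd> f" for i c
  proof -
    from that obtain m where m: "m < ?l" "i = num m" "c = ncode (subs p ! m)" unfolding f by blast
    then have q: "subs p ! m \<in> set (subs p)" by simp
    have sc: "(subs p ! m = NImpl q r \<longrightarrow> (\<exists>j<m. subs p ! j = q) \<and> (\<exists>j<m. subs p ! j = r)) \<and>
        (subs p ! m = NForall u q \<longrightarrow> (\<exists>j<m. subs p ! j = q))" for q r u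
      using subclosed_subs[of p] m(1) unfolding subclosed_def by blast
    have ff: "\<exists>j. j \<lhd> i \<and> op j (ncode q) \<lhd> f" if "\<exists>j<m. subs p ! j = q" for q
      using that m unfolding f by (metis less_trans mem_num_num)
    have v: "\<forall>v\<in>vars (subs p ! m). num v \<lhd> w" using vars_subs[OF q] assms by blast
    show ?thesis
    proof (cases "subs p ! m")
      case (NImpl a b)
      have "\<exists>j. j \<lhd> i \<and> op j (ncode a) \<lhd> f" "\<exists>j. j \<lhd> i \<and> op j (ncode b) \<lhd> f"
        using sc[of a b] NImpl by (auto intro: ff)
      with NImpl m(3) show ?thesis by (auto simp: formstep_def)
    next
      case (NForall u a)
      have "\<exists>j. j \<lhd> i \<and> op j (ncode a) \<lhd> f"
        using sc[of a _ u] NForall by (auto intro: ff)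
      with NForall m(3) v show ?thesis by (auto simp: formstep_def)
    qed (use m(3) v in \<open>auto simp: formstep_def\<close>)
  qed
  have "fseq f (num ?l) w"
    unfolding fseq_def
  proof (rule conjI[OF fn], intro allI impI)
    fix i c assume "i \<lhd> num ?l \<and> op i c \<lhd> f"
    then show "formstep f w i c"
      by (intro cl) simp
  qed
  with num_om f show ?thesis by metis
qed

lemma isformula_ncode:
  assumes "\<forall>v\<in>vars p. num v \<lhd> w"
  shows "isformula w (ncode p)"
proof -
  from ex_formation[OF assms] obtain f k where f: "k \<lhd> om" "fseq f k w"
    "\<forall>i c. op i c \<lhd> f \<longleftrightarrow> (\<exists>m<length (subs p). i = num m \<and> c = ncode (subs p ! m))" by blast
  obtain m where m: "m < length (subs p)" "subs p ! m = p"
    using subs_self[of p] by (auto simp: in_set_conv_nth)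
  have "op (num m) (ncode p) \<lhd> f" unfolding f(3)[rule_format] using m by auto
  with f(1,2) show ?thesis unfolding isformula_def isnat_iff by blast
qed

subsection \<open>Separation and replacement in models\<close>

lemma model_mem: "model M \<Longrightarrow> x \<lhd> M \<Longrightarrow> y \<lhd> x \<Longrightarrow> y \<lhd> M"
  using model_tr(1) unfolding tr_def sub_def by blast

text \<open>Level \<open>length ps\<close> of \<open>P\<close> is the separated element. Names
  \<open>K\<close> and \<open>Suc K\<close>, above all variables of the code, are reserved for the
  new set and the given one. Outside the levels the environment is constantly \<open>hd ps\<close>,
  the value that truncated subtraction assigns to unbound indices.\<close>

lemma separation:
  assumes M: "model M" and ps: "set ps \<subseteq> el M" "ps \<noteq> []" and a: "a \<lhd> M"
  shows "\<exists>b. b \<lhd> M \<and> (\<forall>x. x \<lhd> b \<longleftrightarrow> x \<lhd> a \<and> holds (el M) (\<lambda>_. hd ps) (ps @ [x]) P)"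
proof -
  let ?d = "length ps"
  let ?p = "named (P (Suc ?d)) (Suc ?d)"
  obtain K where K: "\<forall>v\<in>insert ?d (vars ?p). v < K"
    using finite_nat_set_iff_bounded[of "insert ?d (vars ?p)"] finite_vars by auto
  then have d: "?d < K" by blast
  define \<rho> where "\<rho> i = (if i < ?d then ps ! i else hd ps)" for i
  have \<rho>: "\<rho> i \<lhd> M" for i
    using ps(1) hd_in_set[OF ps(2)] by (auto simp: \<rho>_def subset_iff)
  let ?c = "NForall (Suc K) (NExists K (NForall ?d (NIff (NMem ?d K) (NAnd (NMem ?d (Suc K)) ?p))))"
  \<comment> \<open>As a set, \<open>num K\<close> consists of the names below \<open>K\<close>: it
    contains all variables of the code and misses \<open>K\<close>, the name of the new set, as the
    coded schema requires.\<close>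
  have "isformula (num K) (ncode ?p)"
    using K by (intro isformula_ncode) auto
  moreover have "sub (num K) om" unfolding sub_def using nat_mem_om[OF num_om] by blast
  ultimately have "sepax (ncode ?c)"
    unfolding sepax_def isom_iff
    by - (rule exI[of _ om], rule exI[of _ "num K"], rule exI[of _ "ncode ?p"],
        rule exI[of _ "num (Suc K)"], rule exI[of _ "num K"], rule exI[of _ "num ?d"],
        use d in \<open>auto simp: num_om sepcode_def num_irrefl simp del: num.simps\<close>)
  then have "zfcax (ncode ?c)" by (simp add: zfcax_def)
  then have "nsat E (el M) \<rho> ?c" by (rule model_nsat[OF M _ \<rho>])
  then have "\<forall>a\<in>el M. \<exists>b\<in>el M. \<forall>x\<in>el M. x \<lhd> b \<longleftrightarrow> x \<lhd> a \<and>
      nsat E (el M) (\<rho>(Suc K := a, K := b, ?d := x)) ?p"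
    using d by simp
  from bspec[OF this, of a] a obtain b where b: "b \<lhd> M" "\<forall>x\<in>el M. x \<lhd> b \<longleftrightarrow> x \<lhd> a \<and>
      nsat E (el M) (\<rho>(Suc K := a, K := b, ?d := x)) ?p"
    by auto
  have "nsat E (el M) (\<rho>(Suc K := a, K := b, ?d := x)) ?p \<longleftrightarrow> holds (el M) (\<lambda>_. hd ps) (ps @ [x]) P" for x
  proof -
    have "nsat E (el M) (\<rho>(Suc K := a, K := b, ?d := x)) ?p \<longleftrightarrow> nsat E (el M) (\<rho>(?d := x)) ?p"
      by (rule nsat_cong) (use K in auto)
    also have "\<dots> \<longleftrightarrow> sat E (el M) (\<lambda>i. (\<rho>(?d := x)) (Suc ?d - Suc i)) (P (Suc ?d))"
      by (rule nsat_named) simp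
    also have "(\<lambda>i. (\<rho>(?d := x)) (Suc ?d - Suc i)) = env (\<lambda>_. hd ps) (ps @ [x])"
    proof -
      have "env (\<lambda>_. hd (ps @ [x])) (ps @ [x]) = (\<lambda>i. (\<rho>(?d := x)) (length (ps @ [x]) - Suc i))"
        by (rule env_hd) (auto simp: \<rho>_def nth_append less_Suc_eq)
      with ps(2) show ?thesis by simp
    qed
    finally show ?thesis by (simp only: holds_def length_append length_Cons list.size add_Suc_right add_0_right)
  qed
  note eq = this
  have "x \<lhd> b \<longleftrightarrow> x \<lhd> a \<and> holds (el M) (\<lambda>_. hd ps) (ps @ [x]) P" for x
  proof (cases "x \<lhd> M")
    case True
    with b(2) eq show ?thesis by simp
  next
    case False
    with model_mem[OF M a] model_mem[OF M b(1)] show ?thesis by blast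
  qed
  with b(1) show ?thesis by blast
qed

text \<open>Coded as for separation, with two levels for argument and value. The name
  \<open>K\<close> serves both as the unique value in the premise and as the collecting set in the
  conclusion.\<close>

lemma replacement:
  assumes M: "model M" and ps: "set ps \<subseteq> el M" "ps \<noteq> []" and a: "a \<lhd> M"
    and fn: "\<And>x. x \<lhd> a \<Longrightarrow> \<exists>y. y \<lhd> M \<and> (\<forall>z. z \<lhd> M \<longrightarrow> (holds (el M) (\<lambda>_. hd ps) (ps @ [x, z]) P \<longleftrightarrow> z = y))"
  shows "\<exists>b. b \<lhd> M \<and> (\<forall>x. x \<lhd> a \<longrightarrow> (\<exists>y. y \<lhd> b \<and> holds (el M) (\<lambda>_. hd ps) (ps @ [x, y]) P))"
proof -
  let ?d = "length ps"
  let ?p = "named (P (Suc (Suc ?d))) (Suc (Suc ?d))"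
  obtain K where K: "\<forall>v\<in>insert (Suc ?d) (vars ?p). v < K"
    using finite_nat_set_iff_bounded[of "insert (Suc ?d) (vars ?p)"] finite_vars by auto
  then have d: "Suc ?d < K" by blast
  define \<rho> where "\<rho> i = (if i < ?d then ps ! i else hd ps)" for i
  have \<rho>: "\<rho> i \<lhd> M" for i
    using ps(1) hd_in_set[OF ps(2)] by (auto simp: \<rho>_def subset_iff)
  let ?c = "NForall (Suc K) (NImpl
     (NForall ?d (NImpl (NMem ?d (Suc K)) (NExists K (NForall (Suc ?d) (NIff ?p (NEqu (Suc ?d) K))))))
     (NExists K (NForall ?d (NImpl (NMem ?d (Suc K)) (NExists (Suc ?d) (NAnd (NMem (Suc ?d) K) ?p))))))"
  have "isformula (num K) (ncode ?p)"
    using K by (intro isformula_ncode) auto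
  moreover have "sub (num K) om" unfolding sub_def using nat_mem_om[OF num_om] by blast
  ultimately have "replax (ncode ?c)"
    unfolding replax_def isom_iff
    by - (rule exI[of _ om], rule exI[of _ "num K"], rule exI[of _ "ncode ?p"],
        rule exI[of _ "num (Suc K)"], rule exI[of _ "num K"], rule exI[of _ "num ?d"],
        rule exI[of _ "num (Suc ?d)"],
        use d in \<open>auto simp: num_om replcode_def num_irrefl simp del: num.simps\<close>)
  then have "zfcax (ncode ?c)" by (simp add: zfcax_def)
  then have c: "nsat E (el M) \<rho> ?c" by (rule model_nsat[OF M _ \<rho>])
  \<comment> \<open>The two update orders come from the schema: in the premise \<open>b\<close> is
    quantified after \<open>x\<close>, in the conclusion before it. Neither matters, as
    \<open>K\<close> and \<open>Suc K\<close> do not occur in \<open>?p\<close>.\<close>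
  have eq: "nsat E (el M) (\<rho>(Suc K := a, ?d := x, K := b, Suc ?d := y)) ?p \<longleftrightarrow> holds (el M) (\<lambda>_. hd ps) (ps @ [x, y]) P"
    "nsat E (el M) (\<rho>(Suc K := a, K := b, ?d := x, Suc ?d := y)) ?p \<longleftrightarrow> holds (el M) (\<lambda>_. hd ps) (ps @ [x, y]) P"
    for x y b a
  proof -
    have *: "nsat E (el M) (\<rho>(?d := x, Suc ?d := y)) ?p \<longleftrightarrow> holds (el M) (\<lambda>_. hd ps) (ps @ [x, y]) P"
    proof -
      have "nsat E (el M) (\<rho>(?d := x, Suc ?d := y)) ?p \<longleftrightarrow>
          sat E (el M) (\<lambda>i. (\<rho>(?d := x, Suc ?d := y)) (Suc (Suc ?d) - Suc i)) (P (Suc (Suc ?d)))"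
        by (rule nsat_named) simp
      also have "(\<lambda>i. (\<rho>(?d := x, Suc ?d := y)) (Suc (Suc ?d) - Suc i)) = env (\<lambda>_. hd ps) (ps @ [x, y])"
      proof -
        have "env (\<lambda>_. hd (ps @ [x, y])) (ps @ [x, y]) =
            (\<lambda>i. (\<rho>(?d := x, Suc ?d := y)) (length (ps @ [x, y]) - Suc i))"
          by (rule env_hd) (auto simp: \<rho>_def nth_append less_Suc_eq)
        with ps(2) show ?thesis by simp
      qed
      finally show ?thesis by (simp only: holds_def length_append length_Cons list.size add_Suc_right add_0_right)
    qed
    show "nsat E (el M) (\<rho>(Suc K := a, ?d := x, K := b, Suc ?d := y)) ?p \<longleftrightarrow> holds (el M) (\<lambda>_. hd ps) (ps @ [x, y]) P"
      unfolding *[symmetric] by (rule nsat_cong) (use K in auto)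
    show "nsat E (el M) (\<rho>(Suc K := a, K := b, ?d := x, Suc ?d := y)) ?p \<longleftrightarrow> holds (el M) (\<lambda>_. hd ps) (ps @ [x, y]) P"
      unfolding *[symmetric] by (rule nsat_cong) (use K in auto)
  qed
  have "\<forall>x\<in>el M. x \<lhd> a \<longrightarrow> (\<exists>b\<in>el M. \<forall>y\<in>el M. holds (el M) (\<lambda>_. hd ps) (ps @ [x, y]) P \<longleftrightarrow> y = b)"
    using fn unfolding Ball_def Bex_def mem_el by blast
  moreover have "\<forall>a\<in>el M.
      (\<forall>x\<in>el M. x \<lhd> a \<longrightarrow> (\<exists>b\<in>el M. \<forall>y\<in>el M. nsat E (el M) (\<rho>(Suc K := a, ?d := x, K := b, Suc ?d := y)) ?p \<longleftrightarrow> y = b)) \<longrightarrow>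
      (\<exists>b\<in>el M. \<forall>x\<in>el M. x \<lhd> a \<longrightarrow>
        (\<exists>y\<in>el M. y \<lhd> b \<and> nsat E (el M) (\<rho>(Suc K := a, K := b, ?d := x, Suc ?d := y)) ?p))"
    using c d by simp
  ultimately have "\<exists>b\<in>el M. \<forall>x\<in>el M. x \<lhd> a \<longrightarrow> (\<exists>y\<in>el M. y \<lhd> b \<and> holds (el M) (\<lambda>_. hd ps) (ps @ [x, y]) P)"
    unfolding eq using a by simp
  then obtain b where b: "b \<lhd> M"
    "\<forall>x\<in>el M. x \<lhd> a \<longrightarrow> (\<exists>y\<in>el M. y \<lhd> b \<and> holds (el M) (\<lambda>_. hd ps) (ps @ [x, y]) P)" by auto
  have "\<exists>y. y \<lhd> b \<and> holds (el M) (\<lambda>_. hd ps) (ps @ [x, y]) P" if "x \<lhd> a" for x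
    using b(2) model_mem[OF M a that] that unfolding Ball_def Bex_def mem_el by blast
  with b(1) show ?thesis by blast
qed

subsection \<open>Closure properties of models\<close>

lemma ball_el: "(\<forall>x\<in>el M. P x) \<longleftrightarrow> (\<forall>x. x \<lhd> M \<longrightarrow> P x)"
  and bex_el: "(\<exists>x\<in>el M. P x) \<longleftrightarrow> (\<exists>x. x \<lhd> M \<and> P x)"
  by auto

text \<open>The substitute for comprehension in the universe: finitely many parameters lie in one
  model, and its separation schema applies to them.\<close>

lemma ex_model_list: "\<exists>N. model N \<and> set xs \<subseteq> el N"
proof -
  have "\<exists>w. \<forall>z. z \<lhd> w \<longleftrightarrow> z \<in> set xs"
  proof (induction xs)
    case (Cons x xs)
    then obtain w where "\<forall>z. z \<lhd> w \<longleftrightarrow> z \<in> set xs" by blast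
    then have "\<forall>z. z \<lhd> cup w (up x x) \<longleftrightarrow> z \<in> set (x # xs)" by auto
    then show ?case by blast
  qed (auto intro: exI[of _ zero])
  then obtain w where w: "\<forall>z. z \<lhd> w \<longleftrightarrow> z \<in> set xs" by blast
  obtain N where "w \<lhd> N" "model N" using ex_model by blast
  with w model_mem show ?thesis by (metis mem_el subsetI)
qed

lemma separationI:
  assumes M: "model M" and ps: "set ps \<subseteq> el M" "ps \<noteq> []" and a: "a \<lhd> M"
    and P: "\<And>x. x \<lhd> a \<Longrightarrow> x \<lhd> M \<Longrightarrow> holds (el M) (\<lambda>_. hd ps) (ps @ [x]) P \<longleftrightarrow> Q x"
  shows "\<exists>b. b \<lhd> M \<and> (\<forall>x. x \<lhd> b \<longleftrightarrow> x \<lhd> a \<and> Q x)"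
proof -
  obtain b where b: "b \<lhd> M" "\<forall>x. x \<lhd> b \<longleftrightarrow> x \<lhd> a \<and> holds (el M) (\<lambda>_. hd ps) (ps @ [x]) P"
    using separation[OF M ps a] by blast
  have "x \<lhd> b \<longleftrightarrow> x \<lhd> a \<and> Q x" for x
    using b(2) P model_mem[OF M a] by blast
  with b(1) show ?thesis by blast
qed

lemma replacementI:
  assumes M: "model M" and ps: "set ps \<subseteq> el M" "ps \<noteq> []" and a: "a \<lhd> M"
    and P: "\<And>x y. x \<lhd> a \<Longrightarrow> x \<lhd> M \<Longrightarrow> y \<lhd> M \<Longrightarrow> holds (el M) (\<lambda>_. hd ps) (ps @ [x, y]) P \<longleftrightarrow> R x y"
    and fn: "\<And>x. x \<lhd> a \<Longrightarrow> \<exists>y. y \<lhd> M \<and> (\<forall>z. z \<lhd> M \<longrightarrow> (R x z \<longleftrightarrow> z = y))"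
  shows "\<exists>b. b \<lhd> M \<and> (\<forall>x. x \<lhd> a \<longrightarrow> (\<exists>y. y \<lhd> b \<and> R x y))"
proof -
  have "\<exists>b. b \<lhd> M \<and> (\<forall>x. x \<lhd> a \<longrightarrow> (\<exists>y. y \<lhd> b \<and> holds (el M) (\<lambda>_. hd ps) (ps @ [x, y]) P))"
  proof (rule replacement[OF M ps a])
    fix x assume x: "x \<lhd> a"
    from fn[OF x] P[OF x model_mem[OF M a x]]
    show "\<exists>y. y \<lhd> M \<and> (\<forall>z. z \<lhd> M \<longrightarrow> (holds (el M) (\<lambda>_. hd ps) (ps @ [x, z]) P \<longleftrightarrow> z = y))" by simp
  qed
  then obtain b where b: "b \<lhd> M" "\<And>x. x \<lhd> a \<Longrightarrow> \<exists>y. y \<lhd> b \<and> holds (el M) (\<lambda>_. hd ps) (ps @ [x, y]) P"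
    by blast
  have "\<exists>y. y \<lhd> b \<and> R x y" if "x \<lhd> a" for x
    using b(2)[OF that] P[OF that model_mem[OF M a that]] model_mem[OF M b(1)] by blast
  with b(1) show ?thesis by blast
qed

lemma model_op_mem: "model M \<Longrightarrow> f \<lhd> M \<Longrightarrow> op x y \<lhd> f \<Longrightarrow> x \<lhd> M \<and> y \<lhd> M"
  using model_mem op_D[OF model_tr(2)] mem_el by blast

lemma model_up: "model M \<Longrightarrow> x \<lhd> M \<Longrightarrow> y \<lhd> M \<Longrightarrow> up x y \<lhd> M"
  using model_axiom[of M ax_pair e0] by (simp add: axiom_forms_def ax_pair_def abs model_tr)

lemma model_un: assumes M: "model M" and x: "x \<lhd> M" shows "un x \<lhd> M"
proof -
  have "\<forall>x\<in>el M. \<exists>u\<in>el M. \<forall>z\<in>el M. z \<lhd> u \<longleftrightarrow> (\<exists>y\<in>el M. y \<lhd> x \<and> z \<lhd> y)"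
    using model_axiom[OF M, of ax_union e0] by (simp add: axiom_forms_def ax_union_def)
  with x obtain u where u: "u \<lhd> M" "\<forall>z\<in>el M. z \<lhd> u \<longleftrightarrow> (\<exists>y\<in>el M. y \<lhd> x \<and> z \<lhd> y)"
    unfolding ball_el bex_el by blast
  have "u = un x"
  proof (rule ext)
    fix z
    have "z \<lhd> M" if "z \<lhd> u" using model_mem[OF M u(1) that] .
    moreover have "y \<lhd> M \<and> z \<lhd> M" if "y \<lhd> x" "z \<lhd> y" for y
      using model_mem[OF M] x that by blast
    ultimately show "z \<lhd> u \<longleftrightarrow> z \<lhd> un x" using u(2) unfolding un ball_el bex_el by blast
  qed
  with u(1) show ?thesis by simp
qed

lemma model_power:
  assumes M: "model M" and x: "x \<lhd> M"
  shows "\<exists>p. p \<lhd> M \<and> (\<forall>z. z \<lhd> p \<longleftrightarrow> z \<lhd> M \<and> sub z x)"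
proof -
  have "\<forall>x\<in>el M. \<exists>p\<in>el M. \<forall>z\<in>el M. z \<lhd> p \<longleftrightarrow> sub z x"
    using model_axiom[OF M, of ax_power e0] by (simp add: axiom_forms_def ax_power_def abs model_tr M)
  with x obtain p where p: "p \<lhd> M" "\<forall>z\<in>el M. z \<lhd> p \<longleftrightarrow> sub z x"
    unfolding ball_el bex_el by blast
  have "z \<lhd> p \<longleftrightarrow> z \<lhd> M \<and> sub z x" for z
    using p(2) model_mem[OF M p(1)] unfolding ball_el by blast
  with p(1) show ?thesis by blast
qed

lemma model_cup: "model M \<Longrightarrow> x \<lhd> M \<Longrightarrow> y \<lhd> M \<Longrightarrow> cup x y \<lhd> M"
  and model_op: "model M \<Longrightarrow> x \<lhd> M \<Longrightarrow> y \<lhd> M \<Longrightarrow> op x y \<lhd> M"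
  by (simp_all add: cup_def op_def model_up model_un)

lemma model_suc: "model M \<Longrightarrow> x \<lhd> M \<Longrightarrow> suc x \<lhd> M"
  by (simp add: suc_def model_cup model_up)

text \<open>An inductive set of \<open>M\<close> includes \<open>om\<close> by induction. From it
  \<open>om\<close> is cut out as the set of ordinals that neither are limits nor contain
  one.\<close>

lemma model_om: assumes M: "model M" shows "om \<lhd> M"
proof -
  obtain w where w: "w \<lhd> M" "zero \<lhd> w" "\<And>x. x \<lhd> w \<Longrightarrow> suc x \<lhd> w"
  proof -
    have "\<exists>w\<in>el M. (\<exists>e\<in>el M. e = zero \<and> e \<lhd> w) \<and> (\<forall>x\<in>el M. x \<lhd> w \<longrightarrow> (\<exists>y\<in>el M. y = suc x \<and> y \<lhd> w))"
      using model_axiom[OF M, of ax_infinity e0]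
      by (simp add: axiom_forms_def ax_infinity_def abs model_tr M)
    then show ?thesis using that model_mem[OF M] unfolding ball_el bex_el by blast
  qed
  have sub: "n \<lhd> w" if "n \<lhd> om" for n
    by (rule om_induct[OF ex_Diff _ _ that]) (use w in auto)
  obtain b where b: "b \<lhd> M" "\<And>x. x \<lhd> b \<longleftrightarrow> x \<lhd> w \<and> ord x \<and> \<not> limit x \<and> (\<forall>y\<in>el M. y \<lhd> x \<longrightarrow> \<not> limit y)"
    using separationI[OF M _ _ w(1), of "[w]" "is_ord 1 \<^bold>\<and> \<^bold>\<not> is_limit 1 \<^bold>\<and> (\<^bold>\<forall>y. y \<^bold>\<in> 1 \<^bold>\<longrightarrow> \<^bold>\<not> is_limit y)"
      "\<lambda>x. ord x \<and> \<not> limit x \<and> (\<forall>y\<in>el M. y \<lhd> x \<longrightarrow> \<not> limit y)"] w(1)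
    by (auto simp: abs model_tr M)
  have "b = om"
  proof (rule ext)
    fix x
    show "x \<lhd> b \<longleftrightarrow> x \<lhd> om"
    proof
      assume x: "x \<lhd> b"
      then have "ord x" "\<not> limit x" "\<forall>y\<in>el M. y \<lhd> x \<longrightarrow> \<not> limit y" unfolding b by auto
      moreover have "y \<lhd> M" if "y \<lhd> x" for y using model_mem[OF M model_mem[OF M b(1) x] that] .
      ultimately have "ord x" "\<not> om \<lhd> x" "x \<noteq> om" using limit_om by auto
      then show "x \<lhd> om" using ord_linear[OF _ ord_om] by blast
    next
      assume x: "x \<lhd> om"
      then have "\<not> limit x" "\<forall>y. y \<lhd> x \<longrightarrow> \<not> limit y" using isom_om nat_mem_om unfolding isom_def by blast+
      with sub[OF x] ord_mem[OF ord_om x] show "x \<lhd> b" unfolding b by simp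
    qed
  qed
  with b(1) show ?thesis by simp
qed

lemma model_nat: "model M \<Longrightarrow> n \<lhd> om \<Longrightarrow> n \<lhd> M"
  using model_mem model_om by blast

lemma model_zero: "model M \<Longrightarrow> zero \<lhd> M"
  using model_nat zero_om by blast

lemma model_node: "model M \<Longrightarrow> a \<lhd> M \<Longrightarrow> b \<lhd> M \<Longrightarrow> node k a b \<lhd> M"
  by (simp add: node_def model_op model_nat num_om)

lemma model_op_iff: "model M \<Longrightarrow> op x y \<lhd> M \<longleftrightarrow> x \<lhd> M \<and> y \<lhd> M"
  using op_D[OF model_tr(2), of M x y] model_op[of M x y] unfolding mem_el by blast

text \<open>Pairs of elements of \<open>a\<close> and \<open>b\<close> lie in the second power set,
  in the sense of \<open>M\<close>, of \<open>cup a b\<close>.\<close>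

lemma model_prod:
  assumes M: "model M" and a: "a \<lhd> M" and b: "b \<lhd> M"
  shows "\<exists>c. c \<lhd> M \<and> (\<forall>z. z \<lhd> c \<longleftrightarrow> (\<exists>x y. x \<lhd> a \<and> y \<lhd> b \<and> z = op x y))"
proof -
  obtain p where p: "p \<lhd> M" "\<And>z. z \<lhd> p \<longleftrightarrow> z \<lhd> M \<and> sub z (cup a b)"
    using model_power[OF M model_cup[OF M a b]] by metis
  obtain q where q: "q \<lhd> M" "\<And>z. z \<lhd> q \<longleftrightarrow> z \<lhd> M \<and> sub z p"
    using model_power[OF M p(1)] by metis
  obtain c where c: "c \<lhd> M" "\<And>z. z \<lhd> c \<longleftrightarrow> z \<lhd> q \<and> (\<exists>x\<in>el M. x \<lhd> a \<and> (\<exists>y\<in>el M. y \<lhd> b \<and> z = op x y))"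
    using separationI[OF M _ _ q(1), of "[a, b]" "\<^bold>\<exists>x. x \<^bold>\<in> 0 \<^bold>\<and> (\<^bold>\<exists>y. y \<^bold>\<in> 1 \<^bold>\<and> is_pair x y 2)"
      "\<lambda>z. \<exists>x\<in>el M. x \<lhd> a \<and> (\<exists>y\<in>el M. y \<lhd> b \<and> z = op x y)"] a b
    by (auto simp: abs model_tr M)
  have "op x y \<lhd> q" if "x \<lhd> a" "y \<lhd> b" for x y
  proof -
    have xy: "x \<lhd> M" "y \<lhd> M" using that model_mem[OF M] a b by auto
    then have "up x x \<lhd> p" "up x y \<lhd> p" using that by (auto simp: p sub_def model_up M)
    with xy show ?thesis unfolding q op_def by (auto simp: sub_def model_up M)
  qed
  then have "z \<lhd> c \<longleftrightarrow> (\<exists>x y. x \<lhd> a \<and> y \<lhd> b \<and> z = op x y)" for z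
    unfolding c Bex_def mem_el using model_mem[OF M a] model_mem[OF M b] by blast
  with c(1) show ?thesis by blast
qed

subsection \<open>Restrictions and finite sequences\<close>

text \<open>A relation and not an operation, because the existence of the restriction inside a model
  is what later has to be proved.\<close>

definition isrestr :: "'a \<Rightarrow> 'a \<Rightarrow> 'a \<Rightarrow> bool" where
  "isrestr f a g \<longleftrightarrow> (\<forall>p. p \<lhd> g \<longleftrightarrow> p \<lhd> f \<and> (\<exists>x y. x \<lhd> a \<and> p = op x y))"
definition is_restr :: "nat \<Rightarrow> nat \<Rightarrow> nat \<Rightarrow> form" where
  "is_restr f a g = (\<^bold>\<forall>p. p \<^bold>\<in> g \<^bold>\<longleftrightarrow> p \<^bold>\<in> f \<^bold>\<and> (\<^bold>\<exists>x. \<^bold>\<exists>y. x \<^bold>\<in> a \<^bold>\<and> is_pair x y p))"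

lemma abs_restr [abs]:
  assumes "ok D xs" "f < length xs" "a < length xs" "g < length xs"
  shows "holds D e xs (is_restr f a g) \<longleftrightarrow> isrestr (xs ! f) (xs ! a) (xs ! g)"
proof -
  have tD: "trD D" using assms(1) by (simp add: ok_def)
  have "holds D e xs (is_restr f a g) \<longleftrightarrow>
      (\<forall>p\<in>D. p \<lhd> xs ! g \<longleftrightarrow> p \<lhd> xs ! f \<and> (\<exists>x\<in>D. \<exists>y\<in>D. x \<lhd> xs ! a \<and> p = op x y))"
    using assms by (simp add: is_restr_def abs nth_append cong: ball_cong bex_cong)
  also have "\<dots> \<longleftrightarrow> (\<forall>p\<in>D. p \<lhd> xs ! g \<longleftrightarrow> p \<lhd> xs ! f \<and> (\<exists>x y. x \<lhd> xs ! a \<and> p = op x y))"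
    using op_D[OF tD] by (intro ball_cong refl) blast
  also have "\<dots> \<longleftrightarrow> isrestr (xs ! f) (xs ! a) (xs ! g)"
    unfolding isrestr_def using ok_mem[OF assms(1,2)] ok_mem[OF assms(1,4)] by blast
  finally show ?thesis .
qed

lemma isrestr_op: "isrestr f a g \<Longrightarrow> op x y \<lhd> g \<longleftrightarrow> op x y \<lhd> f \<and> x \<lhd> a"
  unfolding isrestr_def by auto

lemma isrestr_self: "isfun f a \<Longrightarrow> isrestr f a g \<Longrightarrow> g = f"
  unfolding isrestr_def isfun_def by (intro ext) blast

lemma isrestr_suc:
  assumes g: "isrestr f a g" and f: "isfun f k" "op a y \<lhd> f"
  shows "isrestr f (suc a) (cup g (up (op a y) (op a y)))"
  unfolding isrestr_def
proof
  fix p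
  have "p \<lhd> f \<and> (\<exists>x z. x \<lhd> suc a \<and> p = op x z) \<longleftrightarrow>
      p \<lhd> f \<and> (\<exists>x z. x \<lhd> a \<and> p = op x z) \<or> p \<lhd> f \<and> (\<exists>z. p = op a z)" by auto
  moreover have "p \<lhd> f \<and> (\<exists>z. p = op a z) \<longleftrightarrow> p = op a y"
  proof
    assume "p \<lhd> f \<and> (\<exists>z. p = op a z)"
    then obtain z where "op a z \<lhd> f" "p = op a z" by blast
    with isfun_unique[OF f(1) this(1) f(2)] show "p = op a y" by simp
  qed (use f(2) in blast)
  ultimately show "p \<lhd> cup g (up (op a y) (op a y)) \<longleftrightarrow> p \<lhd> f \<and> (\<exists>x z. x \<lhd> suc a \<and> p = op x z)"
    using g unfolding isrestr_def by simp
qed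

text \<open>Internal induction on \<open>i\<close> shows that the restriction of \<open>f\<close> to
  each \<open>i\<close> up to \<open>k\<close> lies in \<open>M\<close>: passing to
  \<open>suc i\<close> adds one pair. The failure set is separated in a model \<open>N\<close> that
  contains both \<open>f\<close> and \<open>M\<close>.\<close>

lemma model_finite_seq:
  assumes M: "model M" and k: "k \<lhd> om" and f: "isfun f k" "\<And>x y. op x y \<lhd> f \<Longrightarrow> y \<lhd> M"
  shows "f \<lhd> M"
proof -
  obtain N where N: "model N" "set [f, M, k, om] \<subseteq> el N" using ex_model_list by blast
  let ?Q = "\<lambda>i. sub i k \<longrightarrow> (\<exists>g. g \<lhd> M \<and> isrestr f i g)"
  have ex: "\<exists>b. \<forall>x. x \<lhd> b \<longleftrightarrow> x \<lhd> om \<and> \<not> ?Q x"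
  proof -
    have "\<exists>g\<in>el N. g \<lhd> M \<and> isrestr f x g" if "\<exists>g. g \<lhd> M \<and> isrestr f x g" for x
      using that N(2) model_mem[OF N(1), of M] by auto
    then have "\<exists>b. b \<lhd> N \<and> (\<forall>x. x \<lhd> b \<longleftrightarrow> x \<lhd> om \<and> \<not> ?Q x)"
      using N(2)
      by (intro separationI[OF N(1), of "[f, M, k]" om "\<^bold>\<not> (is_subset 3 2 \<^bold>\<longrightarrow> (\<^bold>\<exists>g. g \<^bold>\<in> 1 \<^bold>\<and> is_restr 0 3 g))"])
        (auto simp: abs model_tr N(1))
    then show ?thesis by blast
  qed
  have "?Q k"
  proof (rule om_induct[OF ex _ _ k])
    have "isrestr f zero zero" by (simp add: isrestr_def)
    then show "?Q zero" using model_zero[OF M] by blast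
  next
    fix n assume n: "n \<lhd> om" "?Q n"
    show "?Q (suc n)"
    proof
      assume s: "sub (suc n) k"
      then have "sub n k" and "n \<lhd> k" by (auto simp: sub_def)
      then obtain g y where g: "g \<lhd> M" "isrestr f n g" "op n y \<lhd> f" using n(2) isfun_ex[OF f(1)] by blast
      have "cup g (up (op n y) (op n y)) \<lhd> M"
        using g(1) f(2)[OF g(3)] n(1) by (simp add: M model_cup model_op model_up model_nat)
      with isrestr_suc[OF g(2) f(1) g(3)] show "\<exists>g. g \<lhd> M \<and> isrestr f (suc n) g" by blast
    qed
  qed
  then show ?thesis using isrestr_self[OF f(1)] by (auto simp: sub_def)
qed

lemma model_assignment: "model M \<Longrightarrow> n \<lhd> om \<Longrightarrow> A \<lhd> M \<Longrightarrow> mapsto s n A \<Longrightarrow> s \<lhd> M"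
  unfolding mapsto_def using model_finite_seq model_mem by blast

text \<open>Consider a least position whose entry is outside \<open>M\<close>. That entry is a node
  built from earlier entries and variables in \<open>w\<close>, and \<open>M\<close> is closed under
  nodes. So all entries, and with them the finite sequence, belong to \<open>M\<close>.\<close>

lemma fseq_model:
  assumes M: "model M" and k: "k \<lhd> om" and w: "w \<lhd> M" and f: "fseq f k w"
  shows "f \<lhd> M"
proof -
  have fn: "isfun f k" using f by (simp add: fseq_def)
  obtain N where N: "model N" "set [f, M, k] \<subseteq> el N" using ex_model_list by blast
  obtain b where b: "\<And>x. x \<lhd> b \<longleftrightarrow> x \<lhd> k \<and> (\<exists>c\<in>el N. op x c \<lhd> f \<and> \<not> c \<lhd> M)"
    using separationI[OF N(1), of "[f, M]" k "\<^bold>\<exists>c. app 0 2 c \<^bold>\<and> \<^bold>\<not> c \<^bold>\<in> 1" "\<lambda>x. \<exists>c\<in>el N. op x c \<lhd> f \<and> \<not> c \<lhd> M"] N(2)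
    by (auto simp: abs model_tr N(1))
  have N3: "c \<lhd> N" if "op x c \<lhd> f" for x c
    using that N model_mem[OF N(1)] model_op_iff[OF N(1)] by auto
  have "c \<lhd> M" if c: "op i c \<lhd> f" for i c
  proof (rule ccontr)
    assume "\<not> c \<lhd> M"
    with c N3 isfun_mem[OF fn c] have "i \<lhd> b" unfolding b by auto
    then obtain m where m: "m \<lhd> b" "\<forall>z. z \<lhd> m \<longrightarrow> \<not> z \<lhd> b" using foundation by blast
    then obtain d where d: "op m d \<lhd> f" "\<not> d \<lhd> M" unfolding b by blast
    have less: "p \<lhd> M" if "j \<lhd> m" "op j p \<lhd> f" for j p
    proof (rule ccontr)
      assume "\<not> p \<lhd> M"
      with that N3 isfun_mem[OF fn that(2)] have "j \<lhd> b" unfolding b by auto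
      with m(2) that(1) show False by blast
    qed
    have wM: "u \<lhd> M" if "u \<lhd> w" for u using that model_mem[OF M w] by blast
    have "d \<lhd> M"
      using fseq_cases[OF f d(1)]
      by (auto simp: nFalse_def nImp_def nAll_def intro!: model_node[OF M] model_zero[OF M] dest: wM less)
    with d(2) show False ..
  qed
  then show ?thesis by (rule model_finite_seq[OF M k fn])
qed

text \<open>Each assignment of the universe is a finite sequence and lies in \<open>M\<close>, so
  the power set of \<open>M\<close> catches all of them.\<close>

lemma model_functions:
  assumes M: "model M" and n: "n \<lhd> om" and A: "A \<lhd> M"
  shows "\<exists>X. X \<lhd> M \<and> (\<forall>s. s \<lhd> X \<longleftrightarrow> mapsto s n A)"
proof -
  obtain c where c: "c \<lhd> M" "\<And>z. z \<lhd> c \<longleftrightarrow> (\<exists>x y. x \<lhd> n \<and> y \<lhd> A \<and> z = op x y)"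
    using model_prod[OF M model_nat[OF M n] A] by metis
  obtain p where p: "p \<lhd> M" "\<And>z. z \<lhd> p \<longleftrightarrow> z \<lhd> M \<and> sub z c" using model_power[OF M c(1)] by metis
  obtain X where X: "X \<lhd> M" "\<And>s. s \<lhd> X \<longleftrightarrow> s \<lhd> p \<and> mapsto s n A"
    using separationI[OF M, of "[n, A]" p "maps 2 0 1" "\<lambda>s. mapsto s n A"] model_nat[OF M n] A p(1)
    by (auto simp: abs model_tr M)
  have "s \<lhd> p" if s: "mapsto s n A" for s
  proof -
    have "sub s c" using s unfolding sub_def c mapsto_def isfun_def by blast
    with model_assignment[OF M n A s] p show ?thesis by blast
  qed
  with X show ?thesis by blast
qed

subsection \<open>Absoluteness of satisfaction and definability\<close>

text \<open>The Tarski clause of an entry of \<open>f\<close> consults the relation only at entries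
  of \<open>f\<close> and assignments from \<open>n\<close> to \<open>A\<close>.\<close>

lemma satrel_cong:
  assumes f: "fseq f k n" and S: "satrel A n f S"
    and eq: "\<And>i c s. op i c \<lhd> f \<Longrightarrow> mapsto s n A \<Longrightarrow> op c s \<lhd> T \<longleftrightarrow> op c s \<lhd> S"
  shows "satrel A n f T"
  unfolding satrel_def
proof (intro allI impI, elim conjE)
  fix i c s assume c: "op i c \<lhd> f" and s: "mapsto s n A"
  note cl = S[unfolded satrel_def tarski_def, rule_format, OF conjI[OF c s]]
  show "tarski A n T c s"
    unfolding tarski_def eq[OF c s]
  proof (intro conjI allI impI)
    fix p q assume pq: "c = nImp p q"
    with fseq_cases[OF f c] obtain j l where "op j p \<lhd> f" "op l q \<lhd> f" by auto
    with pq cl eq[OF _ s] show "op c s \<lhd> S \<longleftrightarrow> (op p s \<lhd> T \<longrightarrow> op q s \<lhd> T)" by blast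
  next
    fix u p assume p: "c = nAll u p"
    with fseq_cases[OF f c] obtain j where "op j p \<lhd> f" by auto
    with p cl eq show "op c s \<lhd> S \<longleftrightarrow>
       (\<forall>t. mapsto t n A \<and> (\<forall>j x. j \<noteq> u \<longrightarrow> (op j x \<lhd> t \<longleftrightarrow> op j x \<lhd> s)) \<longrightarrow> op p t \<lhd> T)" by blast
  qed (use cl in blast)+
qed

text \<open>If \<open>T\<close> in \<open>M\<close> agrees with \<open>S\<close> on the entries
  before position \<open>i\<close>, the Tarski clause defines the truth set of the entry at
  \<open>i\<close> from \<open>T\<close> over \<open>M\<close>. One separation instance is needed
  per kind of node.\<close>

lemma satrel_row:
  assumes M: "model M" and A: "A \<lhd> M" and n: "n \<lhd> om" and f: "fseq f k n" and S: "satrel A n f S"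
    and T: "T \<lhd> M" "\<And>j c s. j \<lhd> i \<Longrightarrow> op j c \<lhd> f \<Longrightarrow> mapsto s n A \<Longrightarrow> op c s \<lhd> T \<longleftrightarrow> op c s \<lhd> S"
    and c: "op i c \<lhd> f" "c \<lhd> M"
  shows "\<exists>R. R \<lhd> M \<and> (\<forall>s. s \<lhd> R \<longleftrightarrow> mapsto s n A \<and> op c s \<lhd> S)"
proof -
  obtain X where X: "X \<lhd> M" "\<And>s. s \<lhd> X \<longleftrightarrow> mapsto s n A" using model_functions[OF M n A] by metis
  have tk: "tarski A n S c s" if "s \<lhd> X" for s
    using S[unfolded satrel_def, rule_format, OF conjI[OF c(1)]] that X(2) by blast
  note cl = tk[unfolded tarski_def]
  have XM: "op u x \<lhd> s \<Longrightarrow> u \<lhd> M \<and> x \<lhd> M" if "s \<lhd> X" for s u x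
    using model_mem[OF M model_mem[OF M X(1) that]] model_op_iff[OF M] by blast
  have nM: "u \<lhd> M" if "u \<lhd> n" for u using model_mem[OF M model_nat[OF M n] that] .
  have D: "a \<lhd> M \<and> b \<lhd> M" if "c = node l a b" for l a b
    using node_D[OF model_tr(2)[OF M], of l a b] c(2) unfolding that mem_el by blast
  have ex: "\<exists>R. R \<lhd> M \<and> (\<forall>s. s \<lhd> R \<longleftrightarrow> s \<lhd> X \<and> op c s \<lhd> S)"
    if "set ps \<subseteq> el M" "ps \<noteq> []" "\<And>s. s \<lhd> X \<Longrightarrow> s \<lhd> M \<Longrightarrow> holds (el M) (\<lambda>_. hd ps) (ps @ [s]) P \<longleftrightarrow> op c s \<lhd> S" for ps P
    using separationI[OF M that(1,2) X(1), where P=P and Q="\<lambda>s. op c s \<lhd> S"] that(3) by blast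
  consider "c = nFalse" | u v where "u \<lhd> n" "v \<lhd> n" "c = node 1 u v" | u v where "u \<lhd> n" "v \<lhd> n" "c = node 2 u v"
    | p q where "\<exists>j. j \<lhd> i \<and> op j p \<lhd> f" "\<exists>j. j \<lhd> i \<and> op j q \<lhd> f" "c = nImp p q"
    | u p where "u \<lhd> n" "\<exists>j. j \<lhd> i \<and> op j p \<lhd> f" "c = nAll u p"
    using fseq_cases[OF f c(1)] by blast
  then have "\<exists>R. R \<lhd> M \<and> (\<forall>s. s \<lhd> R \<longleftrightarrow> s \<lhd> X \<and> op c s \<lhd> S)"
  proof cases
    case 1
    with cl have "\<forall>s. s \<lhd> zero \<longleftrightarrow> s \<lhd> X \<and> op c s \<lhd> S" by auto
    then show ?thesis using model_zero[OF M] by blast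
  next
    case (2 u v)
    have *: "op c s \<lhd> S \<longleftrightarrow> (\<exists>x\<in>el M. \<exists>y\<in>el M. op u x \<lhd> s \<and> op v y \<lhd> s \<and> x \<lhd> y)" if "s \<lhd> X" for s
      using cl[OF that] 2(3) XM[OF that] unfolding bex_el by blast
    show ?thesis
      by (rule ex[of "[u, v]" "\<^bold>\<exists>x. \<^bold>\<exists>y. app 2 0 x \<^bold>\<and> app 2 1 y \<^bold>\<and> x \<^bold>\<in> y"])
        (use 2(1,2) nM * in \<open>simp_all add: abs model_tr M\<close>)
  next
    case (3 u v)
    have *: "op c s \<lhd> S \<longleftrightarrow> (\<exists>x\<in>el M. \<exists>y\<in>el M. op u x \<lhd> s \<and> op v y \<lhd> s \<and> x = y)" if "s \<lhd> X" for s
      using cl[OF that] 3(3) XM[OF that] unfolding bex_el by blast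
    show ?thesis
      by (rule ex[of "[u, v]" "\<^bold>\<exists>x. \<^bold>\<exists>y. app 2 0 x \<^bold>\<and> app 2 1 y \<^bold>\<and> x \<^bold>= y"])
        (use 3(1,2) nM * in \<open>simp_all add: abs model_tr M\<close>)
  next
    case (4 p q)
    then have pq: "p \<lhd> M" "q \<lhd> M" using D unfolding nImp_def by auto
    have *: "op c s \<lhd> S \<longleftrightarrow> (op p s \<lhd> T \<longrightarrow> op q s \<lhd> T)" if "s \<lhd> X" for s
      using cl[OF that] 4 T(2) X(2) that by blast
    show ?thesis
      by (rule ex[of "[p, q, T]" "app 2 0 3 \<^bold>\<longrightarrow> app 2 1 3"])
        (use pq T(1) * in \<open>simp_all add: abs model_tr M\<close>)
  next
    case (5 u p)
    then have up: "p \<lhd> M" "u \<lhd> M" using D unfolding nAll_def by auto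
    have *: "op c s \<lhd> S \<longleftrightarrow> (\<forall>t\<in>el M. t \<lhd> X \<and> (\<forall>j\<in>el M. \<forall>x\<in>el M. j \<noteq> u \<longrightarrow> (op j x \<lhd> t \<longleftrightarrow> op j x \<lhd> s)) \<longrightarrow> op p t \<lhd> T)"
      if s: "s \<lhd> X" for s
    proof -
      have "(\<forall>j\<in>el M. \<forall>x\<in>el M. j \<noteq> u \<longrightarrow> (op j x \<lhd> t \<longleftrightarrow> op j x \<lhd> s)) \<longleftrightarrow>
          (\<forall>j x. j \<noteq> u \<longrightarrow> (op j x \<lhd> t \<longleftrightarrow> op j x \<lhd> s))" if "t \<lhd> X" for t
        using XM[OF s] XM[OF that] unfolding ball_el by blast
      moreover have "op p t \<lhd> T \<longleftrightarrow> op p t \<lhd> S" if "t \<lhd> X" for t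
        using 5(2) T(2) X(2) that by blast
      moreover have "op c s \<lhd> S \<longleftrightarrow> (\<forall>t. t \<lhd> X \<and> (\<forall>j x. j \<noteq> u \<longrightarrow> (op j x \<lhd> t \<longleftrightarrow> op j x \<lhd> s)) \<longrightarrow> op p t \<lhd> S)"
        using cl[OF s] 5(3) unfolding X(2) by blast
      ultimately show ?thesis using model_mem[OF M X(1)] unfolding ball_el by blast
    qed
    show ?thesis
      by (rule ex[of "[u, p, T, X]" "\<^bold>\<forall>t. t \<^bold>\<in> 3 \<^bold>\<and> (\<^bold>\<forall>j. \<^bold>\<forall>x. \<^bold>\<not> j \<^bold>= 0 \<^bold>\<longrightarrow> (app t j x \<^bold>\<longleftrightarrow> app 4 j x)) \<^bold>\<longrightarrow> app 2 1 t"])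
        (use up T(1) X(1) * in \<open>simp_all add: abs model_tr M\<close>)
  qed
  then show ?thesis unfolding X(2) .
qed

text \<open>The relation \<open>S\<close> may lie outside \<open>M\<close>, and the coded formulas
  may be nonstandard. Internal induction on \<open>i\<close> builds in \<open>M\<close> a part
  \<open>T\<close> of \<open>S\<close> that has all rows of entries before \<open>i\<close>; at
  \<open>k\<close> it agrees with \<open>S\<close> wherever the Tarski clauses look.\<close>

lemma satrel_model:
  assumes M: "model M" and A: "A \<lhd> M" and n: "n \<lhd> om" and k: "k \<lhd> om"
    and f: "fseq f k n" and S: "satrel A n f S"
  shows "\<exists>T. T \<lhd> M \<and> satrel A n f T \<and> (\<forall>i c s. op i c \<lhd> f \<and> mapsto s n A \<longrightarrow> (op c s \<lhd> T \<longleftrightarrow> op c s \<lhd> S))"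
proof -
  have fn: "isfun f k" using f by (simp add: fseq_def)
  have fM: "f \<lhd> M" using fseq_model[OF M k model_nat[OF M n] f] .
  have cM: "c \<lhd> M" if "op i c \<lhd> f" for i c
    using model_mem[OF M fM that] model_op_iff[OF M] by blast
  define rows where "rows i T \<longleftrightarrow> sub T S \<and> (\<forall>j c s. j \<lhd> i \<and> op j c \<lhd> f \<and> mapsto s n A \<and> op c s \<lhd> S \<longrightarrow> op c s \<lhd> T)"
    for i T
  let ?Q = "\<lambda>i. sub i k \<longrightarrow> (\<exists>T. T \<lhd> M \<and> rows i T)"
  obtain N where N: "model N" "set [f, M, k, S, n, A, om] \<subseteq> el N" using ex_model_list by blast
  have ex: "\<exists>b. \<forall>x. x \<lhd> b \<longleftrightarrow> x \<lhd> om \<and> \<not> ?Q x"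
  proof -
    have TN: "T \<lhd> N" if "T \<lhd> M" for T using that N(2) model_mem[OF N(1), of M] by auto
    have SN: "j \<lhd> N \<and> c \<lhd> N \<and> s \<lhd> N" if "op j c \<lhd> f" "op c s \<lhd> S" for j c s
      using that N(2) model_mem[OF N(1)] model_op_iff[OF N(1)] by auto
    have "?Q x \<longleftrightarrow> (sub x k \<longrightarrow> (\<exists>T\<in>el N. T \<lhd> M \<and> sub T S \<and>
        (\<forall>j\<in>el N. \<forall>c\<in>el N. \<forall>s\<in>el N. j \<lhd> x \<and> op j c \<lhd> f \<and> mapsto s n A \<and> op c s \<lhd> S \<longrightarrow> op c s \<lhd> T)))" for x
      unfolding rows_def ball_el bex_el using TN SN by meson
    then have "\<exists>b. b \<lhd> N \<and> (\<forall>x. x \<lhd> b \<longleftrightarrow> x \<lhd> om \<and> \<not> ?Q x)"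
      using N(2)
      by (intro separationI[OF N(1), of "[f, M, k, S, n, A]" om "\<^bold>\<not> (is_subset 6 2 \<^bold>\<longrightarrow> (\<^bold>\<exists>T. T \<^bold>\<in> 1 \<^bold>\<and> is_subset T 3 \<^bold>\<and>
          (\<^bold>\<forall>j. \<^bold>\<forall>c. \<^bold>\<forall>s. j \<^bold>\<in> 6 \<^bold>\<and> app 0 j c \<^bold>\<and> maps s 4 5 \<^bold>\<and> app 3 c s \<^bold>\<longrightarrow> app T c s)))"])
        (simp_all add: abs model_tr N(1))
    then show ?thesis by blast
  qed
  have "?Q k"
  proof (rule om_induct[OF ex _ _ k])
    show "?Q zero" using model_zero[OF M] unfolding rows_def sub_def by auto
  next
    fix i assume i: "i \<lhd> om" "?Q i"
    show "?Q (suc i)"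
    proof
      assume s: "sub (suc i) k"
      then have ik: "sub i k" "i \<lhd> k" by (auto simp: sub_def)
      then obtain T where T: "T \<lhd> M" "rows i T" using i(2) by blast
      obtain c where c: "op i c \<lhd> f" using isfun_ex[OF fn ik(2)] by blast
      have TS: "op c s \<lhd> T \<longleftrightarrow> op c s \<lhd> S" if "j \<lhd> i" "op j c \<lhd> f" "mapsto s n A" for j c s
        using T(2) that unfolding rows_def sub_def by blast
      have "\<exists>R. R \<lhd> M \<and> (\<forall>s. s \<lhd> R \<longleftrightarrow> mapsto s n A \<and> op c s \<lhd> S)"
        by (rule satrel_row[OF M A n f S T(1) _ c cM[OF c]]) (rule TS)
      then obtain R where R: "R \<lhd> M" "\<And>s. s \<lhd> R \<longleftrightarrow> mapsto s n A \<and> op c s \<lhd> S" by blast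
      \<comment> \<open>The new row: the product of the singleton of \<open>c\<close> with its truth
        set \<open>R\<close>.\<close>
      obtain C where C: "C \<lhd> M" "\<And>z. z \<lhd> C \<longleftrightarrow> (\<exists>x y. x \<lhd> up c c \<and> y \<lhd> R \<and> z = op x y)"
        using model_prod[OF M model_up[OF M cM[OF c] cM[OF c]] R(1)] by metis
      have "rows (suc i) (cup T C)"
        unfolding rows_def
      proof (intro conjI allI impI, unfold cup)
        show "sub (cup T C) S" using T(2) C(2) R(2) unfolding rows_def sub_def by auto
        fix j d s assume a: "j \<lhd> suc i \<and> op j d \<lhd> f \<and> mapsto s n A \<and> op d s \<lhd> S"
        show "op d s \<lhd> T \<or> op d s \<lhd> C"
        proof (cases "j \<lhd> i")
          case True
          with a T(2) show ?thesis unfolding rows_def by blast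
        next
          case False
          with a have "j = i" by simp
          with a c have "d = c" using isfun_unique[OF fn] by blast
          with a R(2) C(2) show ?thesis by auto
        qed
      qed
      then show "\<exists>T. T \<lhd> M \<and> rows (suc i) T" using model_cup[OF M T(1) C(1)] by blast
    qed
  qed
  then obtain T where T: "T \<lhd> M" "rows k T" by (auto simp: sub_def)
  have eq: "op c s \<lhd> T \<longleftrightarrow> op c s \<lhd> S" if "op i c \<lhd> f" "mapsto s n A" for i c s
    using T(2) that isfun_mem[OF fn that(1)] unfolding rows_def sub_def by blast
  have "satrel A n f T" by (rule satrel_cong[OF f S]) (rule eq)
  with T(1) eq show ?thesis by blast
qed

lemma evals_iff: "evals S A c n \<longleftrightarrow> n \<lhd> om \<and> (\<exists>f k i. k \<lhd> om \<and> fseq f k n \<and> op i c \<lhd> f \<and> satrel A n f S)"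
  by (simp add: evals_def isnat_iff)

lemma evals_model:
  assumes M: "model M" and A: "A \<lhd> M" and S: "evals S A c n"
  shows "c \<lhd> M \<and> (\<exists>T. T \<lhd> M \<and> evals T A c n \<and> (\<forall>s. mapsto s n A \<longrightarrow> (op c s \<lhd> T \<longleftrightarrow> op c s \<lhd> S)))"
proof -
  from S obtain f k i where f: "n \<lhd> om" "k \<lhd> om" "fseq f k n" "op i c \<lhd> f" "satrel A n f S"
    unfolding evals_iff by blast
  have "f \<lhd> M" using fseq_model[OF M f(2) model_nat[OF M f(1)] f(3)] .
  then have "c \<lhd> M" using model_mem[OF M _ f(4)] model_op_iff[OF M] by blast
  with satrel_model[OF M A f(1,2,3,5)] f show ?thesis unfolding evals_iff by blast
qed

text \<open>The formation sequence, its length and the position are finite objects of the universe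
  and hence lie in \<open>M\<close>; the satisfaction relation is itself a parameter.\<close>

lemma abs_evaluates [abs]:
  assumes M: "model M" and xs: "ok (el M) xs"
    and l: "S < length xs" "A < length xs" "c < length xs" "n < length xs"
  shows "holds (el M) e xs (evaluates S A c n) \<longleftrightarrow> evals (xs ! S) (xs ! A) (xs ! c) (xs ! n)"
proof (cases "xs ! n \<lhd> om")
  case True
  have A: "xs ! A \<lhd> M" using ok_nth[OF xs l(2)] by simp
  have s: "s \<lhd> M" if "mapsto s (xs ! n) (xs ! A)" for s
    using model_assignment[OF M True A that] .
  have sr: "holds (el M) e (xs @ [f, k, i]) (satisfaction_rel A n (length xs) S) \<longleftrightarrow>
      satrel (xs ! A) (xs ! n) f (xs ! S)" if "f \<lhd> M" "k \<lhd> M" "i \<lhd> M" for f k i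
    by (subst abs_satrel) (use xs l that s in \<open>auto simp: nth_append\<close>)
  have "holds (el M) e xs (evaluates S A c n) \<longleftrightarrow> (\<exists>f\<in>el M. \<exists>k\<in>el M. \<exists>i\<in>el M. k \<lhd> om \<and>
      fseq f k (xs ! n) \<and> op i (xs ! c) \<lhd> f \<and> satrel (xs ! A) (xs ! n) f (xs ! S))"
    using xs l True sr by (simp add: evaluates_def abs nth_append model_om[OF M])
  also have "\<dots> \<longleftrightarrow> evals (xs ! S) (xs ! A) (xs ! c) (xs ! n)"
  proof -
    have "f \<lhd> M \<and> k \<lhd> M \<and> i \<lhd> M" if "k \<lhd> om" "fseq f k (xs ! n)" "op i (xs ! c) \<lhd> f" for f k i
    proof -
      have "f \<lhd> M" using fseq_model[OF M that(1) model_nat[OF M True] that(2)] .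
      with that show ?thesis using model_mem[OF M _ that(3)] model_op_iff[OF M] model_nat[OF M] by blast
    qed
    with True show ?thesis unfolding evals_iff bex_el by blast
  qed
  finally show ?thesis .
next
  case False
  then show ?thesis using xs l by (simp add: evaluates_def evals_iff abs nth_append model_om[OF M])
qed

definition defby :: "'a \<Rightarrow> 'a \<Rightarrow> 'a \<Rightarrow> 'a \<Rightarrow> 'a \<Rightarrow> 'a \<Rightarrow> 'a \<Rightarrow> bool" where
  "defby X A m n c r S \<longleftrightarrow> m \<lhd> om \<and> n = suc m \<and> evals S A c n \<and> mapsto r m A \<and>
     (\<forall>a. a \<lhd> X \<longleftrightarrow> a \<lhd> A \<and> (\<exists>t. mapsto t n A \<and> sub r t \<and> op m a \<lhd> t \<and> op c t \<lhd> S))"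
definition defsub :: "'a \<Rightarrow> 'a \<Rightarrow> bool" where
  "defsub X A \<longleftrightarrow> (\<exists>m n c r S. defby X A m n c r S)"
definition isDef :: "'a \<Rightarrow> 'a \<Rightarrow> bool" where
  "isDef A Y \<longleftrightarrow> (\<forall>X. X \<lhd> Y \<longleftrightarrow> defsub X A)"

text \<open>The relation \<open>S\<close> is replaced by its copy \<open>T\<close> in
  \<open>M\<close>; separation over \<open>A\<close> with parameter \<open>T\<close> then recovers
  \<open>X\<close> in \<open>M\<close>.\<close>

lemma defby_model:
  assumes M: "model M" and A: "A \<lhd> M" and X: "defby X A m n c r S"
  shows "m \<lhd> M \<and> n \<lhd> M \<and> c \<lhd> M \<and> r \<lhd> M \<and> X \<lhd> M \<and> (\<exists>T. T \<lhd> M \<and> defby X A m n c r T)"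
proof -
  have b: "m \<lhd> om" "n = suc m" "evals S A c n" "mapsto r m A"
    "\<And>a. a \<lhd> X \<longleftrightarrow> a \<lhd> A \<and> (\<exists>t. mapsto t n A \<and> sub r t \<and> op m a \<lhd> t \<and> op c t \<lhd> S)"
    using X unfolding defby_def by auto
  have n: "n \<lhd> om" using b(1,2) suc_om by simp
  have mM: "m \<lhd> M" "n \<lhd> M" "r \<lhd> M"
    using model_nat[OF M] b n model_assignment[OF M b(1) A b(4)] by auto
  from evals_model[OF M A b(3)] obtain T where T: "c \<lhd> M" "T \<lhd> M" "evals T A c n"
    "\<And>s. mapsto s n A \<Longrightarrow> op c s \<lhd> T \<longleftrightarrow> op c s \<lhd> S" by blast
  have d: "defby X A m n c r T"
    using b T unfolding defby_def by (metis (no_types, lifting))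
  obtain Y where Y: "Y \<lhd> M" "\<And>a. a \<lhd> Y \<longleftrightarrow> a \<lhd> A \<and>
      (\<exists>t\<in>el M. mapsto t n A \<and> sub r t \<and> op m a \<lhd> t \<and> op c t \<lhd> T)"
    using separationI[OF M _ _ A, of "[A, m, n, c, r, T]"
      "\<^bold>\<exists>t. maps t 2 0 \<^bold>\<and> is_subset 4 t \<^bold>\<and> app t 1 6 \<^bold>\<and> app 5 3 t"
      "\<lambda>a. \<exists>t\<in>el M. mapsto t n A \<and> sub r t \<and> op m a \<lhd> t \<and> op c t \<lhd> T"] A mM T(1,2)
    by (auto simp: abs model_tr M)
  have "Y = X"
    by (rule ext) (use Y(2) d model_assignment[OF M n A] in \<open>unfold defby_def bex_el, blast\<close>)
  with mM T d Y(1) show ?thesis by blast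
qed

lemma defsub_model: "model M \<Longrightarrow> A \<lhd> M \<Longrightarrow> defsub X A \<Longrightarrow> X \<lhd> M"
  unfolding defsub_def using defby_model by blast

text \<open>Now the satisfaction relation is quantified, and a witness of the universe is exchanged
  for its copy in \<open>M\<close>.\<close>

lemma abs_definable [abs]:
  assumes M: "model M" and xs: "ok (el M) xs" and l: "X < length xs" "A < length xs"
  shows "holds (el M) e xs (is_definable_subset X A) \<longleftrightarrow> defsub (xs ! X) (xs ! A)"
proof -
  have AX: "xs ! A \<lhd> M" "xs ! X \<lhd> M" using ok_nth[OF xs] l by auto
  have "holds (el M) e xs (is_definable_subset X A) \<longleftrightarrow>
      (\<exists>m\<in>el M. \<exists>n\<in>el M. \<exists>c\<in>el M. \<exists>r\<in>el M. \<exists>S\<in>el M.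
        m \<lhd> om \<and> n = suc m \<and> evals S (xs ! A) c n \<and> mapsto r m (xs ! A) \<and>
        (\<forall>a\<in>el M. a \<lhd> xs ! X \<longleftrightarrow> a \<lhd> xs ! A \<and>
          (\<exists>t\<in>el M. mapsto t n (xs ! A) \<and> sub r t \<and> op m a \<lhd> t \<and> op c t \<lhd> S)))"
    using xs l by (simp add: is_definable_subset_def abs M nth_append model_om)
  also have "\<dots> \<longleftrightarrow> (\<exists>m\<in>el M. \<exists>n\<in>el M. \<exists>c\<in>el M. \<exists>r\<in>el M. \<exists>S\<in>el M. defby (xs ! X) (xs ! A) m n c r S)"
  proof (intro bex_cong refl)
    fix m n c r S
    have "(\<forall>a\<in>el M. a \<lhd> xs ! X \<longleftrightarrow> a \<lhd> xs ! A \<and> Q a) \<longleftrightarrow> (\<forall>a. a \<lhd> xs ! X \<longleftrightarrow> a \<lhd> xs ! A \<and> Q a)" for Q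
      using model_mem[OF M AX(1)] model_mem[OF M AX(2)] unfolding ball_el by blast
    moreover have "(\<exists>t\<in>el M. mapsto t n (xs ! A) \<and> Q t) \<longleftrightarrow> (\<exists>t. mapsto t n (xs ! A) \<and> Q t)"
      if "m \<lhd> om" "n = suc m" for Q
      using model_assignment[OF M suc_om[OF that(1)] AX(1)] that(2) unfolding bex_el by blast
    ultimately show "(m \<lhd> om \<and> n = suc m \<and> evals S (xs ! A) c n \<and> mapsto r m (xs ! A) \<and>
        (\<forall>a\<in>el M. a \<lhd> xs ! X \<longleftrightarrow> a \<lhd> xs ! A \<and>
          (\<exists>t\<in>el M. mapsto t n (xs ! A) \<and> sub r t \<and> op m a \<lhd> t \<and> op c t \<lhd> S))) \<longleftrightarrow>
        defby (xs ! X) (xs ! A) m n c r S"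
      unfolding defby_def by (simp cong: conj_cong)
  qed
  also have "\<dots> \<longleftrightarrow> defsub (xs ! X) (xs ! A)"
  proof
    assume "defsub (xs ! X) (xs ! A)"
    then obtain m n c r S where d: "defby (xs ! X) (xs ! A) m n c r S" unfolding defsub_def by blast
    from defby_model[OF M AX(1) d] obtain T where "T \<lhd> M" "defby (xs ! X) (xs ! A) m n c r T" by blast
    then show "\<exists>m\<in>el M. \<exists>n\<in>el M. \<exists>c\<in>el M. \<exists>r\<in>el M. \<exists>S\<in>el M. defby (xs ! X) (xs ! A) m n c r S"
      using defby_model[OF M AX(1) d] unfolding bex_el by blast
  next
    assume "\<exists>m\<in>el M. \<exists>n\<in>el M. \<exists>c\<in>el M. \<exists>r\<in>el M. \<exists>S\<in>el M. defby (xs ! X) (xs ! A) m n c r S"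
    then show "defsub (xs ! X) (xs ! A)" unfolding defsub_def by blast
  qed
  finally show ?thesis .
qed

lemma absU_definable: "X < length xs \<Longrightarrow> A < length xs \<Longrightarrow>
    holds UNIV e xs (is_definable_subset X A) \<longleftrightarrow> defsub (xs ! X) (xs ! A)"
  by (simp add: is_definable_subset_def defsub_def defby_def absU_evaluates abs nth_append)

text \<open>All definable subsets of \<open>A\<close> lie in \<open>M\<close>, so separating them
  from the power set of \<open>M\<close> loses none.\<close>

lemma isDef_model:
  assumes M: "model M" and A: "A \<lhd> M" and Y: "isDef A Y"
  shows "Y \<lhd> M"
proof -
  obtain p where p: "p \<lhd> M" "\<And>z. z \<lhd> p \<longleftrightarrow> z \<lhd> M \<and> sub z A" using model_power[OF M A] by metis
  obtain Z where Z: "Z \<lhd> M" "\<And>X. X \<lhd> Z \<longleftrightarrow> X \<lhd> p \<and> defsub X A"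
    using separationI[OF M _ _ p(1), of "[A]" "is_definable_subset 1 0" "\<lambda>X. defsub X A"] A
    by (auto simp: abs model_tr M)
  have "sub X A" if "defsub X A" for X
    using that unfolding defsub_def defby_def sub_def by blast
  then have "Z = Y"
    by (intro ext) (use Z(2) p(2) Y defsub_model[OF M A] in \<open>unfold isDef_def, blast\<close>)
  with Z(1) show ?thesis by simp
qed

subsection \<open>The constructible hierarchy in models\<close>

lemma abs_Def [abs]:
  assumes M: "model M" and xs: "ok (el M) xs" and l: "A < length xs" "Y < length xs"
  shows "holds (el M) e xs (is_Def A Y) \<longleftrightarrow> isDef (xs ! A) (xs ! Y)"
proof -
  have "holds (el M) e xs (is_Def A Y) \<longleftrightarrow> (\<forall>X\<in>el M. X \<lhd> xs ! Y \<longleftrightarrow> defsub X (xs ! A))"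
    using xs l by (simp add: is_Def_def abs M nth_append)
  also have "\<dots> \<longleftrightarrow> isDef (xs ! A) (xs ! Y)"
    using defsub_model[OF M] ok_mem[OF xs l(2)] ok_nth[OF xs l(1)]
    unfolding isDef_def ball_el mem_el by blast
  finally show ?thesis .
qed

lemma absU_Def: "A < length xs \<Longrightarrow> Y < length xs \<Longrightarrow>
    holds UNIV e xs (is_Def A Y) \<longleftrightarrow> isDef (xs ! A) (xs ! Y)"
  by (simp add: is_Def_def isDef_def absU_definable nth_append)

lemma isDef_unique: "isDef A Y \<Longrightarrow> isDef A Z \<Longrightarrow> Y = Z"
  unfolding isDef_def by (intro ext) simp

definition Lstep :: "'a \<Rightarrow> 'a \<Rightarrow> 'a \<Rightarrow> bool" where
  "Lstep f \<beta> y \<longleftrightarrow> (\<beta> = zero \<longrightarrow> y = zero) \<and> (\<forall>\<gamma> z. \<beta> = suc \<gamma> \<and> op \<gamma> z \<lhd> f \<longrightarrow> isDef z y) \<and>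
     (limit \<beta> \<longrightarrow> (\<forall>x. x \<lhd> y \<longleftrightarrow> (\<exists>\<gamma> z. \<gamma> \<lhd> \<beta> \<and> op \<gamma> z \<lhd> f \<and> x \<lhd> z)))"
definition Lseq :: "'a \<Rightarrow> 'a \<Rightarrow> bool" where
  "Lseq f \<alpha> \<longleftrightarrow> ord \<alpha> \<and> isfun f \<alpha> \<and> (\<forall>\<beta> y. \<beta> \<lhd> \<alpha> \<and> op \<beta> y \<lhd> f \<longrightarrow> Lstep f \<beta> y)"

lemma abs_L_hierarchy [abs]:
  assumes M: "model M" and xs: "ok (el M) xs" and l: "f < length xs" "\<alpha> < length xs"
  shows "holds (el M) e xs (is_L_hierarchy f \<alpha>) \<longleftrightarrow> Lseq (xs ! f) (xs ! \<alpha>)"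
proof -
  let ?f = "xs ! f" and ?\<alpha> = "xs ! \<alpha>"
  have f: "\<gamma> \<lhd> M \<and> z \<lhd> M" if "op \<gamma> z \<lhd> ?f" for \<gamma> z
    using op_ok[OF xs l(1) that] by simp
  have "holds (el M) e xs (is_L_hierarchy f \<alpha>) \<longleftrightarrow> ord ?\<alpha> \<and> isfun ?f ?\<alpha> \<and>
     (\<forall>\<beta>\<in>el M. \<forall>y\<in>el M. \<beta> \<lhd> ?\<alpha> \<and> op \<beta> y \<lhd> ?f \<longrightarrow>
       (\<beta> = zero \<longrightarrow> y = zero) \<and>
       (\<forall>\<gamma>\<in>el M. \<forall>z\<in>el M. \<beta> = suc \<gamma> \<and> op \<gamma> z \<lhd> ?f \<longrightarrow> isDef z y) \<and>
       (limit \<beta> \<longrightarrow> (\<forall>x\<in>el M. x \<lhd> y \<longleftrightarrow> (\<exists>\<gamma>\<in>el M. \<exists>z\<in>el M. \<gamma> \<lhd> \<beta> \<and> op \<gamma> z \<lhd> ?f \<and> x \<lhd> z))))"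
    using xs l by (simp add: is_L_hierarchy_def abs M nth_append cong del: imp_cong)
  also have "\<dots> \<longleftrightarrow> ord ?\<alpha> \<and> isfun ?f ?\<alpha> \<and>
     (\<forall>\<beta>\<in>el M. \<forall>y\<in>el M. \<beta> \<lhd> ?\<alpha> \<and> op \<beta> y \<lhd> ?f \<longrightarrow> Lstep ?f \<beta> y)"
  proof (intro conj_cong ball_cong imp_cong refl)
    fix \<beta> y assume "y \<in> el M"
    have 1: "(\<forall>\<gamma>\<in>el M. \<forall>z\<in>el M. \<beta> = suc \<gamma> \<and> op \<gamma> z \<lhd> ?f \<longrightarrow> isDef z y) \<longleftrightarrow>
        (\<forall>\<gamma> z. \<beta> = suc \<gamma> \<and> op \<gamma> z \<lhd> ?f \<longrightarrow> isDef z y)"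
      using f unfolding ball_el by blast
    have 2: "(\<exists>\<gamma>\<in>el M. \<exists>z\<in>el M. \<gamma> \<lhd> \<beta> \<and> op \<gamma> z \<lhd> ?f \<and> x \<lhd> z) \<longleftrightarrow> (\<exists>\<gamma> z. \<gamma> \<lhd> \<beta> \<and> op \<gamma> z \<lhd> ?f \<and> x \<lhd> z)" for x
      using f unfolding bex_el by blast
    have 3: "(\<forall>x\<in>el M. x \<lhd> y \<longleftrightarrow> (\<exists>\<gamma> z. \<gamma> \<lhd> \<beta> \<and> op \<gamma> z \<lhd> ?f \<and> x \<lhd> z)) \<longleftrightarrow>
        (\<forall>x. x \<lhd> y \<longleftrightarrow> (\<exists>\<gamma> z. \<gamma> \<lhd> \<beta> \<and> op \<gamma> z \<lhd> ?f \<and> x \<lhd> z))"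
    proof -
      have "x \<lhd> M" if "x \<lhd> y" for x using model_mem[OF M _ that] \<open>y \<in> el M\<close> by simp
      moreover have "x \<lhd> M" if "op \<gamma> z \<lhd> ?f" "x \<lhd> z" for \<gamma> z x
        using model_mem[OF M _ that(2)] f[OF that(1)] by simp
      ultimately show ?thesis unfolding ball_el by blast
    qed
    show "((\<beta> = zero \<longrightarrow> y = zero) \<and>
       (\<forall>\<gamma>\<in>el M. \<forall>z\<in>el M. \<beta> = suc \<gamma> \<and> op \<gamma> z \<lhd> ?f \<longrightarrow> isDef z y) \<and>
       (limit \<beta> \<longrightarrow> (\<forall>x\<in>el M. x \<lhd> y \<longleftrightarrow> (\<exists>\<gamma>\<in>el M. \<exists>z\<in>el M. \<gamma> \<lhd> \<beta> \<and> op \<gamma> z \<lhd> ?f \<and> x \<lhd> z)))) =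
      Lstep ?f \<beta> y" unfolding Lstep_def 1 2 3 ..
  qed
  also have "\<dots> \<longleftrightarrow> Lseq ?f ?\<alpha>"
    unfolding Lseq_def ball_el using f by blast
  finally show ?thesis .
qed

lemma absU_L_hierarchy: "f < length xs \<Longrightarrow> \<alpha> < length xs \<Longrightarrow>
    holds UNIV e xs (is_L_hierarchy f \<alpha>) \<longleftrightarrow> Lseq (xs ! f) (xs ! \<alpha>)"
  by (simp add: is_L_hierarchy_def Lseq_def Lstep_def absU_Def abs nth_append)

lemma Lstep_unique:
  assumes "ord \<gamma>" "Lstep f \<gamma> u" "Lstep g \<gamma> v"
    and eq: "\<And>\<delta> w. \<delta> \<lhd> \<gamma> \<Longrightarrow> op \<delta> w \<lhd> f \<longleftrightarrow> op \<delta> w \<lhd> g" and ex: "\<And>\<delta>. \<delta> \<lhd> \<gamma> \<Longrightarrow> \<exists>w. op \<delta> w \<lhd> f"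
  shows "u = v"
  using ord_cases[OF assms(1)]
proof (elim disjE exE conjE)
  assume "\<gamma> = zero"
  then show ?thesis using assms(2,3) by (simp add: Lstep_def)
next
  fix \<delta> assume d: "\<delta> \<lhd> \<gamma>" "\<gamma> = suc \<delta>"
  then obtain w where "op \<delta> w \<lhd> f" "op \<delta> w \<lhd> g" using ex eq by blast
  with d assms(2,3) have "isDef w u" "isDef w v" unfolding Lstep_def by blast+
  then show ?thesis by (rule isDef_unique)
next
  assume "limit \<gamma>"
  then have "x \<lhd> u \<longleftrightarrow> (\<exists>\<delta> z. \<delta> \<lhd> \<gamma> \<and> op \<delta> z \<lhd> f \<and> x \<lhd> z)" "x \<lhd> v \<longleftrightarrow> (\<exists>\<delta> z. \<delta> \<lhd> \<gamma> \<and> op \<delta> z \<lhd> g \<and> x \<lhd> z)" for x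
    using assms(2,3) by (auto simp: Lstep_def)
  with eq show ?thesis by (intro ext) blast
qed

text \<open>At a least point of disagreement the earlier values coincide, and they determine the
  next value. The set of disagreements is separated in a model \<open>N\<close>.\<close>

lemma Lseq_unique:
  assumes h: "Lseq h \<alpha>" and z: "Lseq z \<beta>" and sub: "sub \<beta> \<alpha>"
  shows "isrestr h \<beta> z"
proof -
  have fn: "isfun h \<alpha>" "isfun z \<beta>" and ord: "ord \<beta>" using h z by (auto simp: Lseq_def)
  obtain N where N: "model N" "set [h, z, \<beta>] \<subseteq> el N" using ex_model_list by blast
  have hN: "x \<lhd> N \<and> y \<lhd> N" if "op x y \<lhd> h" for x y
    using model_op_mem[OF N(1) _ that] N(2) by auto
  have zN: "x \<lhd> N \<and> y \<lhd> N" if "op x y \<lhd> z" for x y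
    using model_op_mem[OF N(1) _ that] N(2) by auto
  obtain b where b: "\<And>\<gamma>. \<gamma> \<lhd> b \<longleftrightarrow> \<gamma> \<lhd> \<beta> \<and> (\<exists>u\<in>el N. \<exists>v\<in>el N. op \<gamma> u \<lhd> z \<and> op \<gamma> v \<lhd> h \<and> u \<noteq> v)"
    using separationI[OF N(1), of "[h, z]" \<beta> "\<^bold>\<exists>u. \<^bold>\<exists>v. app 1 2 u \<^bold>\<and> app 0 2 v \<^bold>\<and> \<^bold>\<not> u \<^bold>= v"
      "\<lambda>\<gamma>. \<exists>u\<in>el N. \<exists>v\<in>el N. op \<gamma> u \<lhd> z \<and> op \<gamma> v \<lhd> h \<and> u \<noteq> v"] N(2)
    by (auto simp: abs model_tr N(1))
  have eq: "u = v" if uv: "op \<gamma> u \<lhd> z" "op \<gamma> v \<lhd> h" for \<gamma> u v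
  proof (rule ccontr)
    assume "u \<noteq> v"
    with uv hN zN isfun_mem[OF fn(2)] have "\<gamma> \<lhd> b" unfolding b bex_el by blast
    then obtain m where m: "m \<lhd> b" "\<forall>x. x \<lhd> m \<longrightarrow> \<not> x \<lhd> b" using foundation by blast
    then obtain u v where uv: "m \<lhd> \<beta>" "op m u \<lhd> z" "op m v \<lhd> h" "u \<noteq> v" unfolding b by blast
    have mem: "\<delta> \<lhd> \<beta>" if "\<delta> \<lhd> m" for \<delta> using ord_tr[OF ord uv(1) that] .
    have same: "w = w'" if "\<delta> \<lhd> m" "op \<delta> w \<lhd> z" "op \<delta> w' \<lhd> h" for \<delta> w w'
    proof (rule ccontr)
      assume "w \<noteq> w'"
      with that mem hN zN have "\<delta> \<lhd> b" unfolding b bex_el by blast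
      with m(2) that(1) show False by blast
    qed
    have ex: "\<exists>w. op \<delta> w \<lhd> z" "\<exists>w. op \<delta> w \<lhd> h" if "\<delta> \<lhd> m" for \<delta>
      using isfun_ex fn mem[OF that] sub unfolding sub_def by blast+
    have "u = v"
    proof (rule Lstep_unique)
      show "ord m" using ord_mem[OF ord uv(1)] .
      show "Lstep z m u" using z uv unfolding Lseq_def by blast
      show "Lstep h m v" using h uv sub unfolding Lseq_def sub_def by blast
      show "op \<delta> w \<lhd> z \<longleftrightarrow> op \<delta> w \<lhd> h" if "\<delta> \<lhd> m" for \<delta> w
        using ex[OF that] same[OF that] by metis
      show "\<exists>w. op \<delta> w \<lhd> z" if "\<delta> \<lhd> m" for \<delta> using ex[OF that] by blast
    qed
    with uv(4) show False ..
  qed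
  have "op x y \<lhd> z \<longleftrightarrow> op x y \<lhd> h \<and> x \<lhd> \<beta>" for x y
  proof
    assume xy: "op x y \<lhd> z"
    then have x: "x \<lhd> \<beta>" using isfun_mem[OF fn(2)] by blast
    with sub obtain w where "op x w \<lhd> h" using isfun_ex[OF fn(1)] unfolding sub_def by blast
    with eq[OF xy this] x show "op x y \<lhd> h \<and> x \<lhd> \<beta>" by simp
  next
    assume xy: "op x y \<lhd> h \<and> x \<lhd> \<beta>"
    then obtain w where "op x w \<lhd> z" using isfun_ex[OF fn(2)] by blast
    with eq[OF this] xy show "op x y \<lhd> z" by auto
  qed
  moreover have "\<exists>x y. p = op x y" if "p \<lhd> z" for p
    using fn(2) that unfolding isfun_def by blast
  ultimately show ?thesis unfolding isrestr_def by (metis isfun_mem fn(2))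
qed

lemma Lseq_restr:
  assumes h: "Lseq h \<alpha>" and b: "\<beta> \<lhd> \<alpha>" and g: "isrestr h \<beta> g"
  shows "Lseq g \<beta>"
proof -
  have ord: "ord \<alpha>" and fn: "isfun h \<alpha>" using h by (auto simp: Lseq_def)
  have ob: "ord \<beta>" using ord_mem[OF ord b] .
  have mem: "x \<lhd> \<alpha>" if "x \<lhd> \<beta>" for x using ord_tr[OF ord b that] .
  note op = isrestr_op[OF g]
  have "isfun g \<beta>"
  proof (rule isfunI)
    fix p assume "p \<lhd> g"
    then show "\<exists>x y. x \<lhd> \<beta> \<and> p = op x y" using g unfolding isrestr_def by blast
  next
    fix x assume "x \<lhd> \<beta>"
    then show "\<exists>y. op x y \<lhd> g" using isfun_ex[OF fn mem] unfolding op by blast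
  next
    fix x y z assume "op x y \<lhd> g" "op x z \<lhd> g"
    then show "y = z" using isfun_unique[OF fn] unfolding op by blast
  qed
  moreover have "Lstep g \<gamma> y" if "\<gamma> \<lhd> \<beta>" "op \<gamma> y \<lhd> g" for \<gamma> y
  proof -
    have "Lstep h \<gamma> y" using h that mem unfolding Lseq_def op by blast
    moreover have "op \<delta> z \<lhd> g \<longleftrightarrow> op \<delta> z \<lhd> h" if "\<delta> \<lhd> \<gamma>" for \<delta> z
      unfolding op using ord_tr[OF ob \<open>\<gamma> \<lhd> \<beta>\<close> that] by blast
    moreover have "\<delta> \<lhd> \<gamma>" if "\<gamma> = suc \<delta>" for \<delta> using that by simp
    ultimately show ?thesis unfolding Lstep_def by (metis (no_types, lifting))
  qed
  ultimately show ?thesis using ob unfolding Lseq_def by blast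
qed

text \<open>Advances from the earlier values to the value at \<open>\<gamma>\<close>, using closure
  of \<open>M\<close> under definable power sets and under unions of sequences.\<close>

lemma Lseq_value:
  assumes M: "model M" and h: "Lseq h \<alpha>" and c: "\<gamma> \<lhd> \<alpha>" "\<gamma> \<lhd> M"
    and g: "isrestr h \<gamma> g" "g \<lhd> M" and y: "op \<gamma> y \<lhd> h"
  shows "y \<lhd> M"
proof -
  have ord: "ord \<alpha>" and fn: "isfun h \<alpha>" using h by (auto simp: Lseq_def)
  have st: "Lstep h \<gamma> y" using h c y unfolding Lseq_def by blast
  note op = isrestr_op[OF g(1)]
  have gM: "x \<lhd> M \<and> z \<lhd> M" if "op x z \<lhd> g" for x z
    using model_mem[OF M g(2) that] model_op_iff[OF M] by blast
  show ?thesis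
    using ord_cases[OF ord_mem[OF ord c(1)]]
  proof (elim disjE exE conjE)
    assume "\<gamma> = zero"
    then show ?thesis using st model_zero[OF M] by (simp add: Lstep_def)
  next
    fix \<delta> assume d: "\<delta> \<lhd> \<gamma>" "\<gamma> = suc \<delta>"
    then obtain w where w: "op \<delta> w \<lhd> h" using isfun_ex[OF fn ord_tr[OF ord c(1) d(1)]] by blast
    then have "w \<lhd> M" using gM[of \<delta> w] d(1) unfolding op by blast
    moreover have "isDef w y" using st d w unfolding Lstep_def by blast
    ultimately show ?thesis by (rule isDef_model[OF M])
  next
    assume l: "limit \<gamma>"
    \<comment> \<open>Two unions lead from \<open>g\<close> through its Kuratowski pairs to the
      values, a third one to their elements.\<close>
    let ?U = "un (un (un g))"
    have U: "?U \<lhd> M" using model_un[OF M] g(2) by blast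
    obtain Y where Y: "Y \<lhd> M" "\<And>x. x \<lhd> Y \<longleftrightarrow> x \<lhd> ?U \<and> (\<exists>\<delta>\<in>el M. \<exists>z\<in>el M. \<delta> \<lhd> \<gamma> \<and> op \<delta> z \<lhd> g \<and> x \<lhd> z)"
      using separationI[OF M _ _ U, of "[g, \<gamma>]" "\<^bold>\<exists>\<delta>. \<^bold>\<exists>z. \<delta> \<^bold>\<in> 1 \<^bold>\<and> app 0 \<delta> z \<^bold>\<and> 2 \<^bold>\<in> z"
        "\<lambda>x. \<exists>\<delta>\<in>el M. \<exists>z\<in>el M. \<delta> \<lhd> \<gamma> \<and> op \<delta> z \<lhd> g \<and> x \<lhd> z"] g(2) c(2)
      by (auto simp: abs model_tr M)
    have "x \<lhd> ?U" if "op \<delta> z \<lhd> g" "x \<lhd> z" for x \<delta> z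
    proof -
      have "up \<delta> z \<lhd> op \<delta> z" by (simp add: op_def)
      with that(1) have "up \<delta> z \<lhd> un g" by auto
      moreover have "z \<lhd> up \<delta> z" by simp
      ultimately have "z \<lhd> un (un g)" unfolding un[of _ "un g"] by blast
      with that(2) show ?thesis unfolding un[of _ "un (un g)"] by blast
    qed
    then have "x \<lhd> Y \<longleftrightarrow> (\<exists>\<delta> z. \<delta> \<lhd> \<gamma> \<and> op \<delta> z \<lhd> h \<and> x \<lhd> z)" for x
      using gM unfolding Y bex_el op by blast
    moreover have "x \<lhd> y \<longleftrightarrow> (\<exists>\<delta> z. \<delta> \<lhd> \<gamma> \<and> op \<delta> z \<lhd> h \<and> x \<lhd> z)" for x
      using st l by (simp add: Lstep_def)
    ultimately have "Y = y" by (intro ext) simp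
    with Y(1) show ?thesis by simp
  qed
qed

text \<open>Being the hierarchy of length \<open>\<gamma>\<close> is absolute and unique, so
  replacement in \<open>M\<close> collects the shorter hierarchies, and their union is the
  restriction to \<open>\<beta>\<close>.\<close>

lemma Lseq_limit_restr:
  assumes M: "model M" and h: "Lseq h \<alpha>" and \<beta>: "\<beta> \<lhd> \<alpha>" "\<beta> \<lhd> M" "limit \<beta>"
    and less: "\<And>\<gamma>. \<gamma> \<lhd> \<beta> \<Longrightarrow> \<exists>g. g \<lhd> M \<and> isrestr h \<gamma> g"
  shows "\<exists>g. g \<lhd> M \<and> isrestr h \<beta> g"
proof -
  have ord: "ord \<alpha>" and fn: "isfun h \<alpha>" using h by (auto simp: Lseq_def)
  have mem: "\<gamma> \<lhd> \<alpha>" if "\<gamma> \<lhd> \<beta>" for \<gamma> using ord_tr[OF ord \<beta>(1) that] .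
  have \<beta>M: "\<gamma> \<lhd> M" if "\<gamma> \<lhd> \<beta>" for \<gamma> using model_mem[OF M \<beta>(2) that] .
  have sub\<alpha>: "sub \<gamma> \<alpha>" if "\<gamma> \<lhd> \<beta>" for \<gamma> using ord_tr[OF ord mem[OF that]] unfolding sub_def by blast
  have uniq: "\<exists>y. y \<lhd> M \<and> (\<forall>z. z \<lhd> M \<longrightarrow> (Lseq z \<gamma> \<longleftrightarrow> z = y))" if \<gamma>: "\<gamma> \<lhd> \<beta>" for \<gamma>
  proof -
    obtain g where g: "g \<lhd> M" "isrestr h \<gamma> g" using less[OF \<gamma>] by blast
    have "z = g" if "Lseq z \<gamma>" for z
      using Lseq_unique[OF h that sub\<alpha>[OF \<gamma>]] g(2) unfolding isrestr_def by (intro ext) simp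
    with g Lseq_restr[OF h mem[OF \<gamma>] g(2)] show ?thesis by blast
  qed
  have "\<exists>b. b \<lhd> M \<and> (\<forall>x. x \<lhd> \<beta> \<longrightarrow> (\<exists>z. z \<lhd> b \<and> Lseq z x))"
  proof (rule replacementI[OF M _ _ \<beta>(2) _ uniq])
    show "holds (el M) (\<lambda>_. hd [\<beta>]) ([\<beta>] @ [x, z]) (is_L_hierarchy 2 1) \<longleftrightarrow> Lseq z x"
      if "x \<lhd> \<beta>" "x \<lhd> M" "z \<lhd> M" for x z
      using \<beta>(2) that by (simp add: abs M model_tr)
  qed (use \<beta>(2) in auto)
  then obtain b where b: "b \<lhd> M" and b2: "\<And>x. x \<lhd> \<beta> \<Longrightarrow> \<exists>z. z \<lhd> b \<and> Lseq z x" by blast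
  \<comment> \<open>Replacement only gives a set \<open>b\<close> including the range, so the
    genuine hierarchies in it must be selected before taking the union.\<close>
  obtain G where G: "G \<lhd> M" "\<And>p. p \<lhd> G \<longleftrightarrow> p \<lhd> un b \<and> (\<exists>x\<in>el M. x \<lhd> \<beta> \<and> (\<exists>z\<in>el M. z \<lhd> b \<and> Lseq z x \<and> p \<lhd> z))"
    using separationI[OF M _ _ model_un[OF M b], of "[b, \<beta>]"
      "\<^bold>\<exists>x. x \<^bold>\<in> 1 \<^bold>\<and> (\<^bold>\<exists>z. z \<^bold>\<in> 0 \<^bold>\<and> is_L_hierarchy z x \<^bold>\<and> 2 \<^bold>\<in> z)"
      "\<lambda>p. \<exists>x\<in>el M. x \<lhd> \<beta> \<and> (\<exists>z\<in>el M. z \<lhd> b \<and> Lseq z x \<and> p \<lhd> z)"] b \<beta>(2)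
    by (auto simp: abs model_tr M)
  have "p \<lhd> G \<longleftrightarrow> (\<exists>x z. x \<lhd> \<beta> \<and> z \<lhd> b \<and> Lseq z x \<and> p \<lhd> z)" for p
    unfolding G bex_el un using \<beta>M model_mem[OF M b] by blast
  note G2 = this
  have "p \<lhd> G \<longleftrightarrow> p \<lhd> h \<and> (\<exists>x y. x \<lhd> \<beta> \<and> p = op x y)" for p
  proof
    assume "p \<lhd> G"
    then obtain x z where x: "x \<lhd> \<beta>" "Lseq z x" "p \<lhd> z" unfolding G2 by blast
    from Lseq_unique[OF h x(2) sub\<alpha>[OF x(1)]] x(3)
    obtain u v where "p \<lhd> h" "u \<lhd> x" "p = op u v" unfolding isrestr_def by blast
    moreover have "u \<lhd> \<beta>" using ord_tr[OF ord_mem[OF ord \<beta>(1)] x(1) \<open>u \<lhd> x\<close>] .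
    ultimately show "p \<lhd> h \<and> (\<exists>x y. x \<lhd> \<beta> \<and> p = op x y)" by blast
  next
    assume "p \<lhd> h \<and> (\<exists>x y. x \<lhd> \<beta> \<and> p = op x y)"
    then obtain x y where p: "p \<lhd> h" "x \<lhd> \<beta>" "p = op x y" by blast
    \<comment> \<open>The pair at \<open>x\<close> occurs only in hierarchies longer than
      \<open>x\<close>; as \<open>\<beta>\<close> is a limit, there is one among those
      collected.\<close>
    then obtain x' where x': "x' \<lhd> \<beta>" "x \<lhd> x'" using \<beta>(3) unfolding limit_def by blast
    obtain z where z: "z \<lhd> b" "Lseq z x'" using b2[OF x'(1)] by blast
    have "p \<lhd> z" using Lseq_unique[OF h z(2) sub\<alpha>[OF x'(1)]] p x'(2) unfolding isrestr_def by blast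
    with z x'(1) show "p \<lhd> G" unfolding G2 by blast
  qed
  with G(1) show ?thesis unfolding isrestr_def by blast
qed

text \<open>The hierarchy \<open>h\<close> need not be given in \<open>M\<close>, only its length. A
  least \<open>m\<close> whose restriction is missing from \<open>M\<close> is refuted in each of
  the cases zero, successor and limit.\<close>

lemma Lseq_model:
  assumes M: "model M" and h: "Lseq h \<alpha>" and \<alpha>: "\<alpha> \<lhd> M" and y: "op \<beta> y \<lhd> h"
  shows "y \<lhd> M"
proof -
  have ord: "ord \<alpha>" and fn: "isfun h \<alpha>" using h by (auto simp: Lseq_def)
  have \<alpha>M: "\<gamma> \<lhd> M" if "\<gamma> \<lhd> \<alpha>" for \<gamma> using model_mem[OF M \<alpha> that] .
  obtain N where N: "model N" "set [h, M, \<alpha>] \<subseteq> el N" using ex_model_list by blast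
  obtain b where b: "\<And>\<gamma>. \<gamma> \<lhd> b \<longleftrightarrow> \<gamma> \<lhd> \<alpha> \<and> \<not> (\<exists>g\<in>el N. g \<lhd> M \<and> isrestr h \<gamma> g)"
    using separationI[OF N(1), of "[h, M]" \<alpha> "\<^bold>\<not> (\<^bold>\<exists>g. g \<^bold>\<in> 1 \<^bold>\<and> is_restr 0 2 g)"
      "\<lambda>\<gamma>. \<not> (\<exists>g\<in>el N. g \<lhd> M \<and> isrestr h \<gamma> g)"] N(2)
    by (auto simp: abs model_tr N(1))
  have b: "\<gamma> \<lhd> b \<longleftrightarrow> \<gamma> \<lhd> \<alpha> \<and> \<not> (\<exists>g. g \<lhd> M \<and> isrestr h \<gamma> g)" for \<gamma>
    using b model_mem[OF N(1), of M] N(2) by auto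
  have all: "\<exists>g. g \<lhd> M \<and> isrestr h \<gamma> g" if \<gamma>: "\<gamma> \<lhd> \<alpha>" for \<gamma>
  proof (rule ccontr)
    assume "\<not> ?thesis"
    with \<gamma> have "\<gamma> \<lhd> b" unfolding b by blast
    then obtain m where m: "m \<lhd> b" "\<forall>x. x \<lhd> m \<longrightarrow> \<not> x \<lhd> b" using foundation by blast
    then have m\<alpha>: "m \<lhd> \<alpha>" and no: "\<not> (\<exists>g. g \<lhd> M \<and> isrestr h m g)" unfolding b by auto
    have less: "\<exists>g. g \<lhd> M \<and> isrestr h \<delta> g" if "\<delta> \<lhd> m" for \<delta>
      using m(2) that ord_tr[OF ord m\<alpha> that] unfolding b by blast
    from ord_cases[OF ord_mem[OF ord m\<alpha>]] have "\<exists>g. g \<lhd> M \<and> isrestr h m g"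
    proof (elim disjE exE conjE)
      assume "m = zero"
      then have "isrestr h m zero" by (simp add: isrestr_def)
      then show ?thesis using model_zero[OF M] by blast
    next
      fix \<delta> assume d: "\<delta> \<lhd> m" "m = suc \<delta>"
      have d\<alpha>: "\<delta> \<lhd> \<alpha>" using ord_tr[OF ord m\<alpha> d(1)] .
      obtain g where g: "g \<lhd> M" "isrestr h \<delta> g" using less[OF d(1)] by blast
      obtain w where w: "op \<delta> w \<lhd> h" using isfun_ex[OF fn d\<alpha>] by blast
      have "w \<lhd> M" using Lseq_value[OF M h d\<alpha> \<alpha>M[OF d\<alpha>] g(2,1) w] .
      then have "cup g (up (op \<delta> w) (op \<delta> w)) \<lhd> M"
        using g(1) \<alpha>M[OF d\<alpha>] by (simp add: M model_cup model_up model_op)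
      with isrestr_suc[OF g(2) fn w] d(2) show ?thesis by blast
    next
      assume "limit m"
      then show ?thesis using Lseq_limit_restr[OF M h m\<alpha> \<alpha>M[OF m\<alpha>] _ less] by blast
    qed
    with no show False ..
  qed
  have "\<beta> \<lhd> \<alpha>" using isfun_mem[OF fn y] .
  with all obtain g where "g \<lhd> M" "isrestr h \<beta> g" by blast
  with Lseq_value[OF M h \<open>\<beta> \<lhd> \<alpha>\<close> \<alpha>M[OF \<open>\<beta> \<lhd> \<alpha>\<close>] _ _ y] show ?thesis by blast
qed

subsection \<open>Injections\<close>

lemma ex_inverse:
  assumes F: "isfun F a" "injective F" and y: "\<And>z. z \<lhd> y \<longleftrightarrow> (\<exists>x. op x z \<lhd> F)"
  shows "\<exists>g. mapsto g y a \<and> injective g"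
proof -
  obtain c where c: "\<And>p. p \<lhd> c \<longleftrightarrow> (\<exists>z x. z \<lhd> y \<and> x \<lhd> a \<and> p = op z x)" using ex_prod by metis
  obtain N where N: "model N" "set [F, c] \<subseteq> el N" using ex_model_list by blast
  have FN: "x \<lhd> N \<and> z \<lhd> N" if "op x z \<lhd> F" for x z
    using model_op_mem[OF N(1) _ that] N(2) by auto
  obtain g where g: "\<And>p. p \<lhd> g \<longleftrightarrow> p \<lhd> c \<and> (\<exists>z\<in>el N. \<exists>x\<in>el N. p = op z x \<and> op x z \<lhd> F)"
    using separationI[OF N(1), of "[F]" c "\<^bold>\<exists>z. \<^bold>\<exists>x. is_pair z x 1 \<^bold>\<and> app 0 x z"
      "\<lambda>p. \<exists>z\<in>el N. \<exists>x\<in>el N. p = op z x \<and> op x z \<lhd> F"] N(2)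
    by (auto simp: abs model_tr N(1))
  have gF: "op z x \<lhd> g \<longleftrightarrow> op x z \<lhd> F" for z x
    using FN isfun_mem[OF F(1)] unfolding g c bex_el y by auto
  have "isfun g y"
  proof (rule isfunI)
    fix p assume "p \<lhd> g"
    then show "\<exists>z x. z \<lhd> y \<and> p = op z x" unfolding g c by blast
  next
    fix z assume "z \<lhd> y"
    then show "\<exists>x. op z x \<lhd> g" unfolding gF y .
  next
    fix z x x' assume "op z x \<lhd> g" "op z x' \<lhd> g"
    then show "x = x'" using F(2) unfolding gF injective_def by blast
  qed
  moreover have "injective g"
    unfolding injective_def gF using isfun_unique[OF F(1)] by blast
  moreover have "x \<lhd> a" if "op z x \<lhd> g" for z x
    using that isfun_mem[OF F(1)] unfolding gF by blast
  ultimately show ?thesis unfolding mapsto_def by blast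
qed

lemma ex_comp:
  assumes f: "mapsto f a b" "injective f" and g: "mapsto g b c" "injective g"
  shows "\<exists>h. mapsto h a c \<and> injective h"
proof -
  obtain d where d: "\<And>p. p \<lhd> d \<longleftrightarrow> (\<exists>x z. x \<lhd> a \<and> z \<lhd> c \<and> p = op x z)" using ex_prod by metis
  obtain N where N: "model N" "set [f, g, d] \<subseteq> el N" using ex_model_list by blast
  have fN: "x \<lhd> N \<and> z \<lhd> N" if "op x z \<lhd> f" for x z
    using model_op_mem[OF N(1) _ that] N(2) by auto
  have gN: "x \<lhd> N \<and> z \<lhd> N" if "op x z \<lhd> g" for x z
    using model_op_mem[OF N(1) _ that] N(2) by auto
  obtain h where h: "\<And>p. p \<lhd> h \<longleftrightarrow> p \<lhd> d \<and> (\<exists>x\<in>el N. \<exists>y\<in>el N. \<exists>z\<in>el N. p = op x z \<and> op x y \<lhd> f \<and> op y z \<lhd> g)"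
    using separationI[OF N(1), of "[f, g]" d "\<^bold>\<exists>x. \<^bold>\<exists>y. \<^bold>\<exists>z. is_pair x z 2 \<^bold>\<and> app 0 x y \<^bold>\<and> app 1 y z"
      "\<lambda>p. \<exists>x\<in>el N. \<exists>y\<in>el N. \<exists>z\<in>el N. p = op x z \<and> op x y \<lhd> f \<and> op y z \<lhd> g"] N(2)
    by (auto simp: abs model_tr N(1))
  have fa: "x \<lhd> a" if "op x y \<lhd> f" for x y using that f(1) isfun_mem unfolding mapsto_def by blast
  have gc: "z \<lhd> c" if "op y z \<lhd> g" for y z using that g(1) unfolding mapsto_def by blast
  have hfg: "op x z \<lhd> h \<longleftrightarrow> (\<exists>y. op x y \<lhd> f \<and> op y z \<lhd> g)" for x z
  proof -
    have "op x z \<lhd> h \<longleftrightarrow> x \<lhd> a \<and> z \<lhd> c \<and> x \<lhd> N \<and> z \<lhd> N \<and> (\<exists>y. y \<lhd> N \<and> op x y \<lhd> f \<and> op y z \<lhd> g)"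
      unfolding h d bex_el by auto
    then show ?thesis using fa gc fN gN by blast
  qed
  have "isfun h a"
  proof (rule isfunI)
    fix p assume "p \<lhd> h"
    then show "\<exists>z x. z \<lhd> a \<and> p = op z x" unfolding h d by blast
  next
    fix x assume "x \<lhd> a"
    then obtain y where y: "op x y \<lhd> f" "y \<lhd> b" using f(1) isfun_ex unfolding mapsto_def by blast
    then obtain z where "op y z \<lhd> g" using g(1) isfun_ex unfolding mapsto_def by blast
    with y show "\<exists>z. op x z \<lhd> h" unfolding hfg by blast
  next
    fix x z z' assume "op x z \<lhd> h" "op x z' \<lhd> h"
    then obtain y y' where yy: "op x y \<lhd> f" "op y z \<lhd> g" "op x y' \<lhd> f" "op y' z' \<lhd> g" unfolding hfg by blast
    have "isfun f a" "isfun g b" using f(1) g(1) by (auto simp: mapsto_def)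
    from isfun_unique[OF this(1) yy(1,3)] yy(2,4) isfun_unique[OF this(2)] show "z = z'" by simp
  qed
  moreover have "injective h"
    unfolding injective_def
  proof (intro allI impI, elim conjE)
    fix x x' z assume "op x z \<lhd> h" "op x' z \<lhd> h"
    then obtain y y' where yy: "op x y \<lhd> f" "op y z \<lhd> g" "op x' y' \<lhd> f" "op y' z \<lhd> g" unfolding hfg by blast
    then have "y = y'" using g(2) unfolding injective_def by blast
    with yy show "x = x'" using f(2) unfolding injective_def by blast
  qed
  ultimately show ?thesis unfolding mapsto_def using hfg gc by blast
qed

lemma model_identity:
  assumes M: "model M" "a \<lhd> M" "b \<lhd> M" and sub: "sub a b"
  shows "\<exists>f. f \<lhd> M \<and> mapsto f a b \<and> injective f"
proof -
  obtain d where d: "d \<lhd> M" "\<And>p. p \<lhd> d \<longleftrightarrow> (\<exists>x z. x \<lhd> a \<and> z \<lhd> a \<and> p = op x z)"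
    using model_prod[OF M(1,2,2)] by metis
  obtain f where f: "f \<lhd> M" "\<And>p. p \<lhd> f \<longleftrightarrow> p \<lhd> d \<and> (\<exists>x\<in>el M. p = op x x)"
    using separationI[OF M(1), of "[a]" d "\<^bold>\<exists>x. is_pair x x 1" "\<lambda>p. \<exists>x\<in>el M. p = op x x"] M d(1)
    by (auto simp: abs model_tr M(1))
  have op: "op x y \<lhd> f \<longleftrightarrow> x \<lhd> a \<and> y = x" for x y
    unfolding f d bex_el using model_mem[OF M(1,2)] by auto
  have "isfun f a"
  proof (rule isfunI)
    fix p assume "p \<lhd> f"
    then show "\<exists>z x. z \<lhd> a \<and> p = op z x" unfolding f d by blast
  qed (auto simp: op)
  with sub have "mapsto f a b" "injective f" unfolding mapsto_def injective_def op sub_def by blast+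
  with f(1) show ?thesis by blast
qed

text \<open>Outside the least set \<open>C\<close> that contains \<open>a - b\<close> and is closed under \<open>f\<close> take the identity,
  and inside it the inverse of \<open>f\<close>.\<close>

lemma model_Schroeder_Bernstein:
  assumes M: "model M" "f \<lhd> M" "a \<lhd> M" "b \<lhd> M" and sub: "sub b a" and f: "mapsto f a b" "injective f"
  shows "\<exists>h. h \<lhd> M \<and> mapsto h b a \<and> injective h \<and> (\<forall>z. z \<lhd> a \<longrightarrow> (\<exists>u. op u z \<lhd> h))"
proof -
  have fn: "isfun f a" and fb: "\<And>x y. op x y \<lhd> f \<Longrightarrow> y \<lhd> b" using f(1) by (auto simp: mapsto_def)
  have ba: "x \<lhd> a" if "x \<lhd> b" for x using sub that unfolding sub_def by blast
  have aM: "x \<lhd> M" if "x \<lhd> a" for x using model_mem[OF M(1,3) that] .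
  have fM: "x \<lhd> M \<and> y \<lhd> M" if "op x y \<lhd> f" for x y
    using that isfun_mem[OF fn that] fb[OF that] aM ba by blast
  obtain P where P: "P \<lhd> M" "\<And>X. X \<lhd> P \<longleftrightarrow> X \<lhd> M \<and> sub X a" using model_power[OF M(1,3)] by metis
  define cl where "cl X \<longleftrightarrow> (\<forall>z. z \<lhd> a \<and> \<not> z \<lhd> b \<longrightarrow> z \<lhd> X) \<and> (\<forall>z w. z \<lhd> X \<and> op z w \<lhd> f \<longrightarrow> w \<lhd> X)" for X
  have clM: "cl X \<longleftrightarrow> (\<forall>z\<in>el M. z \<lhd> a \<and> \<not> z \<lhd> b \<longrightarrow> z \<lhd> X) \<and> (\<forall>z\<in>el M. \<forall>w\<in>el M. z \<lhd> X \<and> op z w \<lhd> f \<longrightarrow> w \<lhd> X)" for X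
    unfolding cl_def ball_el using aM fM by blast
  have "\<exists>C. C \<lhd> M \<and> (\<forall>x. x \<lhd> C \<longleftrightarrow> x \<lhd> a \<and> (\<forall>X\<in>el M. X \<lhd> P \<and> cl X \<longrightarrow> x \<lhd> X))"
    by (rule separationI[OF M(1), of "[f, a, b, P]" a "\<^bold>\<forall>X. X \<^bold>\<in> 3 \<^bold>\<and> ((\<^bold>\<forall>z. z \<^bold>\<in> 1 \<^bold>\<and> \<^bold>\<not> z \<^bold>\<in> 2 \<^bold>\<longrightarrow> z \<^bold>\<in> X) \<^bold>\<and>
        (\<^bold>\<forall>z. \<^bold>\<forall>w. z \<^bold>\<in> X \<^bold>\<and> app 0 z w \<^bold>\<longrightarrow> w \<^bold>\<in> X)) \<^bold>\<longrightarrow> 4 \<^bold>\<in> X"])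
      (use M P(1) in \<open>simp_all add: abs model_tr clM cong del: imp_cong\<close>)
  then obtain C where C: "C \<lhd> M" "\<And>x. x \<lhd> C \<longleftrightarrow> x \<lhd> a \<and> (\<forall>X\<in>el M. X \<lhd> P \<and> cl X \<longrightarrow> x \<lhd> X)" by metis
  have C2: "x \<lhd> C \<longleftrightarrow> x \<lhd> a \<and> (\<forall>X. X \<lhd> M \<and> sub X a \<and> cl X \<longrightarrow> x \<lhd> X)" for x
    unfolding C P ball_el by blast
  have Ccl: "cl C"
    unfolding cl_def C2 using fb ba by (auto simp: cl_def)
  have Ca: "sub C a" unfolding sub_def C2 by blast
  \<comment> \<open>Otherwise \<open>C\<close> without \<open>u\<close> would still contain
    \<open>a - b\<close> and be closed under \<open>f\<close>, against the minimality of
    \<open>C\<close>.\<close>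
  have least: "\<exists>v. v \<lhd> C \<and> op v u \<lhd> f" if u: "u \<lhd> C" "u \<lhd> b" for u
  proof (rule ccontr)
    assume no: "\<not> ?thesis"
    obtain X where X: "X \<lhd> M" "\<And>x. x \<lhd> X \<longleftrightarrow> x \<lhd> C \<and> x \<noteq> u"
      using separationI[OF M(1), of "[u]" C "\<^bold>\<not> 1 \<^bold>= 0" "\<lambda>x. x \<noteq> u"] C(1) aM[OF ba[OF u(2)]]
      by auto
    have "cl X" using Ccl no u(2) unfolding cl_def X by blast
    moreover have "sub X a" using Ca unfolding sub_def X by blast
    ultimately have "u \<lhd> X" using u(1) X(1) unfolding C2 by blast
    then show False unfolding X by blast
  qed
  obtain d where d: "d \<lhd> M" "\<And>p. p \<lhd> d \<longleftrightarrow> (\<exists>u v. u \<lhd> b \<and> v \<lhd> a \<and> p = op u v)"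
    using model_prod[OF M(1,4,3)] by metis
  obtain h where h: "h \<lhd> M" "\<And>p. p \<lhd> h \<longleftrightarrow> p \<lhd> d \<and> (\<exists>u\<in>el M. \<exists>v\<in>el M. p = op u v \<and> (v \<lhd> C \<and> op v u \<lhd> f \<or> \<not> v \<lhd> C \<and> u = v))"
    using separationI[OF M(1), of "[f, C]" d "\<^bold>\<exists>u. \<^bold>\<exists>v. is_pair u v 2 \<^bold>\<and> ((v \<^bold>\<in> 1 \<^bold>\<and> app 0 v u) \<^bold>\<or> ((\<^bold>\<not> v \<^bold>\<in> 1) \<^bold>\<and> u \<^bold>= v))"
      "\<lambda>p. \<exists>u\<in>el M. \<exists>v\<in>el M. p = op u v \<and> (v \<lhd> C \<and> op v u \<lhd> f \<or> \<not> v \<lhd> C \<and> u = v)"] M C(1) d(1)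
    by (auto simp: abs model_tr M(1))
  have op: "op u v \<lhd> h \<longleftrightarrow> u \<lhd> b \<and> v \<lhd> a \<and> (v \<lhd> C \<and> op v u \<lhd> f \<or> \<not> v \<lhd> C \<and> u = v)" for u v
    unfolding h d bex_el using aM ba by auto
  have "isfun h b"
  proof (rule isfunI)
    fix p assume "p \<lhd> h"
    then show "\<exists>z x. z \<lhd> b \<and> p = op z x" unfolding h d by blast
  next
    fix u assume u: "u \<lhd> b"
    show "\<exists>v. op u v \<lhd> h"
    proof (cases "u \<lhd> C")
      case True
      with least u obtain v where "v \<lhd> C" "op v u \<lhd> f" by blast
      with u Ca show ?thesis unfolding op sub_def by blast
    next
      case False
      with u ba show ?thesis unfolding op by blast
    qed
  next
    fix u v w assume v: "op u v \<lhd> h" and w: "op u w \<lhd> h"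
    have Cf: "u \<lhd> C" if "v \<lhd> C" "op v u \<lhd> f" for v using Ccl that unfolding cl_def by blast
    have inj: "v = w" if "op v u \<lhd> f" "op w u \<lhd> f" using f(2) that unfolding injective_def by blast
    from v w show "v = w" unfolding op using Cf inj by blast
  qed
  moreover have "injective h"
    unfolding injective_def op using isfun_unique[OF fn] by blast
  moreover have "\<exists>u. op u z \<lhd> h" if z: "z \<lhd> a" for z
  proof (cases "z \<lhd> C")
    case True
    obtain u where "op z u \<lhd> f" using isfun_ex[OF fn z] by blast
    with True z fb show ?thesis unfolding op by blast
  next
    case False
    with Ccl z have "z \<lhd> b" unfolding cl_def by blast
    with False z show ?thesis unfolding op by blast
  qed
  moreover have "v \<lhd> a" if "op u v \<lhd> h" for u v using that unfolding op by blast
  ultimately show ?thesis using h(1) unfolding mapsto_def by blast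
qed

subsection \<open>The well-ordering theorem in a model\<close>

text \<open>\<open>f\<close> lists elements of \<open>y\<close>, always choosing the next one with the choice function \<open>c\<close>, whose
  domain \<open>a\<close> consists of the nonempty subsets of \<open>y\<close>.\<close>

definition good :: "'a \<Rightarrow> 'a \<Rightarrow> 'a \<Rightarrow> 'a \<Rightarrow> 'a \<Rightarrow> bool" where
  "good c a y f \<alpha> \<longleftrightarrow> ord \<alpha> \<and> isfun f \<alpha> \<and> (\<forall>\<beta> w. op \<beta> w \<lhd> f \<longrightarrow>
     (\<exists>X. X \<lhd> a \<and> (\<forall>z. z \<lhd> X \<longleftrightarrow> z \<lhd> y \<and> \<not> (\<exists>\<gamma>. \<gamma> \<lhd> \<beta> \<and> op \<gamma> z \<lhd> f)) \<and> op X w \<lhd> c))"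
definition is_good :: "nat \<Rightarrow> nat \<Rightarrow> nat \<Rightarrow> nat \<Rightarrow> nat \<Rightarrow> form" where
  "is_good c a y f \<alpha> = (is_ord \<alpha> \<^bold>\<and> is_fun f \<alpha> \<^bold>\<and> (\<^bold>\<forall>\<beta>. \<^bold>\<forall>w. app f \<beta> w \<^bold>\<longrightarrow>
     (\<^bold>\<exists>X. X \<^bold>\<in> a \<^bold>\<and> (\<^bold>\<forall>z. z \<^bold>\<in> X \<^bold>\<longleftrightarrow> z \<^bold>\<in> y \<^bold>\<and> \<^bold>\<not> (\<^bold>\<exists>\<gamma>. \<gamma> \<^bold>\<in> \<beta> \<^bold>\<and> app f \<gamma> z)) \<^bold>\<and> app c X w)))"

lemma abs_good [abs]:
  assumes xs: "ok D xs" and l: "c < length xs" "a < length xs" "y < length xs" "f < length xs" "\<alpha> < length xs"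
  shows "holds D e xs (is_good c a y f \<alpha>) \<longleftrightarrow> good (xs ! c) (xs ! a) (xs ! y) (xs ! f) (xs ! \<alpha>)"
proof -
  have tD: "trD D" using xs by (simp add: ok_def)
  have f: "\<beta> \<in> D \<and> w \<in> D" if "op \<beta> w \<lhd> xs ! f" for \<beta> w using op_ok[OF xs l(4) that] .
  have "holds D e xs (is_good c a y f \<alpha>) \<longleftrightarrow> ord (xs ! \<alpha>) \<and> isfun (xs ! f) (xs ! \<alpha>) \<and>
     (\<forall>\<beta>\<in>D. \<forall>w\<in>D. op \<beta> w \<lhd> xs ! f \<longrightarrow> (\<exists>X\<in>D. X \<lhd> xs ! a \<and>
       (\<forall>z\<in>D. z \<lhd> X \<longleftrightarrow> z \<lhd> xs ! y \<and> \<not> (\<exists>\<gamma>\<in>D. \<gamma> \<lhd> \<beta> \<and> op \<gamma> z \<lhd> xs ! f)) \<and> op X w \<lhd> xs ! c))"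
    using xs l by (simp add: is_good_def abs nth_append cong: ball_cong bex_cong)
  also have "\<dots> \<longleftrightarrow> good (xs ! c) (xs ! a) (xs ! y) (xs ! f) (xs ! \<alpha>)"
  proof -
    have 1: "(\<exists>\<gamma>\<in>D. \<gamma> \<lhd> \<beta> \<and> op \<gamma> z \<lhd> xs ! f) \<longleftrightarrow> (\<exists>\<gamma>. \<gamma> \<lhd> \<beta> \<and> op \<gamma> z \<lhd> xs ! f)" for \<beta> z
      using f by blast
    have 2: "(\<forall>z\<in>D. z \<lhd> X \<longleftrightarrow> z \<lhd> xs ! y \<and> Q z) \<longleftrightarrow> (\<forall>z. z \<lhd> X \<longleftrightarrow> z \<lhd> xs ! y \<and> Q z)" if "X \<in> D" for X Q
      using ok_mem[OF xs l(3)] trD_mem[OF tD that] by blast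
    have 3: "(\<exists>X\<in>D. X \<lhd> xs ! a \<and> (\<forall>z\<in>D. z \<lhd> X \<longleftrightarrow> z \<lhd> xs ! y \<and> Q z) \<and> R X) \<longleftrightarrow>
        (\<exists>X. X \<lhd> xs ! a \<and> (\<forall>z. z \<lhd> X \<longleftrightarrow> z \<lhd> xs ! y \<and> Q z) \<and> R X)" for Q R
      using 2 ok_mem[OF xs l(2)] by blast
    show ?thesis unfolding good_def 1 3 using f by blast
  qed
  finally show ?thesis .
qed

context
  fixes M c a y
  assumes M: "model M" and cM: "c \<lhd> M" and aM: "a \<lhd> M" and yM: "y \<lhd> M"
    and a: "\<And>X. X \<lhd> a \<longleftrightarrow> X \<lhd> M \<and> sub X y \<and> X \<noteq> zero"
    and c: "isfun c a" "\<And>X w. op X w \<lhd> c \<Longrightarrow> w \<lhd> X"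
begin

lemma good_range: "good c a y f \<alpha> \<Longrightarrow> op \<beta> w \<lhd> f \<Longrightarrow> w \<lhd> y \<and> \<beta> \<lhd> \<alpha>"
  unfolding good_def using c(2) isfun_mem by meson

lemma good_fresh: "good c a y f \<alpha> \<Longrightarrow> op \<beta> w \<lhd> f \<Longrightarrow> \<gamma> \<lhd> \<beta> \<Longrightarrow> \<not> op \<gamma> w \<lhd> f"
  unfolding good_def using c(2) by meson

lemma good_injective: 
  assumes f: "good c a y f \<alpha>" "op \<beta> w \<lhd> f" "op \<gamma> w \<lhd> f" shows "\<beta> = \<gamma>"
proof -
  have "ord \<beta>" "ord \<gamma>" using f good_range ord_mem unfolding good_def by blast+
  with ord_linear[of \<beta> \<gamma>] good_fresh f show ?thesis by blast
qed

text \<open>Before the least disagreement both lists have used the same elements, so the same set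
  remains and the choice function returns the same next element.\<close>

lemma good_agree:
  assumes f: "good c a y f \<alpha>" and g: "good c a y g \<beta>" and u: "op \<gamma> u \<lhd> f" and v: "op \<gamma> v \<lhd> g"
  shows "u = v"
proof (rule ccontr)
  assume "u \<noteq> v"
  obtain N where N: "model N" "set [f, g, \<alpha>] \<subseteq> el N" using ex_model_list by blast
  have fN: "x \<lhd> N \<and> z \<lhd> N" if "op x z \<lhd> f" for x z
    using model_op_mem[OF N(1) _ that] N(2) by auto
  have gN: "x \<lhd> N \<and> z \<lhd> N" if "op x z \<lhd> g" for x z
    using model_op_mem[OF N(1) _ that] N(2) by auto
  obtain b where b: "\<And>\<gamma>. \<gamma> \<lhd> b \<longleftrightarrow> \<gamma> \<lhd> \<alpha> \<and> (\<exists>u\<in>el N. \<exists>v\<in>el N. op \<gamma> u \<lhd> f \<and> op \<gamma> v \<lhd> g \<and> u \<noteq> v)"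
    using separationI[OF N(1), of "[f, g]" \<alpha> "\<^bold>\<exists>u. \<^bold>\<exists>v. app 0 2 u \<^bold>\<and> app 1 2 v \<^bold>\<and> \<^bold>\<not> u \<^bold>= v"
      "\<lambda>\<gamma>. \<exists>u\<in>el N. \<exists>v\<in>el N. op \<gamma> u \<lhd> f \<and> op \<gamma> v \<lhd> g \<and> u \<noteq> v"] N(2)
    by (auto simp: abs model_tr N(1))
  have fn: "isfun f \<alpha>" "isfun g \<beta>" and ord: "ord \<alpha>" "ord \<beta>" using f g by (auto simp: good_def)
  from \<open>u \<noteq> v\<close> u v fN gN isfun_mem[OF fn(1)] have "\<gamma> \<lhd> b" unfolding b bex_el by blast
  then obtain m where m: "m \<lhd> b" "\<forall>x. x \<lhd> m \<longrightarrow> \<not> x \<lhd> b" using foundation by blast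
  then obtain u v where uv: "op m u \<lhd> f" "op m v \<lhd> g" "u \<noteq> v" "m \<lhd> \<alpha>" "m \<lhd> \<beta>"
    using isfun_mem[OF fn(2)] unfolding b by blast
  have same: "op \<delta> z \<lhd> f \<longleftrightarrow> op \<delta> z \<lhd> g" if d: "\<delta> \<lhd> m" for \<delta> z
  proof -
    obtain w w' where w: "op \<delta> w \<lhd> f" "op \<delta> w' \<lhd> g"
      using isfun_ex fn ord_tr[OF ord(1) uv(4) d] ord_tr[OF ord(2) uv(5) d] by blast
    have "w = w'"
    proof (rule ccontr)
      assume "w \<noteq> w'"
      with w fN gN isfun_mem[OF fn(1)] have "\<delta> \<lhd> b" unfolding b bex_el by blast
      with m(2) d show False by blast
    qed
    with w show ?thesis using isfun_unique[OF fn(1)] isfun_unique[OF fn(2)] by blast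
  qed
  from f uv(1) obtain X where X: "\<forall>z. z \<lhd> X \<longleftrightarrow> z \<lhd> y \<and> \<not> (\<exists>\<gamma>. \<gamma> \<lhd> m \<and> op \<gamma> z \<lhd> f)" "op X u \<lhd> c"
    unfolding good_def by blast
  from g uv(2) obtain Y where Y: "\<forall>z. z \<lhd> Y \<longleftrightarrow> z \<lhd> y \<and> \<not> (\<exists>\<gamma>. \<gamma> \<lhd> m \<and> op \<gamma> z \<lhd> g)" "op Y v \<lhd> c"
    unfolding good_def by blast
  have "X = Y" using X(1) Y(1) same by (intro ext) blast
  with X(2) Y(2) isfun_unique[OF c(1)] uv(3) show False by blast
qed

text \<open>If \<open>\<alpha>\<close> were below \<open>\<beta>\<close>, the element that
  \<open>g\<close> lists at \<open>\<alpha>\<close> would occur in \<open>f\<close> at some smaller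
  position, hence by agreement also in \<open>g\<close> there, against injectivity. Thus the length
  is a function of the range.\<close>

lemma good_range_unique:
  assumes f: "good c a y f \<alpha>" and g: "good c a y g \<beta>"
    and "\<And>w. (\<exists>\<gamma>. op \<gamma> w \<lhd> f) \<longleftrightarrow> (\<exists>\<gamma>. op \<gamma> w \<lhd> g)"
  shows "\<alpha> = \<beta>"
proof -
  have *: False if f: "good c a y f \<alpha>" and g: "good c a y g \<beta>" and "\<alpha> \<lhd> \<beta>"
    and r: "\<And>w. (\<exists>\<gamma>. op \<gamma> w \<lhd> f) \<longleftrightarrow> (\<exists>\<gamma>. op \<gamma> w \<lhd> g)" for f g \<alpha> \<beta>
  proof -
    obtain w where w: "op \<alpha> w \<lhd> g" using g isfun_ex[OF _ \<open>\<alpha> \<lhd> \<beta>\<close>] unfolding good_def by blast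
    then obtain \<gamma> where \<gamma>: "op \<gamma> w \<lhd> f" using r by blast
    then have "\<gamma> \<lhd> \<alpha>" using good_range[OF f] by blast
    moreover have "ord \<beta>" using g by (simp add: good_def)
    ultimately have "\<gamma> \<lhd> \<beta>" using ord_tr \<open>\<alpha> \<lhd> \<beta>\<close> by blast
    then obtain v where v: "op \<gamma> v \<lhd> g" using g isfun_ex unfolding good_def by blast
    have "w = v" using good_agree[OF f g \<gamma> v] .
    with v w good_injective[OF g] have "\<gamma> = \<alpha>" by blast
    with \<open>\<gamma> \<lhd> \<alpha>\<close> irrefl show False by blast
  qed
  have "ord \<alpha>" "ord \<beta>" using f g by (auto simp: good_def)
  with ord_linear *[OF f g] *[OF g f] assms(3) show ?thesis by blast
qed

text \<open>A Hartogs-style bound: since the range determines the length and ranges are subsets of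
  \<open>y\<close>, replacement in \<open>M\<close> over the power set collects all lengths. Their
  union is \<open>\<theta>\<close>.\<close>

lemma ex_good_domain:
  "\<exists>\<theta>. \<theta> \<lhd> M \<and> (\<forall>\<beta>. \<beta> \<lhd> \<theta> \<longleftrightarrow> (\<exists>f \<alpha>. f \<lhd> M \<and> \<alpha> \<lhd> M \<and> good c a y f \<alpha> \<and> \<beta> \<lhd> \<alpha>))"
proof -
  let ?ran = "\<lambda>f X. \<forall>w\<in>el M. w \<lhd> X \<longleftrightarrow> (\<exists>\<gamma>\<in>el M. op \<gamma> w \<lhd> f)"
  let ?R = "\<lambda>X \<alpha>. \<exists>f\<in>el M. good c a y f \<alpha> \<and> ?ran f X"
  obtain P where P: "P \<lhd> M" "\<And>X. X \<lhd> P \<longleftrightarrow> X \<lhd> M \<and> sub X y" using model_power[OF M yM] by metis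
  have fM: "x \<lhd> M \<and> z \<lhd> M" if "f \<lhd> M" "op x z \<lhd> f" for x z f
    using model_op_mem[OF M that] .
  obtain B where B: "B \<lhd> M" "\<And>X. X \<lhd> B \<longleftrightarrow> X \<lhd> P \<and> (\<exists>\<alpha>\<in>el M. ?R X \<alpha>)"
    using separationI[OF M _ _ P(1), of "[c, a, y]"
      "\<^bold>\<exists>\<alpha>. \<^bold>\<exists>f. is_good 0 1 2 f \<alpha> \<^bold>\<and> (\<^bold>\<forall>w. w \<^bold>\<in> 3 \<^bold>\<longleftrightarrow> (\<^bold>\<exists>\<gamma>. app f \<gamma> w))" "\<lambda>X. \<exists>\<alpha>\<in>el M. ?R X \<alpha>"] cM aM yM
    by (auto simp: abs model_tr M)
  have uniq: "\<alpha> = \<beta>" if "X \<lhd> M" "?R X \<alpha>" "?R X \<beta>" for X \<alpha> \<beta>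
  proof -
    from that obtain f g where f: "f \<lhd> M" "good c a y f \<alpha>" "?ran f X" and g: "g \<lhd> M" "good c a y g \<beta>" "?ran g X"
      unfolding bex_el by blast
    have "(\<exists>\<gamma>. op \<gamma> w \<lhd> f) \<longleftrightarrow> (\<exists>\<gamma>. op \<gamma> w \<lhd> g)" for w
      using f(3) g(3) fM[OF f(1)] fM[OF g(1)] unfolding ball_el bex_el by blast
    from good_range_unique[OF f(2) g(2) this] show ?thesis .
  qed
  have "\<exists>b. b \<lhd> M \<and> (\<forall>X. X \<lhd> B \<longrightarrow> (\<exists>\<alpha>. \<alpha> \<lhd> b \<and> ?R X \<alpha>))"
  proof (rule replacementI[OF M _ _ B(1)])
    show "holds (el M) (\<lambda>_. hd [c, a, y]) ([c, a, y] @ [X, \<alpha>])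
        (\<^bold>\<exists>f. is_good 0 1 2 f 4 \<^bold>\<and> (\<^bold>\<forall>w. w \<^bold>\<in> 3 \<^bold>\<longleftrightarrow> (\<^bold>\<exists>\<gamma>. app f \<gamma> w))) \<longleftrightarrow> ?R X \<alpha>"
      if "X \<lhd> B" "X \<lhd> M" "\<alpha> \<lhd> M" for X \<alpha>
      using that(2,3) cM aM yM by (simp add: abs model_tr M)
    fix X assume X: "X \<lhd> B"
    from X have "\<exists>\<alpha>\<in>el M. ?R X \<alpha>" unfolding B by blast
    then obtain \<alpha> where \<alpha>: "\<alpha> \<lhd> M" "?R X \<alpha>" unfolding bex_el[of M "\<lambda>\<alpha>. ?R X \<alpha>"] by blast
    show "\<exists>\<alpha>. \<alpha> \<lhd> M \<and> (\<forall>z. z \<lhd> M \<longrightarrow> (?R X z \<longleftrightarrow> z = \<alpha>))"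
    proof (intro exI[of _ \<alpha>] conjI allI impI iffI)
      fix z assume "?R X z"
      from uniq[OF model_mem[OF M B(1) X] this \<alpha>(2)] show "z = \<alpha>" .
    next
      fix z assume "z = \<alpha>"
      with \<alpha>(2) show "?R X z" by (simp only:)
    qed (rule \<alpha>(1))
  qed (use cM aM yM in auto)
  then obtain b where b: "b \<lhd> M" "\<And>X. X \<lhd> B \<Longrightarrow> \<exists>\<alpha>. \<alpha> \<lhd> b \<and> ?R X \<alpha>" by blast
  have inb: "\<alpha> \<lhd> b" if f: "f \<lhd> M" "\<alpha> \<lhd> M" "good c a y f \<alpha>" for f \<alpha>
  proof -
    obtain X where X: "X \<lhd> M" "\<And>w. w \<lhd> X \<longleftrightarrow> w \<lhd> y \<and> (\<exists>\<gamma>\<in>el M. op \<gamma> w \<lhd> f)"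
      using separationI[OF M _ _ yM, of "[f]" "\<^bold>\<exists>\<gamma>. app 0 \<gamma> 1" "\<lambda>w. \<exists>\<gamma>\<in>el M. op \<gamma> w \<lhd> f"] f(1)
      by (auto simp: abs model_tr M)
    have "?R X \<alpha>" using f good_range[OF f(3)] unfolding X bex_el ball_el by blast
    moreover have "sub X y" unfolding sub_def X by blast
    ultimately have "X \<lhd> B" using X(1) f(2) unfolding B P bex_el[of M "\<lambda>\<alpha>. ?R X \<alpha>"] by blast
    then obtain \<beta> where \<beta>: "\<beta> \<lhd> b" "?R X \<beta>" using b(2) by blast
    from uniq[OF X(1) \<open>?R X \<alpha>\<close> \<beta>(2)] \<beta>(1) show ?thesis by simp
  qed
  \<comment> \<open>The set \<open>b\<close> from replacement may have further elements, so the
    ordinals below actual lengths are separated from its union.\<close>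
  obtain \<theta> where \<theta>: "\<theta> \<lhd> M" "\<And>\<beta>. \<beta> \<lhd> \<theta> \<longleftrightarrow> \<beta> \<lhd> un b \<and> (\<exists>f\<in>el M. \<exists>\<alpha>\<in>el M. good c a y f \<alpha> \<and> \<beta> \<lhd> \<alpha>)"
    using separationI[OF M _ _ model_un[OF M b(1)], of "[c, a, y]" "\<^bold>\<exists>f. \<^bold>\<exists>\<alpha>. is_good 0 1 2 f \<alpha> \<^bold>\<and> 3 \<^bold>\<in> \<alpha>"
      "\<lambda>\<beta>. \<exists>f\<in>el M. \<exists>\<alpha>\<in>el M. good c a y f \<alpha> \<and> \<beta> \<lhd> \<alpha>"] cM aM yM
    by (auto simp: abs model_tr M)
  have "\<beta> \<lhd> \<theta> \<longleftrightarrow> (\<exists>f \<alpha>. f \<lhd> M \<and> \<alpha> \<lhd> M \<and> good c a y f \<alpha> \<and> \<beta> \<lhd> \<alpha>)" for \<beta>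
    unfolding \<theta> bex_el un using inb by blast
  with \<theta>(1) show ?thesis by blast
qed

text \<open>The union \<open>F\<close> of all lists in \<open>M\<close> is again a list, of length
  \<open>\<theta>\<close>. If it missed an element of \<open>y\<close>, one more choice would give a
  list of length \<open>suc \<theta>\<close>, and \<open>\<theta>\<close> would be an element of
  itself.\<close>

lemma ex_enumeration: "\<exists>\<theta> F. \<theta> \<lhd> M \<and> good c a y F \<theta> \<and> (\<forall>z. z \<lhd> y \<longrightarrow> (\<exists>\<beta>. op \<beta> z \<lhd> F))"
proof -
  obtain \<theta> where \<theta>: "\<theta> \<lhd> M" "\<And>\<beta>. \<beta> \<lhd> \<theta> \<longleftrightarrow> (\<exists>f \<alpha>. f \<lhd> M \<and> \<alpha> \<lhd> M \<and> good c a y f \<alpha> \<and> \<beta> \<lhd> \<alpha>)"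
    using ex_good_domain by metis
  have ordmem: "ord \<beta>" if "\<beta> \<lhd> \<theta>" for \<beta>
    using that ord_mem unfolding \<theta> good_def by blast
  have "x \<lhd> \<theta>" if "x \<lhd> \<beta>" "\<beta> \<lhd> \<theta>" for x \<beta>
    using that ord_tr unfolding \<theta> good_def by blast
  then have ord: "ord \<theta>" using ordmem ord_linear unfolding ord_iff[of \<theta>] tr_def sub_def by blast
  obtain d where d: "d \<lhd> M" "\<And>p. p \<lhd> d \<longleftrightarrow> (\<exists>\<beta> z. \<beta> \<lhd> \<theta> \<and> z \<lhd> y \<and> p = op \<beta> z)"
    using model_prod[OF M \<theta>(1) yM] by metis
  obtain F where F: "F \<lhd> M" "\<And>p. p \<lhd> F \<longleftrightarrow> p \<lhd> d \<and> (\<exists>f\<in>el M. \<exists>\<alpha>\<in>el M. good c a y f \<alpha> \<and> p \<lhd> f)"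
    using separationI[OF M _ _ d(1), of "[c, a, y]" "\<^bold>\<exists>f. \<^bold>\<exists>\<alpha>. is_good 0 1 2 f \<alpha> \<^bold>\<and> 3 \<^bold>\<in> f"
      "\<lambda>p. \<exists>f\<in>el M. \<exists>\<alpha>\<in>el M. good c a y f \<alpha> \<and> p \<lhd> f"] cM aM yM
    by (auto simp: abs model_tr M)
  have op: "op \<beta> z \<lhd> F \<longleftrightarrow> (\<exists>f \<alpha>. f \<lhd> M \<and> \<alpha> \<lhd> M \<and> good c a y f \<alpha> \<and> op \<beta> z \<lhd> f)" for \<beta> z
  proof -
    have "op \<beta> z \<lhd> d" if "f \<lhd> M" "\<alpha> \<lhd> M" "good c a y f \<alpha>" "op \<beta> z \<lhd> f" for f \<alpha>
      using good_range[OF that(3,4)] that unfolding d \<theta> by blast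
    then show ?thesis unfolding F bex_el by blast
  qed
  have fn: "isfun F \<theta>"
  proof (rule isfunI)
    fix p assume "p \<lhd> F"
    then show "\<exists>\<beta> z. \<beta> \<lhd> \<theta> \<and> p = op \<beta> z" unfolding F d by blast
  next
    fix \<beta> assume "\<beta> \<lhd> \<theta>"
    then obtain f \<alpha> where f: "f \<lhd> M" "\<alpha> \<lhd> M" "good c a y f \<alpha>" "\<beta> \<lhd> \<alpha>" unfolding \<theta> by blast
    then obtain z where "op \<beta> z \<lhd> f" using isfun_ex unfolding good_def by blast
    with f show "\<exists>z. op \<beta> z \<lhd> F" unfolding op by blast
  next
    fix \<beta> z z' assume "op \<beta> z \<lhd> F" "op \<beta> z' \<lhd> F"
    then show "z = z'" unfolding op using good_agree by blast
  qed
  have step: "\<exists>X. X \<lhd> a \<and> (\<forall>z. z \<lhd> X \<longleftrightarrow> z \<lhd> y \<and> \<not> (\<exists>\<gamma>. \<gamma> \<lhd> \<beta> \<and> op \<gamma> z \<lhd> F)) \<and> op X w \<lhd> c" if "op \<beta> w \<lhd> F" for \<beta> w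
  proof -
    from that obtain f \<alpha> where f: "f \<lhd> M" "\<alpha> \<lhd> M" "good c a y f \<alpha>" "op \<beta> w \<lhd> f" unfolding op by blast
    have "op \<gamma> z \<lhd> F \<longleftrightarrow> op \<gamma> z \<lhd> f" if \<gamma>: "\<gamma> \<lhd> \<beta>" for \<gamma> z
    proof
      assume "op \<gamma> z \<lhd> F"
      then obtain g \<delta> where g: "good c a y g \<delta>" "op \<gamma> z \<lhd> g" unfolding op by blast
      have fo: "ord \<alpha>" "isfun f \<alpha>" using f(3) by (auto simp: good_def)
      have "\<gamma> \<lhd> \<alpha>" using ord_tr[OF fo(1) _ \<gamma>] good_range[OF f(3,4)] by blast
      then obtain v where v: "op \<gamma> v \<lhd> f" using isfun_ex[OF fo(2)] by blast
      with good_agree[OF f(3) g(1) v g(2)] show "op \<gamma> z \<lhd> f" by simp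
    next
      assume "op \<gamma> z \<lhd> f" with f show "op \<gamma> z \<lhd> F" unfolding op by blast
    qed
    then have "(\<exists>\<gamma>. \<gamma> \<lhd> \<beta> \<and> op \<gamma> z \<lhd> F) \<longleftrightarrow> (\<exists>\<gamma>. \<gamma> \<lhd> \<beta> \<and> op \<gamma> z \<lhd> f)" for z by blast
    with f(3,4) show ?thesis unfolding good_def by simp
  qed
  have gF: "good c a y F \<theta>" unfolding good_def using ord fn step by blast
  have "\<exists>\<beta>. op \<beta> z \<lhd> F" if z: "z \<lhd> y" for z
  proof (rule ccontr)
    assume no: "\<not> ?thesis"
    obtain X where X: "X \<lhd> M" "\<And>z. z \<lhd> X \<longleftrightarrow> z \<lhd> y \<and> \<not> (\<exists>\<gamma>\<in>el M. op \<gamma> z \<lhd> F)"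
      using separationI[OF M _ _ yM, of "[F]" "\<^bold>\<not> (\<^bold>\<exists>\<gamma>. app 0 \<gamma> 1)" "\<lambda>z. \<not> (\<exists>\<gamma>\<in>el M. op \<gamma> z \<lhd> F)"] F(1)
      by (auto simp: abs model_tr M)
    have FM: "x \<lhd> M" if "op x z \<lhd> F" for x z
      using model_mem[OF M F(1) that] model_op_iff[OF M] by blast
    have X2: "z \<lhd> X \<longleftrightarrow> z \<lhd> y \<and> \<not> (\<exists>\<gamma>. op \<gamma> z \<lhd> F)" for z unfolding X bex_el using FM by blast
    have "z \<lhd> X" using z no unfolding X2 by blast
    then have "X \<noteq> zero" by auto
    moreover have "sub X y" unfolding sub_def X2 by blast
    ultimately have "X \<lhd> a" unfolding a using X(1) by blast
    then obtain w where w: "op X w \<lhd> c" using isfun_ex[OF c(1)] by blast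
    have "w \<lhd> y" using c(2)[OF w] X2 by blast
    let ?G = "cup F (up (op \<theta> w) (op \<theta> w))"
    have \<theta>F: "\<not> op \<theta> v \<lhd> F" for v using isfun_mem[OF fn] irrefl by blast
    have G: "op \<beta> v \<lhd> ?G \<longleftrightarrow> op \<beta> v \<lhd> F \<or> \<beta> = \<theta> \<and> v = w" for \<beta> v by simp
    have "isfun ?G (suc \<theta>)"
    proof (rule isfunI)
      fix p assume "p \<lhd> ?G"
      then show "\<exists>\<beta> z. \<beta> \<lhd> suc \<theta> \<and> p = op \<beta> z" using fn unfolding isfun_def by auto
    next
      fix \<beta> assume "\<beta> \<lhd> suc \<theta>"
      then show "\<exists>z. op \<beta> z \<lhd> ?G" using isfun_ex[OF fn] unfolding G suc by blast
    next
      fix \<beta> z z' assume "op \<beta> z \<lhd> ?G" "op \<beta> z' \<lhd> ?G"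
      then show "z = z'" unfolding G using isfun_unique[OF fn] \<theta>F by blast
    qed
    moreover have "\<exists>X. X \<lhd> a \<and> (\<forall>z. z \<lhd> X \<longleftrightarrow> z \<lhd> y \<and> \<not> (\<exists>\<gamma>. \<gamma> \<lhd> \<beta> \<and> op \<gamma> z \<lhd> ?G)) \<and> op X v \<lhd> c"
      if "op \<beta> v \<lhd> ?G" for \<beta> v
    proof -
      have less: "op \<gamma> z \<lhd> ?G \<longleftrightarrow> op \<gamma> z \<lhd> F" if "\<gamma> \<lhd> \<theta>" for \<gamma> z
        using that irrefl unfolding G by blast
      from that consider "op \<beta> v \<lhd> F" | "\<beta> = \<theta>" "v = w" unfolding G by blast
      then show ?thesis
      proof cases
        case 1
        then have "\<gamma> \<lhd> \<theta>" if "\<gamma> \<lhd> \<beta>" for \<gamma> using isfun_mem[OF fn] ord_tr[OF ord _ that] by blast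
        with less have "(\<exists>\<gamma>. \<gamma> \<lhd> \<beta> \<and> op \<gamma> z \<lhd> ?G) \<longleftrightarrow> (\<exists>\<gamma>. \<gamma> \<lhd> \<beta> \<and> op \<gamma> z \<lhd> F)" for z by blast
        with step[OF 1] show ?thesis by simp
      next
        case 2
        \<comment> \<open>Before position \<open>\<theta>\<close> exactly the range of
          \<open>F\<close> has been listed, so \<open>X\<close> is the remaining set there.\<close>
        have "(\<exists>\<gamma>. \<gamma> \<lhd> \<theta> \<and> op \<gamma> z \<lhd> ?G) \<longleftrightarrow> (\<exists>\<gamma>. op \<gamma> z \<lhd> F)" for z
          using less isfun_mem[OF fn] by blast
        with 2 w X2 \<open>X \<lhd> a\<close> show ?thesis by (intro exI[of _ X]) simp
      qed
    qed
    ultimately have "good c a y ?G (suc \<theta>)" unfolding good_def using ord_suc[OF ord] by blast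
    moreover have "?G \<lhd> M" "suc \<theta> \<lhd> M"
      using F(1) \<theta>(1) model_mem[OF M yM \<open>w \<lhd> y\<close>] by (simp_all add: M model_cup model_up model_op model_suc)
    ultimately have "\<theta> \<lhd> \<theta>" unfolding \<theta>(2)[of \<theta>] by (intro exI[of _ ?G] exI[of _ "suc \<theta>"]) simp
    with irrefl show False by blast
  qed
  with \<theta>(1) gF show ?thesis by blast
qed

end

lemma well_ordering:
  assumes M: "model M" and y: "y \<lhd> M"
  shows "\<exists>\<theta> g. \<theta> \<lhd> M \<and> ord \<theta> \<and> mapsto g y \<theta> \<and> injective g"
proof -
  obtain P where P: "P \<lhd> M" "\<And>X. X \<lhd> P \<longleftrightarrow> X \<lhd> M \<and> sub X y" using model_power[OF M y] by metis
  obtain a where a: "a \<lhd> M" "\<And>X. X \<lhd> a \<longleftrightarrow> X \<lhd> P \<and> X \<noteq> zero"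
    using separationI[OF M _ _ P(1), of "[y]" "\<^bold>\<not> is_zero 1" "\<lambda>X. X \<noteq> zero"] y
    by (auto simp: abs model_tr M)
  have "\<forall>a\<in>el M. (\<forall>x\<in>el M. x \<lhd> a \<longrightarrow> x \<noteq> zero) \<longrightarrow>
      (\<exists>f\<in>el M. isfun f a \<and> (\<forall>x\<in>el M. \<forall>y\<in>el M. x \<lhd> a \<and> op x y \<lhd> f \<longrightarrow> y \<lhd> x))"
    using model_axiom[OF M, of ax_choice e0] by (simp add: axiom_forms_def ax_choice_def abs model_tr M)
  with a obtain c where c: "c \<lhd> M" "isfun c a" "\<forall>x\<in>el M. \<forall>y\<in>el M. x \<lhd> a \<and> op x y \<lhd> c \<longrightarrow> y \<lhd> x"
    unfolding ball_el bex_el by blast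
  have c3: "w \<lhd> X" if "op X w \<lhd> c" for X w
    using c(3) isfun_mem[OF c(2) that] model_mem[OF M c(1) that] model_op_iff[OF M] that
    unfolding ball_el by blast
  have a2: "X \<lhd> a \<longleftrightarrow> X \<lhd> M \<and> sub X y \<and> X \<noteq> zero" for X unfolding a P by blast
  note prems = M c(1) a(1) y a2 c(2) c3
  obtain \<theta> F where F: "\<theta> \<lhd> M" "good c a y F \<theta>" "\<forall>z. z \<lhd> y \<longrightarrow> (\<exists>\<beta>. op \<beta> z \<lhd> F)"
    using ex_enumeration[OF prems] by blast
  have fn: "isfun F \<theta>" "ord \<theta>" using F(2) by (auto simp: good_def)
  moreover have "injective F" unfolding injective_def using good_injective[OF prems F(2)] by blast
  moreover have "z \<lhd> y \<longleftrightarrow> (\<exists>x. op x z \<lhd> F)" for z using F(3) good_range[OF prems F(2)] by blast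
  ultimately show ?thesis using ex_inverse[of F \<theta> y] F(1) by blast
qed

subsection \<open>Satisfaction of actual formulas\<close>

text \<open>A model \<open>N\<close> containing \<open>A\<close> contains all assignments too, so
  each connective costs one separation instance in \<open>N\<close>.\<close>

lemma ex_truth_set:
  assumes n: "n \<lhd> om" and p: "\<forall>v\<in>vars p. num v \<lhd> n"
  shows "\<exists>R. \<forall>s. s \<lhd> R \<longleftrightarrow> mapsto s n A \<and> nsat E (el A) (val s) p"
proof -
  obtain N where N: "model N" "set [A] \<subseteq> el N" using ex_model_list by blast
  then have AN: "A \<lhd> N" by simp
  obtain X where X: "X \<lhd> N" "\<And>s. s \<lhd> X \<longleftrightarrow> mapsto s n A" using model_functions[OF N(1) n AN] by metis
  have XN: "op u x \<lhd> s \<Longrightarrow> u \<lhd> N \<and> x \<lhd> N" if "s \<lhd> X" for s u x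
    using model_mem[OF N(1) model_mem[OF N(1) X(1) that]] model_op_iff[OF N(1)] by blast
  have "\<exists>R. R \<lhd> N \<and> (\<forall>s. s \<lhd> R \<longleftrightarrow> s \<lhd> X \<and> nsat E (el A) (val s) p)" using p
  proof (induction p)
    case NFalsum
    show ?case using model_zero[OF N(1)] by (intro exI[of _ zero]) simp
  next
    case (NMem i j)
    then have ij: "num i \<lhd> n" "num j \<lhd> n" by auto
    have *: "val s i \<lhd> val s j \<longleftrightarrow> (\<exists>x\<in>el N. \<exists>y\<in>el N. op (num i) x \<lhd> s \<and> op (num j) y \<lhd> s \<and> x \<lhd> y)"
      if s: "s \<lhd> X" for s
    proof -
      have fn: "isfun s n" using s X(2) by (simp add: mapsto_def)
      show ?thesis using XN[OF s] val[OF fn ij(1)] val[OF fn ij(2)] unfolding bex_el by metis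
    qed
    show ?case
      by (rule separationI[OF N(1) _ _ X(1), of "[num i, num j]" "\<^bold>\<exists>x. \<^bold>\<exists>y. app 2 0 x \<^bold>\<and> app 2 1 y \<^bold>\<and> x \<^bold>\<in> y"])
        (use * model_nat[OF N(1)] num_om in \<open>simp_all add: abs model_tr N(1)\<close>)
  next
    case (NEqu i j)
    then have ij: "num i \<lhd> n" "num j \<lhd> n" by auto
    have *: "val s i = val s j \<longleftrightarrow> (\<exists>x\<in>el N. \<exists>y\<in>el N. op (num i) x \<lhd> s \<and> op (num j) y \<lhd> s \<and> x = y)"
      if s: "s \<lhd> X" for s
    proof -
      have fn: "isfun s n" using s X(2) by (simp add: mapsto_def)
      show ?thesis using XN[OF s] val[OF fn ij(1)] val[OF fn ij(2)] unfolding bex_el by metis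
    qed
    show ?case
      by (rule separationI[OF N(1) _ _ X(1), of "[num i, num j]" "\<^bold>\<exists>x. \<^bold>\<exists>y. app 2 0 x \<^bold>\<and> app 2 1 y \<^bold>\<and> x \<^bold>= y"])
        (use * model_nat[OF N(1)] num_om in \<open>simp_all add: abs model_tr N(1)\<close>)
  next
    case (NImpl p q)
    then obtain R T where RT: "R \<lhd> N" "\<And>s. s \<lhd> R \<longleftrightarrow> s \<lhd> X \<and> nsat E (el A) (val s) p"
      "T \<lhd> N" "\<And>s. s \<lhd> T \<longleftrightarrow> s \<lhd> X \<and> nsat E (el A) (val s) q" by auto
    show ?case
      by (rule separationI[OF N(1) _ _ X(1), of "[R, T]" "2 \<^bold>\<in> 0 \<^bold>\<longrightarrow> 2 \<^bold>\<in> 1"])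
        (use RT in \<open>simp_all add: abs model_tr N(1)\<close>)
  next
    case (NForall u p)
    then have u: "num u \<lhd> n" by simp
    from NForall obtain R where R: "R \<lhd> N" "\<And>s. s \<lhd> R \<longleftrightarrow> s \<lhd> X \<and> nsat E (el A) (val s) p" by auto
    have *: "nsat E (el A) (val s) (NForall u p) \<longleftrightarrow>
        (\<forall>t\<in>el N. t \<lhd> X \<and> (\<forall>j\<in>el N. \<forall>x\<in>el N. j \<noteq> num u \<longrightarrow> (op j x \<lhd> t \<longleftrightarrow> op j x \<lhd> s)) \<longrightarrow> t \<lhd> R)"
      if s: "s \<lhd> X" for s
    proof -
      have "nsat E (el A) (val s) (NForall u p) \<longleftrightarrow>
          (\<forall>t. mapsto t n A \<and> (\<forall>j x. j \<noteq> num u \<longrightarrow> (op j x \<lhd> t \<longleftrightarrow> op j x \<lhd> s)) \<longrightarrow> nsat E (el A) (val t) p)"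
        using all_variants[of s n A u "\<lambda>v. nsat E (el A) v p"] s X(2) u by (simp add: ball_el)
      moreover have "(\<forall>j\<in>el N. \<forall>x\<in>el N. j \<noteq> num u \<longrightarrow> (op j x \<lhd> t \<longleftrightarrow> op j x \<lhd> s)) \<longleftrightarrow>
          (\<forall>j x. j \<noteq> num u \<longrightarrow> (op j x \<lhd> t \<longleftrightarrow> op j x \<lhd> s))" if "t \<lhd> X" for t
        using XN[OF s] XN[OF that] unfolding ball_el by blast
      ultimately show ?thesis
        using R(2) X(2) model_mem[OF N(1) X(1)] unfolding ball_el[of N "\<lambda>t. t \<lhd> X \<and> _ t \<longrightarrow> _ t"] by blast
    qed
    show ?case
      by (rule separationI[OF N(1) _ _ X(1), of "[num u, X, R]"
          "\<^bold>\<forall>t. t \<^bold>\<in> 1 \<^bold>\<and> (\<^bold>\<forall>j. \<^bold>\<forall>x. \<^bold>\<not> j \<^bold>= 0 \<^bold>\<longrightarrow> (app t j x \<^bold>\<longleftrightarrow> app 3 j x)) \<^bold>\<longrightarrow> t \<^bold>\<in> 2"])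
        (use * R(1) X(1) model_nat[OF N(1) num_om] in \<open>simp_all add: abs model_tr N(1) del: nsat.simps\<close>)
  qed
  then show ?thesis unfolding X(2) by blast
qed

text \<open>The counterpart of \<open>bridge\<close>: to assert satisfaction internally, a
  satisfaction relation must exist. It is the finite union, over the subformulas, of the singleton
  of the code times the truth set.\<close>

lemma ex_evals:
  assumes n: "n \<lhd> om" and p: "\<forall>v\<in>vars p. num v \<lhd> n"
  shows "\<exists>S. evals S A (ncode p) n"
proof -
  let ?qs = "set (subs p)"
  have "\<exists>R. \<forall>s. s \<lhd> R \<longleftrightarrow> mapsto s n A \<and> nsat E (el A) (val s) q" if "q \<in> ?qs" for q
    using ex_truth_set[OF n] vars_subs[OF that] p by blast
  then obtain R where R: "\<And>q s. q \<in> ?qs \<Longrightarrow> s \<lhd> R q \<longleftrightarrow> mapsto s n A \<and> nsat E (el A) (val s) q" by metis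
  have "\<exists>S. \<forall>z. z \<lhd> S \<longleftrightarrow> (\<exists>q\<in>set qs. \<exists>s. s \<lhd> R q \<and> z = op (ncode q) s)" for qs
  proof (induction qs)
    case (Cons q qs)
    then obtain S where S: "\<And>z. z \<lhd> S \<longleftrightarrow> (\<exists>q\<in>set qs. \<exists>s. s \<lhd> R q \<and> z = op (ncode q) s)" by blast
    obtain C where C: "\<And>z. z \<lhd> C \<longleftrightarrow> (\<exists>x y. x \<lhd> up (ncode q) (ncode q) \<and> y \<lhd> R q \<and> z = op x y)"
      using ex_prod by metis
    have "z \<lhd> cup S C \<longleftrightarrow> (\<exists>q\<in>set (q # qs). \<exists>s. s \<lhd> R q \<and> z = op (ncode q) s)" for z
      by (auto simp: S C)
    then show ?case by blast
  qed (auto intro: exI[of _ zero])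
  then obtain S where "\<And>z. z \<lhd> S \<longleftrightarrow> (\<exists>q\<in>?qs. \<exists>s. s \<lhd> R q \<and> z = op (ncode q) s)" by metis
  \<comment> \<open>Coding is injective, so the rows of different subformulas do not mix.\<close>
  then have S: "op (ncode q) s \<lhd> S \<longleftrightarrow> mapsto s n A \<and> nsat E (el A) (val s) q" if "q \<in> ?qs" for q s
    using that R[OF that] by (auto simp: ncode_eq)
  obtain f k where f: "k \<lhd> om" "fseq f k n"
    "\<And>i c. op i c \<lhd> f \<longleftrightarrow> (\<exists>m<length (subs p). i = num m \<and> c = ncode (subs p ! m))"
    using ex_formation[OF p] by metis
  have dom: "\<exists>q\<in>?qs. c = ncode q" if "op i c \<lhd> f" for i c using that unfolding f(3) by auto
  have "satrel A n f S"
    unfolding satrel_def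
  proof (intro allI impI, elim conjE)
    fix i c s assume "op i c \<lhd> f" and s: "mapsto s n A"
    then obtain q where q: "q \<in> ?qs" "c = ncode q" using dom by blast
    note sub = subs_trans[OF q(1)] and vq = vars_subs[OF q(1)]
    have fn: "isfun s n" using s by (simp add: mapsto_def)
    have ex: "(\<exists>x y. op (num i) x \<lhd> s \<and> op (num j) y \<lhd> s \<and> Q x y) \<longleftrightarrow> Q (val s i) (val s j)"
      if "i \<in> vars q" "j \<in> vars q" for i j Q
    proof -
      have "num i \<lhd> n" "num j \<lhd> n" using that vq p by auto
      then show ?thesis by (simp add: val[OF fn])
    qed
    show "tarski A n S c s"
    proof (cases q)
      case NFalsum
      then show ?thesis using S[OF q(1)] q(2) s by (simp add: tarski_def)
    next
      case (NMem i j)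
      have "op c s \<lhd> S \<longleftrightarrow> (\<exists>x y. op (num i) x \<lhd> s \<and> op (num j) y \<lhd> s \<and> x \<lhd> y)"
        using S[OF q(1), of s] s q(2) NMem ex[of i j "\<lambda>x y. x \<lhd> y"] by simp
      then show ?thesis using q(2) NMem by (simp add: tarski_def)
    next
      case (NEqu i j)
      have "op c s \<lhd> S \<longleftrightarrow> (\<exists>x y. op (num i) x \<lhd> s \<and> op (num j) y \<lhd> s \<and> x = y)"
        using S[OF q(1), of s] s q(2) NEqu ex[of i j "\<lambda>x y. x = y"] by simp
      then show ?thesis using q(2) NEqu by (simp add: tarski_def)
    next
      case (NImpl q1 q2)
      then have "q1 \<in> ?qs" "q2 \<in> ?qs" using sub subs_self by auto
      then have "op c s \<lhd> S \<longleftrightarrow> (op (ncode q1) s \<lhd> S \<longrightarrow> op (ncode q2) s \<lhd> S)"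
        using S[OF q(1), of s] S[of q1 s] S[of q2 s] NImpl q(2) s by simp
      then show ?thesis using q(2) NImpl by (simp add: tarski_def)
    next
      case (NForall u r)
      then have r: "r \<in> ?qs" using sub subs_self by auto
      have "num u \<lhd> n" using NForall vq p by auto
      with all_variants[OF s this, of "\<lambda>v. nsat E (el A) v r"] s
      have "nsat E (el A) (val s) q \<longleftrightarrow>
        (\<forall>t. mapsto t n A \<and> (\<forall>j x. j \<noteq> num u \<longrightarrow> (op j x \<lhd> t \<longleftrightarrow> op j x \<lhd> s)) \<longrightarrow> op (ncode r) t \<lhd> S)"
        unfolding NForall nsat.simps ball_el S[OF r] by blast
      with S[OF q(1), of s] s q(2) NForall show ?thesis by (simp add: tarski_def)
    qed
  qed
  moreover obtain m where "m < length (subs p)" "subs p ! m = p"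
    using subs_self[of p] by (auto simp: in_set_conv_nth)
  then have "op (num m) (ncode p) \<lhd> f" unfolding f(3) by auto
  ultimately show ?thesis unfolding evals_iff using n f(1,2) by blast
qed

definition modsless :: "'a \<Rightarrow> 'a \<Rightarrow> 'a \<Rightarrow> bool" where
  "modsless M x y \<longleftrightarrow> (\<exists>s. op (num 0) x \<lhd> s \<and> op (num 1) y \<lhd> s \<and>
     (\<exists>n S. evals S M (ncode (named (card_less 0 1 2) 2)) n \<and> mapsto s n M \<and>
       op (ncode (named (card_less 0 1 2) 2)) s \<lhd> S))"

lemma absU_models_less: "M < length xs \<Longrightarrow> x < length xs \<Longrightarrow> y < length xs \<Longrightarrow>
    holds UNIV e xs (models_card_less M x y) \<longleftrightarrow> modsless (xs ! M) (xs ! x) (xs ! y)"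
  by (auto simp: models_card_less_def modsless_def satisfies_def absU_evaluates abs nth_append)

lemma nsat_card_less:
  assumes "v 0 = x" "v 1 = y"
  shows "nsat E D v (named (card_less 0 1 2) 2) \<longleftrightarrow> holds D (\<lambda>_. x) [x, y] (card_less 0 1)"
proof -
  have "(\<lambda>i. v (2 - Suc i)) = env (\<lambda>_. x) [x, y]"
    using assms by (auto simp: fun_eq_iff env_def numeral_2_eq_2 less_Suc_eq diff_Suc split: nat.split)
  then show ?thesis by (simp add: nsat_named holds_def numeral_2_eq_2)
qed

text \<open>Reduces the coded satisfaction statement of TMA to truth in \<open>el M\<close>:
  \<open>bridge\<close> reads off a given satisfaction relation, and \<open>ex_evals\<close>
  supplies one for the converse.\<close>

lemma modsless_iff:
  assumes M: "model M" and x: "x \<lhd> M" and y: "y \<lhd> M"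
  shows "modsless M x y \<longleftrightarrow> holds (el M) (\<lambda>_. x) [x, y] (card_less 0 1)"
proof
  let ?p = "named (card_less 0 1 2) 2"
  assume "modsless M x y"
  then obtain s n S where s: "op (num 0) x \<lhd> s" "op (num 1) y \<lhd> s" "evals S M (ncode ?p) n" "mapsto s n M"
    "op (ncode ?p) s \<lhd> S" unfolding modsless_def by blast
  then obtain f k i where f: "fseq f k n" "op i (ncode ?p) \<lhd> f" "satrel M n f S" unfolding evals_iff by blast
  have "nsat E (el M) (val s) ?p" using bridge[OF f(1,3,2)] s(4,5) by blast
  moreover have "val s 0 = x" "val s 1 = y"
    using s(1,2,4) isfun_mem val unfolding mapsto_def by metis+
  ultimately show "holds (el M) (\<lambda>_. x) [x, y] (card_less 0 1)" using nsat_card_less by blast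
next
  let ?p = "named (card_less 0 1 2) 2"
  assume h: "holds (el M) (\<lambda>_. x) [x, y] (card_less 0 1)"
  \<comment> \<open>Including \<open>1\<close> makes both named variables belong to the domain
    \<open>num K\<close> of the assignment.\<close>
  obtain K where K: "\<forall>v\<in>insert 1 (vars ?p). v < K"
    using finite_nat_set_iff_bounded[of "insert 1 (vars ?p)"] finite_vars by auto
  then have K2: "0 < K" "1 < K" by auto
  have vK: "\<forall>v\<in>vars ?p. num v \<lhd> num K" using K by simp
  obtain S where S: "evals S M (ncode ?p) (num K)" using ex_evals[OF num_om vK] by blast
  then obtain f k i where f: "fseq f k (num K)" "op i (ncode ?p) \<lhd> f" "satrel M (num K) f S"
    unfolding evals_iff by blast
  have "\<exists>s. mapsto s (num K) M \<and> (\<forall>i<K. num i \<lhd> num K \<longrightarrow> val s i = (if i = 0 then x else y))"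
    by (rule ex_assignment) (use x y in simp)
  then obtain s where s: "mapsto s (num K) M" "\<forall>i<K. num i \<lhd> num K \<longrightarrow> val s i = (if i = 0 then x else y)"
    by blast
  then have v: "val s 0 = x" "val s 1 = y" using K2 by auto
  have "op (num 0) x \<lhd> s" "op (num 1) y \<lhd> s"
    using val[of s "num K" 0 x] val[of s "num K" 1 y] s(1) v K2 unfolding mapsto_def mem_num_num by blast+
  moreover have "op (ncode ?p) s \<lhd> S"
    using bridge[OF f(1,3,2)] s(1) nsat_card_less[of "val s" x y "el M"] v h by blast
  ultimately show "modsless M x y" unfolding modsless_def using S s(1) by blast
qed

lemma card_less_in:
  assumes "model M" "x \<lhd> M" "y \<lhd> M"
  shows "holds (el M) e [x, y] (card_less 0 1) \<longleftrightarrow> (\<exists>f. f \<lhd> M \<and> mapsto f x y \<and> injective f) \<and>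
    \<not> (\<exists>f. f \<lhd> M \<and> mapsto f x y \<and> injective f \<and> (\<forall>z. z \<lhd> y \<longrightarrow> (\<exists>u. op u z \<lhd> f)))"
proof -
  have "holds (el M) e [x, y] (card_less 0 1) \<longleftrightarrow> (\<exists>f\<in>el M. mapsto f x y \<and> injective f) \<and>
    \<not> (\<exists>f\<in>el M. mapsto f x y \<and> injective f \<and> (\<forall>z\<in>el M. z \<lhd> y \<longrightarrow> (\<exists>u\<in>el M. op u z \<lhd> f)))"
    using assms by (simp add: card_less_def card_le_def card_eq_def abs model_tr)
  moreover have "(\<forall>z\<in>el M. z \<lhd> y \<longrightarrow> (\<exists>u\<in>el M. op u z \<lhd> f)) \<longleftrightarrow> (\<forall>z. z \<lhd> y \<longrightarrow> (\<exists>u. op u z \<lhd> f))"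
    if "f \<lhd> M" for f
    using model_mem[OF assms(1) assms(3)] model_mem[OF assms(1) that] model_op_iff[OF assms(1)]
    unfolding ball_el bex_el by blast
  ultimately show ?thesis unfolding bex_el by blast
qed

subsection \<open>Greatest cardinality and tall models\<close>

lemma holds_GC: "holds UNIV e [] GC \<longleftrightarrow> (\<exists>\<kappa>. ord \<kappa> \<and> (\<forall>y. \<exists>f. mapsto f y \<kappa> \<and> injective f))"
  by (simp add: GC_def card_le_def abs)

lemma holds_TMA: "holds UNIV e [] TMA \<longleftrightarrow> (\<forall>\<kappa>. ord \<kappa> \<longrightarrow> (\<exists>\<alpha>. ord \<alpha> \<and> \<kappa> \<lhd> \<alpha> \<and>
    (\<forall>\<delta>. ord \<delta> \<and> (\<alpha> \<lhd> \<delta> \<or> \<alpha> = \<delta>) \<longrightarrow> (\<exists>M. model M \<and> \<delta> \<lhd> M \<and> modsless M \<kappa> \<alpha>))))"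
  by (simp add: TMA_def abs absU_model absU_models_less)

lemma TMA_if_not_GC:
  assumes \<kappa>: "ord \<kappa>" and y: "\<not> (\<exists>f. mapsto f y \<kappa> \<and> injective f)"
  shows "\<exists>\<alpha>. ord \<alpha> \<and> \<kappa> \<lhd> \<alpha> \<and>
    (\<forall>\<delta>. ord \<delta> \<and> (\<alpha> \<lhd> \<delta> \<or> \<alpha> = \<delta>) \<longrightarrow> (\<exists>M. model M \<and> \<delta> \<lhd> M \<and> modsless M \<kappa> \<alpha>))"
proof -
  obtain N where N: "y \<lhd> N" "model N" using ex_model by blast
  obtain \<alpha> g where \<alpha>: "ord \<alpha>" and g: "mapsto g y \<alpha>" "injective g" using well_ordering[OF N(2,1)] by blast
  have "\<not> sub \<alpha> \<kappa>"
  proof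
    assume "sub \<alpha> \<kappa>"
    then have "mapsto g y \<kappa>" using g(1) unfolding mapsto_def sub_def by blast
    with g(2) y show False by blast
  qed
  with ord_sub[OF \<alpha> \<kappa>] ord_linear[OF \<kappa> \<alpha>] have \<kappa>\<alpha>: "\<kappa> \<lhd> \<alpha>" by blast
  have "\<exists>M. model M \<and> \<delta> \<lhd> M \<and> modsless M \<kappa> \<alpha>" if "\<alpha> \<lhd> \<delta> \<or> \<alpha> = \<delta>" for \<delta>
  proof -
    obtain M where M: "\<delta> \<lhd> M" "model M" using ex_model by blast
    then have \<alpha>M: "\<alpha> \<lhd> M" using that model_mem by blast
    have \<kappa>M: "\<kappa> \<lhd> M" using model_mem[OF M(2) \<alpha>M \<kappa>\<alpha>] .
    have "sub \<kappa> \<alpha>" using ord_sub[OF \<kappa> \<alpha>] \<kappa>\<alpha> by blast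
    from model_identity[OF M(2) \<kappa>M \<alpha>M this] obtain i where i: "i \<lhd> M \<and> mapsto i \<kappa> \<alpha> \<and> injective i" by blast
    \<comment> \<open>A bijection is excluded even in the universe: its inverse after
      \<open>g\<close> would inject \<open>y\<close> into \<open>\<kappa>\<close>.\<close>
    have "False" if f: "mapsto f \<kappa> \<alpha>" "injective f" "\<forall>z. z \<lhd> \<alpha> \<longrightarrow> (\<exists>u. op u z \<lhd> f)" for f
    proof -
      have "isfun f \<kappa>" using f(1) by (simp add: mapsto_def)
      moreover have "z \<lhd> \<alpha> \<longleftrightarrow> (\<exists>u. op u z \<lhd> f)" for z using f(1,3) unfolding mapsto_def by blast
      ultimately obtain h where "mapsto h \<alpha> \<kappa>" "injective h" using ex_inverse[of f \<kappa> \<alpha>] f(2) by blast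
      from ex_comp[OF g this] y show False by blast
    qed
    with i have "holds (el M) (\<lambda>_. \<kappa>) [\<kappa>, \<alpha>] (card_less 0 1)"
      unfolding card_less_in[OF M(2) \<kappa>M \<alpha>M] by blast
    then show ?thesis using M modsless_iff[OF M(2) \<kappa>M \<alpha>M] by blast
  qed
  with \<alpha> \<kappa>\<alpha> show ?thesis by blast
qed

lemma GC_contradicts_TMA:
  assumes VL: "holds UNIV e [] V_eq_L"
    and \<kappa>: "ord \<kappa>" "\<And>y. \<exists>f. mapsto f y \<kappa> \<and> injective f"
    and \<alpha>: "ord \<alpha>" "\<kappa> \<lhd> \<alpha>"
    and tall: "\<And>\<delta>. ord \<delta> \<Longrightarrow> \<alpha> \<lhd> \<delta> \<or> \<alpha> = \<delta> \<Longrightarrow> \<exists>M. model M \<and> \<delta> \<lhd> M \<and> modsless M \<kappa> \<alpha>"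
  shows False
proof -
  obtain f where f: "mapsto f \<alpha> \<kappa>" "injective f" using \<kappa>(2) by blast
  have "\<forall>x. \<exists>\<beta> y. ord \<beta> \<and> (\<exists>h \<gamma>. Lseq h \<gamma> \<and> \<beta> \<lhd> \<gamma> \<and> op \<beta> y \<lhd> h) \<and> x \<lhd> y"
    using VL by (simp add: V_eq_L_def is_L_def abs absU_L_hierarchy)
  then obtain \<beta> y h \<gamma> where h: "Lseq h \<gamma>" "op \<beta> y \<lhd> h" "f \<lhd> y" by blast
  then have "ord \<gamma>" by (simp add: Lseq_def)
  \<comment> \<open>The larger of \<open>\<alpha>\<close> and the hierarchy's length
    \<open>\<gamma>\<close>: a model containing it contains both, which is what the absoluteness of
    the hierarchy requires.\<close>
  then obtain \<delta> where \<delta>: "ord \<delta>" "\<alpha> \<lhd> \<delta> \<or> \<alpha> = \<delta>" "\<gamma> \<lhd> \<delta> \<or> \<gamma> = \<delta>"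
    using \<alpha>(1) ord_linear by blast
  then obtain M where M: "model M" "\<delta> \<lhd> M" "modsless M \<kappa> \<alpha>" using tall by blast
  have M\<alpha>: "\<alpha> \<lhd> M" and "\<gamma> \<lhd> M" using \<delta> M(2) model_mem[OF M(1)] by blast+
  then have "f \<lhd> M" using Lseq_model[OF M(1) h(1) _ h(2)] h(3) model_mem[OF M(1)] by blast
  moreover have M\<kappa>: "\<kappa> \<lhd> M" using model_mem[OF M(1) M\<alpha> \<alpha>(2)] .
  moreover have "sub \<kappa> \<alpha>" using ord_sub[OF \<kappa>(1) \<alpha>(1)] \<alpha>(2) by blast
  ultimately obtain g where "g \<lhd> M \<and> mapsto g \<kappa> \<alpha> \<and> injective g \<and> (\<forall>z. z \<lhd> \<alpha> \<longrightarrow> (\<exists>u. op u z \<lhd> g))"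
    using model_Schroeder_Bernstein[OF M(1) _ M\<alpha>] f by blast
  moreover have "holds (el M) (\<lambda>_. \<kappa>) [\<kappa>, \<alpha>] (card_less 0 1)"
    using M(3) modsless_iff[OF M(1) M\<kappa> M\<alpha>] by blast
  ultimately show False unfolding card_less_in[OF M(1) M\<kappa> M\<alpha>] by blast
qed

end

theorem corollary5p10:
  shows "LZFC \<union> {sentence V_eq_L} \<turnstile> Iff (Neg (sentence TMA)) (sentence GC)"
proof (rule completeness_UNIV)
  fix E :: "nat \<Rightarrow> nat \<Rightarrow> bool" and e
  assume T: "\<And>p. p \<in> LZFC \<union> {sentence V_eq_L} \<Longrightarrow> sat E UNIV e p"
  interpret lzfc E e by unfold_locales (use T in blast)
  have VL: "holds UNIV e [] V_eq_L" using T holds_sentence by blast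
  have "holds UNIV e [] TMA" if no: "\<not> holds UNIV e [] GC"
    unfolding holds_TMA
  proof (intro allI impI)
    fix \<kappa> assume \<kappa>: "ord \<kappa>"
    with no obtain y where "\<not> (\<exists>f. mapsto f y \<kappa> \<and> injective f)" unfolding holds_GC by blast
    with \<kappa> show "\<exists>\<alpha>. ord \<alpha> \<and> E \<kappa> \<alpha> \<and>
        (\<forall>\<delta>. ord \<delta> \<and> (E \<alpha> \<delta> \<or> \<alpha> = \<delta>) \<longrightarrow> (\<exists>M. model M \<and> E \<delta> M \<and> modsless M \<kappa> \<alpha>))"
      by (rule TMA_if_not_GC)
  qed
  moreover have False if GC: "holds UNIV e [] GC" and TMA: "holds UNIV e [] TMA"
  proof -
    obtain \<kappa> where \<kappa>: "ord \<kappa>" "\<forall>y. \<exists>f. mapsto f y \<kappa> \<and> injective f"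
      using GC unfolding holds_GC by blast
    with TMA obtain \<alpha> where \<alpha>: "ord \<alpha>" "E \<kappa> \<alpha>"
      "\<forall>\<delta>. ord \<delta> \<and> (E \<alpha> \<delta> \<or> \<alpha> = \<delta>) \<longrightarrow> (\<exists>M. model M \<and> E \<delta> M \<and> modsless M \<kappa> \<alpha>)"
      unfolding holds_TMA by blast
    show False
      by (rule GC_contradicts_TMA[OF VL \<kappa>(1) _ \<alpha>(1,2)]) (use \<kappa>(2) \<alpha>(3) in blast)+
  qed
  ultimately have "\<not> holds UNIV e [] TMA \<longleftrightarrow> holds UNIV e [] GC" by blast
  then show "sat E UNIV e (Iff (Neg (sentence TMA)) (sentence GC))"
    by (simp add: holds_sentence)
qed (auto simp: LZFC_def BST_def)

end
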